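(* Let $\kappa,\chi\in\mathbb{R}$ and let $\mathfrak{g}$ be the three-dimensional Lie algebra with basis $X_1,X_2,X_3$ and relations $[X_1,X_2]=X_3$, $[X_1,X_3]=(\kappa+\chi)X_2$, $[X_2,X_3]=(\kappa-\chi)X_1$. Consider the left-invariant contact sub-Lorentzian structure on a Lie group with Lie algebra $\mathfrak{g}$ given by $\Delta_{\mathrm{id}}=\operatorname{span}\{X_1,X_2\}$, $q(X_1,X_1)=-1$, $q(X_1,X_2)=0$, $q(X_2,X_2)=1$, time orientation given by the left-invariant field generated by $X_1$. (2) If $\kappa<\chi<0$, then $\mathfrak{g}\cong\mathfrak{sl}_2(\mathbb{R})$, and on the simply connected group $\widetilde{\mathrm{SL}}_2(\mathbb{R})$ (universal cover of $\mathrm{SL}_2(\mathbb{R})$) for any two points $x_0,x_1$ there exists a longest arc from $x_0$ to $x_1$ if and only if $x_1$ is attainable from $x_0$. (3) If $\chi<0$ and $|\kappa|<-\chi$, then $\mathfrak{g}\cong\mathfrak{su}_2$, and on the Lie group $\mathrm{SU}_2$, for any points $x_0,x_1$ connectable by an admissible curve, the sub-Lorentzian distance from $x_0$ to $x_1$ equals $+\infty$ (so no longest arcs exist).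
   Context: A sub-Lorentzian structure on a manifold $M$ is a smooth completely non-integrable distribution $\Delta$ with a smooth Lorentzian metric $q$ on it; it is left-invariant on a Lie group if $\Delta$ and $q$ are invariant under left shifts. A time orientation is a vector field $V$ with $V_x\in\Delta_x$, $q_x(V_x,V_x)<0$. The cone of admissible velocities is $C^+_x=\{v\in\Delta_x : q_x(v,v)\le 0,\ q_x(V_x,v)\le 0\}$. An admissible curve is a Lipschitz curve $x:[0,t_1]\to M$ with $\dot x(t)\in C^+_{x(t)}$ for almost all $t$; its length is $\int_0^{t_1}\sqrt{|q_{x(t)}(\dot x(t),\dot x(t))|}\,dt$. A point $x_1$ is attainable from $x_0$ if there is an admissible curve from $x_0$ to $x_1$. The sub-Lorentzian distance from $x_0$ to $x_1$ is the supremum of lengths of admissible curves from $x_0$ to $x_1$; a longest arc is an admissible curve attaining this (finite) supremum. *)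

theory Defs
  imports "HOL-Analysis.Analysis"
begin

definition lie_br :: "'k::comm_ring_1^'n^'n \<Rightarrow> 'k^'n^'n \<Rightarrow> 'k^'n^'n" where
  "lie_br A B = A ** B - B ** A"

definition mtrace :: "'k::comm_ring_1^'n^'n \<Rightarrow> 'k" where
  "mtrace A = (\<Sum>i\<in>UNIV. A $ i $ i)"

definition cstar :: "complex^'n^'n \<Rightarrow> complex^'n^'n" where
  "cstar A = (\<chi> i j. cnj (A $ j $ i))"

definition sl2_alg :: "(real^2^2) set" where
  "sl2_alg = {A. mtrace A = 0}"

definition su2_alg :: "(complex^2^2) set" where
  "su2_alg = {A. cstar A = - A \<and> mtrace A = 0}"

text \<open>Real matrices X1 X2 X3 forming a basis of the (real) Lie algebra L and satisfying
  [X1,X2] = X3, [X1,X3] = (kappa+chi) X2, [X2,X3] = (kappa-chi) X1.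
  Such a triple is exactly a Lie algebra isomorphism from the abstract algebra g onto L.\<close>
definition g_frame :: "('k::{real_normed_field}^'n^'n) set \<Rightarrow> real \<Rightarrow> real \<Rightarrow>
    'k^'n^'n \<Rightarrow> 'k^'n^'n \<Rightarrow> 'k^'n^'n \<Rightarrow> bool" where
  "g_frame L kap chi X1 X2 X3 \<longleftrightarrow>
     X1 \<in> L \<and> X2 \<in> L \<and> X3 \<in> L \<and>
     independent {X1, X2, X3} \<and> card {X1, X2, X3} = 3 \<and>
     (\<forall>A\<in>L. A \<in> span {X1, X2, X3}) \<and>
     lie_br X1 X2 = X3 \<and>
     lie_br X1 X3 = (kap + chi) *\<^sub>R X2 \<and>
     lie_br X2 X3 = (kap - chi) *\<^sub>R X1"

definition SL2 :: "(real^2^2) set" where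
  "SL2 = {g. det g = 1}"

definition SU2 :: "(complex^2^2) set" where
  "SU2 = {g. g ** cstar g = mat 1 \<and> det g = 1}"

text \<open>Universal cover of SL2(R): pairs (g, theta) with g in SL2(R) and theta a
  continuous argument of the first column of g; the covering map is fst.
  (This subset of real^2^2 x real is homeomorphic to R_{>0} x R x R.)\<close>
definition USL2 :: "((real^2^2) \<times> real) set" where
  "USL2 = {(g, \<theta>). g \<in> SL2 \<and>
     (\<exists>r>0. g $ 1 $ 1 = r * cos \<theta> \<and> g $ 2 $ 1 = r * sin \<theta>)}"

text \<open>Distribution Delta_g = g * span{X1,X2}; metric q_g(g Y, g Y) = q(Y,Y) with
  q(X1,X1) = -1, q(X1,X2) = 0, q(X2,X2) = 1; time orientation V_g = g X1.
  For v = g (u1 X1 + u2 X2): q(v,v) = u2^2 - u1^2 and q(V,v) = -u1.\<close>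

definition li_coords :: "'k::real_normed_field^'n^'n \<Rightarrow> 'k^'n^'n \<Rightarrow> 'k^'n^'n \<Rightarrow> 'k^'n^'n
    \<Rightarrow> real \<times> real" where
  "li_coords X1 X2 g v = (THE p. v = g ** (fst p *\<^sub>R X1 + snd p *\<^sub>R X2))"

definition li_q :: "'k::real_normed_field^'n^'n \<Rightarrow> 'k^'n^'n \<Rightarrow> 'k^'n^'n \<Rightarrow> 'k^'n^'n \<Rightarrow> real" where
  "li_q X1 X2 g v = (snd (li_coords X1 X2 g v))\<^sup>2 - (fst (li_coords X1 X2 g v))\<^sup>2"

definition li_cone :: "'k::real_normed_field^'n^'n \<Rightarrow> 'k^'n^'n \<Rightarrow> 'k^'n^'n \<Rightarrow> 'k^'n^'n \<Rightarrow> bool" where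
  "li_cone X1 X2 g v \<longleftrightarrow> (\<exists>u1 u2. v = g ** (u1 *\<^sub>R X1 + u2 *\<^sub>R X2) \<and>
       u2\<^sup>2 - u1\<^sup>2 \<le> 0 \<and> - u1 \<le> 0)"

text \<open>Admissible curve x : [0,t1] -> G (values outside [0,t1] are irrelevant).\<close>
definition li_admissible :: "('k::real_normed_field^'n^'n) set \<Rightarrow> 'k^'n^'n \<Rightarrow> 'k^'n^'n
    \<Rightarrow> (real \<Rightarrow> 'k^'n^'n) \<Rightarrow> real \<Rightarrow> bool" where
  "li_admissible G X1 X2 x t1 \<longleftrightarrow> 0 < t1 \<and> (\<forall>t\<in>{0..t1}. x t \<in> G) \<and>
     (\<exists>C. C-lipschitz_on {0..t1} x) \<and>
     (AE t in lborel. t \<in> {0..t1} \<longrightarrow>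
        x differentiable (at t) \<and> li_cone X1 X2 (x t) (vector_derivative x (at t)))"

definition li_length :: "'k::real_normed_field^'n^'n \<Rightarrow> 'k^'n^'n
    \<Rightarrow> (real \<Rightarrow> 'k^'n^'n) \<Rightarrow> real \<Rightarrow> ennreal" where
  "li_length X1 X2 x t1 =
     (\<integral>\<^sup>+ t. ennreal (sqrt \<bar>li_q X1 X2 (x t) (vector_derivative x (at t))\<bar>)
              * indicator {0..t1} t \<partial>lborel)"

text \<open>On the universal cover the structure is the pullback by the covering map fst.\<close>
definition usl2_admissible :: "real^2^2 \<Rightarrow> real^2^2 \<Rightarrow> (real \<Rightarrow> (real^2^2) \<times> real) \<Rightarrow> real \<Rightarrow> bool" where
  "usl2_admissible X1 X2 x t1 \<longleftrightarrow> (\<forall>t\<in>{0..t1}. x t \<in> USL2) \<and>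
     (\<exists>C. C-lipschitz_on {0..t1} x) \<and> li_admissible SL2 X1 X2 (fst \<circ> x) t1"

definition usl2_length :: "real^2^2 \<Rightarrow> real^2^2 \<Rightarrow> (real \<Rightarrow> (real^2^2) \<times> real) \<Rightarrow> real \<Rightarrow> ennreal" where
  "usl2_length X1 X2 x t1 = li_length X1 X2 (fst \<circ> x) t1"

definition attainable :: "((real \<Rightarrow> 'a) \<Rightarrow> real \<Rightarrow> bool) \<Rightarrow> 'a \<Rightarrow> 'a \<Rightarrow> bool" where
  "attainable adm x0 x1 \<longleftrightarrow> (\<exists>x t1. adm x t1 \<and> x 0 = x0 \<and> x t1 = x1)"

definition sL_dist :: "((real \<Rightarrow> 'a) \<Rightarrow> real \<Rightarrow> bool) \<Rightarrow> ((real \<Rightarrow> 'a) \<Rightarrow> real \<Rightarrow> ennreal)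
    \<Rightarrow> 'a \<Rightarrow> 'a \<Rightarrow> ennreal" where
  "sL_dist adm len x0 x1 = (SUP p \<in> {(x, t1). adm x t1 \<and> x 0 = x0 \<and> x t1 = x1}. len (fst p) (snd p))"

definition longest_arc :: "((real \<Rightarrow> 'a) \<Rightarrow> real \<Rightarrow> bool) \<Rightarrow> ((real \<Rightarrow> 'a) \<Rightarrow> real \<Rightarrow> ennreal)
    \<Rightarrow> 'a \<Rightarrow> 'a \<Rightarrow> (real \<Rightarrow> 'a) \<Rightarrow> real \<Rightarrow> bool" where
  "longest_arc adm len x0 x1 x t1 \<longleftrightarrow> adm x t1 \<and> x 0 = x0 \<and> x t1 = x1 \<and>
     len x t1 = sL_dist adm len x0 x1 \<and> sL_dist adm len x0 x1 < \<infinity>"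

end

theory Submission
  imports Defs "HOL-Complex_Analysis.Great_Picard"
begin

text \<open>
  On \<open>SU\<^sub>2\<close> the one-parameter group of \<open>X1\<close> is a closed timelike curve, and running through it arbitrarily
  often before following a given admissible curve makes the length as large as we please.

  On the universal cover of \<open>SL\<^sub>2(\<real>)\<close> the determinant is positive on the cone, so every admissible
  velocity \<open>u1 X1 + u2 X2\<close> is elliptic, and the angle of the orthogonal factor in the polar
  decomposition changes monotonically, at a rate of at least a constant times \<open>u1\<close>. Hence \<open>\<integral> u1\<close> is bounded
  in terms of the endpoints. Parametrised by \<open>\<integral> u1\<close>, the admissible curves between two points are therefore
  uniformly Lipschitz on a common interval, and a length-maximising sequence has a uniform limit by
  Arzela-Ascoli. The limit is admissible because the cone is convex, and no length is lost because
  \<open>sqrt (u1\<^sup>2 - u2\<^sup>2)\<close> is concave on it.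
\<close>

section \<open>Lipschitz functions on the real line\<close>

text \<open>The obstacle is that \<open>g\<close> ranges over a noncompact group. The angle of the
  first column turns at rate \<open>M $ 2 $ 1 / N\<close>, \<open>N\<close> its squared length, and
  any lower bound for this in terms of \<open>u1\<close> degenerates as \<open>N\<close> grows.
  Hence the polar angle: write \<open>g\<close> as a rotation by theta times an upper triangular
  matrix with diagonal \<open>sqrt N\<close>, \<open>1 / sqrt N\<close> and corner
  \<open>D / sqrt N\<close>, where \<open>D\<close> is the inner product of the columns. The
  rotation in the polar decomposition of that triangular factor has angle
  \<open>- arctan (D / (N + 1))\<close>, which is the correction in \<open>winding\<close>. The
  corrected rate is a weighted mean of rotation rates, so its lower bound is uniform in
  \<open>g\<close>. The cover makes this angle a real number, so that its increase is fixed by the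
  endpoints; on the quotient \<open>SL2\<close> the curve generated by \<open>X1\<close> is closed,
  as on \<open>SU2\<close>. The claim concerns every frame with the given brackets, so determinants
  are extracted from the brackets and not from a model. Curves are only Lipschitz. Every estimate
  integrates an a.e. derivative, which is why a.e. differentiability and the fundamental theorem
  come first.\<close>

lemma AE_lborel_imp_negligible:
  fixes P :: "'a::euclidean_space \<Rightarrow> bool"
  assumes "AE x in lborel. P x"
  shows "negligible {x. \<not> P x}"
proof -
  obtain N where N: "N \<in> null_sets (lebesgue :: 'a measure)" "{x \<in> space lebesgue. \<not> P x} \<subseteq> N"
    using AE_completion[OF assms] unfolding eventually_ae_filter by blast
  then show ?thesis
    using negligible_subset[of N "{x. \<not> P x}"] by (simp add: negligible_iff_null_sets)
qed

lemma negligible_imp_AE_lborel: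
  fixes P :: "'a::euclidean_space \<Rightarrow> bool"
  assumes "negligible {x. \<not> P x}"
  shows "AE x in lborel. P x"
proof -
  have "AE x in lebesgue. P x"
    using assms unfolding negligible_iff_null_sets by (intro AE_I') auto
  then show ?thesis by (simp only: AE_completion_iff)
qed

lemma has_vector_derivative_quotient:
  assumes "(f has_vector_derivative d) (at t)"
  shows "((\<lambda>h. (f (t + h) - f t) /\<^sub>R h) \<longlongrightarrow> d) (at 0)"
proof -
  have "(\<lambda>h. norm (f (t + h) - f t - h *\<^sub>R d) / norm h) \<midarrow>0\<rightarrow> 0"
    using assms by (simp add: has_vector_derivative_def has_derivative_at)
  then have "(\<lambda>h. (f (t + h) - f t) /\<^sub>R h - d) \<midarrow>0\<rightarrow> 0"
  proof (rule tendsto_norm_zero_cancel[OF Lim_transform_eventually])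
    have "norm (f (t + h) - f t - h *\<^sub>R d) / norm h = norm ((f (t + h) - f t) /\<^sub>R h - d)" if "h \<noteq> 0" for h
    proof -
      have "(f (t + h) - f t) /\<^sub>R h - d = (f (t + h) - f t - h *\<^sub>R d) /\<^sub>R h"
        using that by (simp add: scaleR_diff_right)
      then show ?thesis by (simp add: divide_inverse mult.commute)
    qed
    then show "\<forall>\<^sub>F h in at 0. norm (f (t + h) - f t - h *\<^sub>R d) / norm h = norm ((f (t + h) - f t) /\<^sub>R h - d)"
      by (auto simp: eventually_at_topological)
  qed
  then show ?thesis by (simp add: LIM_zero_iff)
qed

lemma has_real_derivative_both_sides:
  fixes f :: "real \<Rightarrow> real"
  assumes r: "\<And>e. 0 < e \<Longrightarrow> \<exists>d>0. \<forall>h. 0 < h \<and> h < d \<longrightarrow> \<bar>(f (x + h) - f x) / h - g\<bar> < e"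
    and l: "\<And>e. 0 < e \<Longrightarrow> \<exists>d>0. \<forall>h. 0 < h \<and> h < d \<longrightarrow> \<bar>(f x - f (x - h)) / h - g\<bar> < e"
  shows "(f has_real_derivative g) (at x)"
  unfolding has_field_derivative_iff LIM_eq
proof (intro allI impI)
  fix e :: real assume "0 < e"
  obtain d1 where d1: "d1 > 0" "\<And>h. 0 < h \<Longrightarrow> h < d1 \<Longrightarrow> \<bar>(f (x + h) - f x) / h - g\<bar> < e"
    using r[OF \<open>0 < e\<close>] by blast
  obtain d2 where d2: "d2 > 0" "\<And>h. 0 < h \<Longrightarrow> h < d2 \<Longrightarrow> \<bar>(f x - f (x - h)) / h - g\<bar> < e"
    using l[OF \<open>0 < e\<close>] by blast
  have "norm ((f y - f x) / (y - x) - g) < e" if "y \<noteq> x" "norm (y - x) < min d1 d2" for y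
  proof (cases "y > x")
    case True
    then show ?thesis using d1(2)[of "y - x"] that by simp
  next
    case False
    then have "\<bar>(f x - f (x - (x - y))) / (x - y) - g\<bar> < e"
      using d2(2)[of "x - y"] that by simp
    moreover have "(f x - f y) / (x - y) = (f y - f x) / (y - x)"
      by (metis minus_diff_eq minus_divide_divide)
    ultimately show ?thesis by simp
  qed
  then show "\<exists>s>0. \<forall>xa. xa \<noteq> x \<and> norm (xa - x) < s \<longrightarrow> norm ((f xa - f x) / (xa - x) - g) < e"
    using d1(1) d2(1) by (intro exI[of _ "min d1 d2"]) auto
qed

text \<open>Lebesgue differentiation in \<open>integrable_ccontinuous_explicit\<close> treats cubes
  with \<open>x\<close> as lower corner, hence right difference quotients. Left quotients come from
  the same fact for \<open>g (- x)\<close>, whose exceptional set \<open>N2\<close> is reflected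
  back.\<close>

lemma indefinite_integral_has_real_derivative_AE:
  fixes f g :: "real \<Rightarrow> real"
  assumes int: "\<And>a b. a \<le> b \<Longrightarrow> (g has_integral (f b - f a)) {a..b}"
  shows "AE t in lborel. (f has_real_derivative g t) (at t)"
proof -
  have "g integrable_on cbox a b" for a b
    by (cases "a \<le> b") (use int in \<open>auto simp: integrable_on_def\<close>)
  then obtain N1 where N1: "negligible N1" "\<And>x e. \<lbrakk>x \<notin> N1; 0 < e\<rbrakk> \<Longrightarrow>
      \<exists>d>0. \<forall>h. 0 < h \<and> h < d \<longrightarrow> norm (integral (cbox x (x + h *\<^sub>R One)) g /\<^sub>R h ^ DIM(real) - g x) < e"
    using integrable_ccontinuous_explicit[of g] by blast
  have im: "((\<lambda>x. g (- x)) has_integral (f (- a) - f (- b))) {a..b}" if "a \<le> b" for a b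
    using has_integral_reflect_lemma_real[OF int[of "- b" "- a"]] that by simp
  then have "(\<lambda>x. g (- x)) integrable_on cbox a b" for a b
    by (cases "a \<le> b") (auto simp: integrable_on_def)
  then obtain N2 where N2: "negligible N2" "\<And>x e. \<lbrakk>x \<notin> N2; 0 < e\<rbrakk> \<Longrightarrow>
      \<exists>d>0. \<forall>h. 0 < h \<and> h < d \<longrightarrow>
        norm (integral (cbox x (x + h *\<^sub>R One)) (\<lambda>x. g (- x)) /\<^sub>R h ^ DIM(real) - g (- x)) < e"
    using integrable_ccontinuous_explicit[of "\<lambda>x. g (- x)"] by blast
  have "negligible (uminus ` N2)"
    by (rule negligible_locally_Lipschitz_image[OF _ N2(1)]) (simp, rule exI[of _ UNIV], rule exI[of _ 1], auto)
  then have "negligible (N1 \<union> uminus ` N2)"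
    using N1(1) by simp
  moreover have "(f has_real_derivative g t) (at t)" if t: "t \<notin> N1 \<union> uminus ` N2" for t
  proof (rule has_real_derivative_both_sides)
    fix e :: real assume "0 < e"
    have "t \<notin> N1" using t by blast
    then obtain d where d: "d > 0" "\<And>h. 0 < h \<Longrightarrow> h < d \<Longrightarrow>
        norm (integral (cbox t (t + h *\<^sub>R One)) g /\<^sub>R h ^ DIM(real) - g t) < e"
      using N1(2) \<open>0 < e\<close> by meson
    have "\<bar>(f (t + h) - f t) / h - g t\<bar> < e" if "0 < h" "h < d" for h
      using d(2)[OF that] integral_unique[OF int[of t "t + h"]] that by (simp add: divide_inverse mult.commute)
    then show "\<exists>d>0. \<forall>h. 0 < h \<and> h < d \<longrightarrow> \<bar>(f (t + h) - f t) / h - g t\<bar> < e"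
      using d(1) by blast
  next
    fix e :: real assume "0 < e"
    have "- t \<notin> N2" using t by force
    then obtain d where d: "d > 0" "\<And>h. 0 < h \<Longrightarrow> h < d \<Longrightarrow>
        norm (integral (cbox (- t) (- t + h *\<^sub>R One)) (\<lambda>x. g (- x)) /\<^sub>R h ^ DIM(real) - g (- (- t))) < e"
      using N2(2) \<open>0 < e\<close> by meson
    have "\<bar>(f t - f (t - h)) / h - g t\<bar> < e" if "0 < h" "h < d" for h
      using d(2)[OF that] integral_unique[OF im[of "- t" "- t + h"]] that by (simp add: divide_inverse mult.commute)
    then show "\<exists>d>0. \<forall>h. 0 < h \<and> h < d \<longrightarrow> \<bar>(f t - f (t - h)) / h - g t\<bar> < e"
      using d(1) by blast
  qed
  ultimately have "negligible {t. \<not> (f has_real_derivative g t) (at t)}"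
    by (blast intro: negligible_subset)
  then show ?thesis by (rule negligible_imp_AE_lborel)
qed

text \<open>The inverse \<open>H\<close> of \<open>F\<close> pushes Lebesgue measure forward to a measure giving \<open>{a..b}\<close> the mass
  \<open>F b - F a\<close>. As \<open>F\<close> maps null sets to null sets, this measure has a Radon-Nikodym density.\<close>
lemma expanding_lipschitz_has_density:
  fixes F :: "real \<Rightarrow> real"
  assumes lip: "K-lipschitz_on UNIV F" and ex: "\<And>a b. a \<le> b \<Longrightarrow> b - a \<le> F b - F a"
  obtains g where "g \<in> borel_measurable borel" "\<And>a b. a \<le> b \<Longrightarrow> (g has_integral (F b - F a)) {a..b}"
proof -
  have cont: "continuous_on UNIV F" using lip by (rule lipschitz_on_continuous_on)
  have mono: "F a \<le> F b \<longleftrightarrow> a \<le> b" for a b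
    using ex[of a b] ex[of b a] by (cases "a \<le> b") auto
  have inj: "inj F" by (rule injI) (metis mono order_antisym order_refl)
  have surj: "\<exists>x. F x = y" for y
  proof -
    define m where "m = \<bar>y - F 0\<bar>"
    have "F (- m) \<le> y" "y \<le> F m" "- m \<le> m"
      using ex[of "- m" 0] ex[of 0 m] by (auto simp: m_def)
    then show ?thesis
      using IVT'[of F "- m" y m] continuous_on_subset[OF cont] by blast
  qed
  define H where "H = inv F"
  have FH: "F (H y) = y" for y unfolding H_def by (metis surj f_inv_into_f rangeI)
  have HF: "H (F x) = x" for x unfolding H_def using inj by simp
  have Hlip: "1-lipschitz_on UNIV H"
  proof (rule lipschitz_onI)
    fix x y :: real
    show "dist (H x) (H y) \<le> 1 * dist x y"
      using ex[of "H x" "H y"] ex[of "H y" "H x"]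
      by (cases "H x \<le> H y") (simp_all add: dist_real_def FH)
  qed simp
  have Hmeas[measurable]: "H \<in> borel_measurable borel"
    by (rule borel_measurable_continuous_onI) (rule lipschitz_on_continuous_on[OF Hlip])
  have vim: "H -` A = F ` A" for A using FH HF by (auto simp: image_iff) metis
  define M where "M = distr lborel borel H"
  have M_sets: "sets M = sets lborel" by (simp add: M_def)
  have ac: "absolutely_continuous lborel M"
    unfolding absolutely_continuous_def
  proof
    fix A assume A: "A \<in> null_sets (lborel :: real measure)"
    then have [measurable]: "A \<in> sets borel" by auto
    have "negligible A" using A by (simp add: negligible_iff_null_sets null_sets_completionI)
    then have "negligible (F ` A)"
    proof (rule negligible_locally_Lipschitz_image[rotated])
      fix x assume "x \<in> A"
      show "\<exists>T B. open T \<and> x \<in> T \<and> (\<forall>y\<in>A \<inter> T. norm (F y - F x) \<le> B * norm (y - x))"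
        using lip by (intro exI[of _ UNIV] exI[of _ K]) (auto simp: dist_norm dest: lipschitz_onD)
    qed simp
    then have "H -` A \<in> null_sets lebesgue" by (simp add: vim negligible_iff_null_sets)
    moreover have "H -` A \<in> sets lborel" using measurable_sets[OF Hmeas, of A] by simp
    ultimately have "H -` A \<in> null_sets lborel" using null_sets_completion_iff by blast
    then show "A \<in> null_sets M" by (auto simp: M_def null_sets_def emeasure_distr)
  qed
  obtain h where h[measurable]: "h \<in> borel_measurable lborel" and dens: "density lborel h = M"
    using sigma_finite_measure.Radon_Nikodym[OF _ ac M_sets] lborel.sigma_finite_measure_axioms by blast
  have val: "(\<integral>\<^sup>+x. h x * indicator {a..b} x \<partial>lborel) = ennreal (F b - F a)" if "a \<le> b" for a b
  proof -
    have "F ` {a..b} = {F a..F b}"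
    proof (intro equalityI subsetI)
      fix y assume "y \<in> {F a..F b}"
      then have "H y \<in> {a..b}" using mono[of a "H y"] mono[of "H y" b] FH[of y] by simp
      then show "y \<in> F ` {a..b}" using FH[of y] by (intro image_eqI[of _ F "H y"]) simp_all
    qed (auto simp: mono)
    then have "emeasure M {a..b} = ennreal (F b - F a)"
      using that mono by (simp add: M_def emeasure_distr vim)
    then show ?thesis by (subst (asm) dens[symmetric]) (simp add: emeasure_density)
  qed
  \<comment> \<open>\<open>h\<close> takes values in \<open>ennreal\<close>. Finite mass on every
    \<open>{- n..n}\<close> makes it finite a.e., so the passage to \<open>enn2real\<close> loses
    nothing.\<close>
  have "AE x in lborel. x \<in> {- real n..real n} \<longrightarrow> h x \<noteq> \<infinity>" for n :: nat
  proof -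
    have "AE x in lborel. h x * indicator {- real n..real n} x \<noteq> \<infinity>"
      by (rule nn_integral_PInf_AE) (auto simp: val)
    then show ?thesis by (rule AE_mp) (auto intro!: AE_I2)
  qed
  then have "AE x in lborel. \<forall>n::nat. x \<in> {- real n..real n} \<longrightarrow> h x \<noteq> \<infinity>"
    unfolding AE_all_countable by (rule allI)
  then have fin: "AE x in lborel. h x \<noteq> \<infinity>"
  proof (rule AE_mp, intro AE_I2 impI)
    fix x :: real assume *: "\<forall>n::nat. x \<in> {- real n..real n} \<longrightarrow> h x \<noteq> \<infinity>"
    obtain n :: nat where "\<bar>x\<bar> \<le> real n" using real_arch_simple by blast
    then have "x \<in> {- real n..real n}" by auto
    then show "h x \<noteq> \<infinity>" using * by blast
  qed
  have "((\<lambda>x. enn2real (h x)) has_integral (F b - F a)) {a..b}" if "a \<le> b" for a b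
  proof -
    have "(\<integral>\<^sup>+x. ennreal (indicator {a..b} x * enn2real (h x)) \<partial>lborel) = (\<integral>\<^sup>+x. h x * indicator {a..b} x \<partial>lborel)"
      by (rule nn_integral_cong_AE, rule AE_mp[OF fin])
        (auto intro!: AE_I2 simp: indicator_def ennreal_enn2real_if)
    then have "(\<integral>\<^sup>+x. ennreal (indicator {a..b} x * enn2real (h x)) \<partial>lborel) = ennreal (F b - F a)"
      using val[OF that] by simp
    then have "((\<lambda>x. indicator {a..b} x * enn2real (h x)) has_integral (F b - F a)) UNIV"
      by (intro nn_integral_has_integral) (use that mono in auto)
    moreover have "(\<lambda>x. indicator {a..b} x * enn2real (h x)) = (\<lambda>x. if x \<in> {a..b} then enn2real (h x) else 0)"
      by (auto simp: indicator_def)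
    ultimately show ?thesis by (simp only: has_integral_restrict_UNIV)
  qed
  then show thesis using that[of "\<lambda>x. enn2real (h x)"] h by simp
qed

lemma lipschitz_on_real_AE_derivative:
  fixes f :: "real \<Rightarrow> real"
  assumes lip: "L-lipschitz_on UNIV f"
  obtains g where "g \<in> borel_measurable borel" "AE t in lborel. (f has_real_derivative g t) (at t)"
    "\<And>a b. a \<le> b \<Longrightarrow> (g has_integral (f b - f a)) {a..b}"
proof -
  \<comment> \<open>The slopes of \<open>f\<close> lie between \<open>- L\<close> and
    \<open>L\<close>. Adding \<open>(L + 1) * t\<close> raises them to at least 1, so
    \<open>F\<close> is expanding and has a density; the constant is subtracted from it again at the
    end.\<close>
  define F where "F t = f t + (L + 1) * t" for t
  have L0: "L \<ge> 0" using lip by (rule lipschitz_on_nonneg)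
  have "(L + 1)-lipschitz_on UNIV (\<lambda>t. (L + 1) * t)"
    using L0 by (intro lipschitz_onI) (auto simp: dist_real_def abs_mult simp flip: right_diff_distrib)
  then have "(L + (L + 1))-lipschitz_on UNIV F"
    unfolding F_def by (intro lipschitz_on_add lip)
  moreover have "b - a \<le> F b - F a" if "a \<le> b" for a b
  proof -
    have "\<bar>f b - f a\<bar> \<le> L * (b - a)"
      using lipschitz_onD[OF lip, of b a] that by (simp add: dist_real_def)
    then show ?thesis by (simp add: F_def algebra_simps)
  qed
  ultimately obtain g where g: "g \<in> borel_measurable borel"
    "\<And>a b. a \<le> b \<Longrightarrow> (g has_integral (F b - F a)) {a..b}"
    using expanding_lipschitz_has_density by blast
  have int: "((\<lambda>t. g t - (L + 1)) has_integral (f b - f a)) {a..b}" if "a \<le> b" for a b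
    using has_integral_diff[OF g(2)[OF that] has_integral_const_real[of "L + 1" a b]] that
    by (simp add: F_def algebra_simps)
  show thesis
    by (rule that[of "\<lambda>t. g t - (L + 1)"])
      (use g(1) int indefinite_integral_has_real_derivative_AE[of "\<lambda>t. g t - (L + 1)" f] in auto)
qed

lemma lipschitz_on_AE_vector_derivative:
  fixes f :: "real \<Rightarrow> 'a::euclidean_space"
  assumes lip: "L-lipschitz_on UNIV f"
  obtains g where "g \<in> borel_measurable borel" "\<And>t. norm (g t) \<le> L"
    "AE t in lborel. (f has_vector_derivative g t) (at t)"
    "\<And>a b. a \<le> b \<Longrightarrow> (g has_integral (f b - f a)) {a..b}"
proof -
  have L0: "L \<ge> 0" using lip by (rule lipschitz_on_nonneg)
  have "\<exists>g. g \<in> borel_measurable borel \<and> (AE t in lborel. ((\<lambda>t. f t \<bullet> i) has_real_derivative g t) (at t)) \<and>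
      (\<forall>a b. a \<le> b \<longrightarrow> (g has_integral (f b \<bullet> i - f a \<bullet> i)) {a..b})" if "i \<in> Basis" for i
  proof -
    have "L-lipschitz_on UNIV (\<lambda>t. f t \<bullet> i)"
    proof (rule lipschitz_onI)
      fix x y
      have "\<bar>f x \<bullet> i - f y \<bullet> i\<bar> \<le> norm (f x - f y)"
        using Basis_le_norm[OF that, of "f x - f y"] by (simp add: inner_diff_left)
      then show "dist (f x \<bullet> i) (f y \<bullet> i) \<le> L * dist x y"
        using lipschitz_onD[OF lip, of x y] by (simp add: dist_norm)
    qed (use lip L0 in auto)
    then obtain g where "g \<in> borel_measurable borel" "AE t in lborel. ((\<lambda>t. f t \<bullet> i) has_real_derivative g t) (at t)"
      "\<And>a b. a \<le> b \<Longrightarrow> (g has_integral (f b \<bullet> i - f a \<bullet> i)) {a..b}"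
      by (rule lipschitz_on_real_AE_derivative) blast
    then show ?thesis by blast
  qed
  then have "\<forall>i\<in>Basis. \<exists>g. g \<in> borel_measurable borel \<and> (AE t in lborel. ((\<lambda>t. f t \<bullet> i) has_real_derivative g t) (at t)) \<and>
      (\<forall>a b. a \<le> b \<longrightarrow> (g has_integral (f b \<bullet> i - f a \<bullet> i)) {a..b})"
    by blast
  from bchoice[OF this] obtain G where G: "\<And>i. i \<in> Basis \<Longrightarrow> G i \<in> borel_measurable borel"
    "\<And>i. i \<in> Basis \<Longrightarrow> AE t in lborel. ((\<lambda>t. f t \<bullet> i) has_real_derivative G i t) (at t)"
    "\<And>i a b. i \<in> Basis \<Longrightarrow> a \<le> b \<Longrightarrow> (G i has_integral (f b \<bullet> i - f a \<bullet> i)) {a..b}"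
    by blast
  define g0 where "g0 t = (\<Sum>i\<in>Basis. G i t *\<^sub>R i)" for t
  \<comment> \<open>Difference quotients force \<open>norm (g0 t) \<le> L\<close> off a null set.
    Resetting the remaining values to 0 makes the bound valid at every \<open>t\<close>, which later
    bounds the controls.\<close>
  define g where "g t = (if norm (g0 t) \<le> L then g0 t else 0)" for t
  have g0_meas[measurable]: "g0 \<in> borel_measurable borel"
    unfolding g0_def using G(1) by (intro borel_measurable_sum borel_measurable_scaleR) auto
  have g_meas: "g \<in> borel_measurable borel" unfolding g_def by measurable
  have "AE t in lborel. \<forall>i\<in>Basis. ((\<lambda>t. f t \<bullet> i) has_real_derivative G i t) (at t)"
    using G(2) by (intro AE_finite_allI) auto
  then have d0: "AE t in lborel. (f has_vector_derivative g0 t) (at t)"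
  proof (rule AE_mp, intro AE_I2 impI)
    fix t assume *: "\<forall>i\<in>Basis. ((\<lambda>t. f t \<bullet> i) has_real_derivative G i t) (at t)"
    have "g0 t \<bullet> i = G i t" if "i \<in> Basis" for i using that by (simp add: g0_def)
    then show "(f has_vector_derivative g0 t) (at t)"
      unfolding has_vector_derivative_def has_derivative_componentwise_within[of f]
      using * by (auto simp: has_real_derivative_iff_has_vector_derivative has_vector_derivative_def)
  qed
  have eq: "AE t in lborel. g t = g0 t"
  proof (rule AE_mp[OF d0], intro AE_I2 impI)
    fix t assume d: "(f has_vector_derivative g0 t) (at t)"
    have "((\<lambda>h. norm ((f (t + h) - f t) /\<^sub>R h)) \<longlongrightarrow> norm (g0 t)) (at 0)"
      by (intro tendsto_norm has_vector_derivative_quotient[OF d])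
    moreover have "\<forall>\<^sub>F h in at 0. norm ((f (t + h) - f t) /\<^sub>R h) \<le> L"
    proof (rule eventually_at_topological[THEN iffD2], intro exI[of _ UNIV] conjI ballI impI)
      fix h :: real assume "h \<noteq> 0"
      then show "norm ((f (t + h) - f t) /\<^sub>R h) \<le> L"
        using lipschitz_onD[OF lip, of "t + h" t] by (simp add: dist_norm divide_simps mult.commute)
    qed auto
    ultimately have "norm (g0 t) \<le> L"
      by (intro tendsto_upperbound) auto
    then show "g t = g0 t" by (simp add: g_def)
  qed
  have int: "(g has_integral (f b - f a)) {a..b}" if "a \<le> b" for a b
  proof -
    have "(g0 has_integral (f b - f a)) {a..b}"
      unfolding has_integral_componentwise_iff[of g0]
      using G(3)[OF _ that] by (auto simp: g0_def inner_diff_left)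
    then show ?thesis
      by (rule has_integral_spike[OF AE_lborel_imp_negligible[OF eq], rotated]) auto
  qed
  show thesis
  proof (rule that[OF g_meas])
    show "norm (g t) \<le> L" for t using L0 by (simp add: g_def)
    show "AE t in lborel. (f has_vector_derivative g t) (at t)"
      using d0 eq by eventually_elim simp
  qed (rule int)
qed

lemma lipschitz_interval_AE_derivative:
  fixes f :: "real \<Rightarrow> 'a::euclidean_space"
  assumes lip: "C-lipschitz_on {0..T} f"
  obtains g where "g \<in> borel_measurable borel" "\<And>t. norm (g t) \<le> C"
    "AE t in lborel. t \<in> {0..T} \<longrightarrow> (f has_vector_derivative g t) (at t)"
    "\<And>a b. 0 \<le> a \<Longrightarrow> a \<le> b \<Longrightarrow> b \<le> T \<Longrightarrow> (g has_integral (f b - f a)) {a..b}"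
proof (cases "0 \<le> T")
  case True
  \<comment> \<open>Extension by the endpoint values: clamping to \<open>{0..T}\<close> is
    1-Lipschitz, so the constant \<open>C\<close> survives.\<close>
  define F where "F t = f (max 0 (min T t))" for t
  have C0: "C \<ge> 0" using lip by (rule lipschitz_on_nonneg)
  have "C-lipschitz_on UNIV F"
  proof (rule lipschitz_onI)
    fix x y :: real
    have "dist (F x) (F y) \<le> C * dist (max 0 (min T x)) (max 0 (min T y))"
      unfolding F_def using True by (intro lipschitz_onD[OF lip]) auto
    also have "\<dots> \<le> C * dist x y"
      using C0 True by (intro mult_left_mono) (auto simp: dist_real_def)
    finally show "dist (F x) (F y) \<le> C * dist x y" .
  qed (rule C0)
  then obtain g where g: "g \<in> borel_measurable borel" "\<And>t. norm (g t) \<le> C"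
    "AE t in lborel. (F has_vector_derivative g t) (at t)"
    "\<And>a b. a \<le> b \<Longrightarrow> (g has_integral (F b - F a)) {a..b}"
    by (rule lipschitz_on_AE_vector_derivative) blast
  have "AE t in lborel. t \<noteq> 0" "AE t in lborel. t \<noteq> T" by (rule AE_lborel_singleton)+
  with g(3) have "AE t in lborel. t \<in> {0..T} \<longrightarrow> (f has_vector_derivative g t) (at t)"
  proof eventually_elim
    case (elim t)
    have "(f has_vector_derivative g t) (at t)" if "t \<in> {0<..<T}"
      by (rule has_vector_derivative_transform_within_open[OF elim(1) open_greaterThanLessThan that])
        (auto simp: F_def)
    then show ?case using elim by auto
  qed
  moreover have "(g has_integral (f b - f a)) {a..b}" if "0 \<le> a" "a \<le> b" "b \<le> T" for a b
    using g(4)[OF that(2)] that by (simp add: F_def)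
  ultimately show thesis using that[OF g(1,2)] by blast
next
  case False
  have "C \<ge> 0" using lip by (rule lipschitz_on_nonneg)
  then show thesis using that[of "\<lambda>_. 0"] False by auto
qed

text \<open>Derivatives are unique, so \<open>D\<close> agrees off a null set with the derivative
  already known to integrate to the increment, and the integral does not see null sets.\<close>

lemma lipschitz_FTC:
  fixes f :: "real \<Rightarrow> 'a::euclidean_space"
  assumes lip: "C-lipschitz_on {0..T} f"
    and ae: "AE t in lborel. t \<in> {0..T} \<longrightarrow> (f has_vector_derivative D t) (at t)"
    and ab: "0 \<le> a" "a \<le> b" "b \<le> T"
  shows "(D has_integral (f b - f a)) {a..b}"
proof -
  obtain g where g: "AE t in lborel. t \<in> {0..T} \<longrightarrow> (f has_vector_derivative g t) (at t)"
    "\<And>a b. 0 \<le> a \<Longrightarrow> a \<le> b \<Longrightarrow> b \<le> T \<Longrightarrow> (g has_integral (f b - f a)) {a..b}"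
    using lipschitz_interval_AE_derivative[OF lip] by metis
  have "AE t in lborel. t \<in> {0..T} \<longrightarrow> D t = g t"
    using ae g(1) by eventually_elim (use vector_derivative_unique_at in blast)
  from has_integral_spike[OF AE_lborel_imp_negligible[OF this] _ g(2)[OF ab], of D]
  show ?thesis using ab by auto
qed

section \<open>Algebra of Lipschitz functions\<close>

text \<open>The Lipschitz constant stays existentially quantified here and below, so that
  \<open>intro\<close> can take a compound expression such as \<open>winding\<close> apart without
  tracking constants.\<close>

lemma ex_lipschitz_mult:
  fixes f g :: "'a::metric_space \<Rightarrow> real"
  assumes S: "compact S" and "\<exists>C. C-lipschitz_on S f" "\<exists>C. C-lipschitz_on S g"
  shows "\<exists>C. C-lipschitz_on S (\<lambda>t. f t * g t)"
proof -
  obtain A B where AB: "A-lipschitz_on S f" "B-lipschitz_on S g" using assms by blast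
  have "bounded (f ` S)" "bounded (g ` S)"
    using AB S by (auto intro!: compact_imp_bounded compact_continuous_image lipschitz_on_continuous_on)
  then obtain M N where MN: "\<And>t. t \<in> S \<Longrightarrow> \<bar>f t\<bar> \<le> M" "\<And>t. t \<in> S \<Longrightarrow> \<bar>g t\<bar> \<le> N"
    by (auto simp: bounded_iff)
  have A0: "A \<ge> 0" "B \<ge> 0" using AB lipschitz_on_nonneg by blast+
  have "(\<bar>M\<bar> * B + \<bar>N\<bar> * A)-lipschitz_on S (\<lambda>t. f t * g t)"
  proof (rule lipschitz_onI)
    fix x y assume xy: "x \<in> S" "y \<in> S"
    have "f x * g x - f y * g y = f x * (g x - g y) + g y * (f x - f y)" by (simp add: algebra_simps)
    then have "\<bar>f x * g x - f y * g y\<bar> \<le> \<bar>f x\<bar> * \<bar>g x - g y\<bar> + \<bar>g y\<bar> * \<bar>f x - f y\<bar>"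
      by (metis abs_mult abs_triangle_ineq)
    also have "\<dots> \<le> \<bar>M\<bar> * (B * dist x y) + \<bar>N\<bar> * (A * dist x y)"
    proof (intro add_mono mult_mono)
      show "\<bar>f x\<bar> \<le> \<bar>M\<bar>" "\<bar>g y\<bar> \<le> \<bar>N\<bar>" using MN xy by (meson abs_ge_self order_trans)+
      show "\<bar>g x - g y\<bar> \<le> B * dist x y" "\<bar>f x - f y\<bar> \<le> A * dist x y"
        using AB xy by (auto dest: lipschitz_onD simp: dist_real_def)
    qed auto
    finally show "dist (f x * g x) (f y * g y) \<le> (\<bar>M\<bar> * B + \<bar>N\<bar> * A) * dist x y"
      by (simp add: dist_real_def algebra_simps)
  qed (use A0 in simp)
  then show ?thesis ..
qed

lemma ex_lipschitz_add:
  fixes f g :: "'a::metric_space \<Rightarrow> real"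
  assumes "\<exists>C. C-lipschitz_on S f" "\<exists>C. C-lipschitz_on S g"
  shows "\<exists>C. C-lipschitz_on S (\<lambda>t. f t + g t)"
  using assms by (blast intro: lipschitz_on_add)

lemma ex_lipschitz_diff:
  fixes f g :: "'a::metric_space \<Rightarrow> real"
  assumes "\<exists>C. C-lipschitz_on S f" "\<exists>C. C-lipschitz_on S g"
  shows "\<exists>C. C-lipschitz_on S (\<lambda>t. f t - g t)"
  using assms by (blast intro: lipschitz_on_diff)

lemma ex_lipschitz_nth:
  fixes g :: "'a::metric_space \<Rightarrow> real^'n^'m"
  assumes "\<exists>C. C-lipschitz_on S g"
  shows "\<exists>C. C-lipschitz_on S (\<lambda>t. g t $ i $ j)"
proof -
  obtain C where C: "C-lipschitz_on S g" using assms by blast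
  have "C-lipschitz_on S (\<lambda>t. g t $ i $ j)"
  proof (rule lipschitz_onI)
    fix x y assume "x \<in> S" "y \<in> S"
    have "dist (g x $ i $ j) (g y $ i $ j) \<le> dist (g x) (g y)"
      by (meson dist_vec_nth_le order_trans)
    then show "dist (g x $ i $ j) (g y $ i $ j) \<le> C * dist x y"
      using lipschitz_onD[OF C] \<open>x \<in> S\<close> \<open>y \<in> S\<close> by (meson order_trans)
  qed (use C lipschitz_on_nonneg in blast)
  then show ?thesis ..
qed

lemma ex_lipschitz_compose_1:
  fixes f :: "'a::metric_space \<Rightarrow> real" and h :: "real \<Rightarrow> real"
  assumes f: "\<exists>C. C-lipschitz_on S f" and mem: "\<And>t. t \<in> S \<Longrightarrow> f t \<in> U"
    and h: "1-lipschitz_on U h"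
  shows "\<exists>C. C-lipschitz_on S (\<lambda>t. h (f t))"
proof -
  obtain C where C: "C-lipschitz_on S f" using f by blast
  have "(1 * C)-lipschitz_on S (\<lambda>t. h (f t))"
    by (rule lipschitz_on_compose2[OF C lipschitz_on_subset[OF h]]) (use mem in auto)
  then show ?thesis ..
qed

lemma lipschitz_on_real_derivative_le_1:
  fixes h :: "real \<Rightarrow> real"
  assumes "convex U" "\<And>x. x \<in> U \<Longrightarrow> (h has_real_derivative h' x) (at x)" "\<And>x. x \<in> U \<Longrightarrow> \<bar>h' x\<bar> \<le> 1"
  shows "1-lipschitz_on U h"
proof (rule bounded_derivative_imp_lipschitz)
  fix x assume "x \<in> U"
  then show "(h has_derivative (\<lambda>t. t *\<^sub>R h' x)) (at x within U)"
    using assms(2)[of x] unfolding has_real_derivative_iff_has_vector_derivative has_vector_derivative_def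
    by (auto intro: has_derivative_at_withinI)
  show "onorm (\<lambda>t. t *\<^sub>R h' x) \<le> 1"
    using assms(3)[OF \<open>x \<in> U\<close>] by (simp add: onorm_scaleR_left[OF bounded_linear_ident] onorm_id del: real_scaleR_def)
qed (use assms in auto)

lemma arctan_lipschitz: "1-lipschitz_on UNIV (arctan :: real \<Rightarrow> real)"
proof (rule lipschitz_on_real_derivative_le_1[where h' = "\<lambda>x. inverse (1 + x\<^sup>2)"])
  show "\<bar>inverse (1 + x\<^sup>2)\<bar> \<le> 1" for x :: real
    by (simp add: inverse_le_1_iff)
qed (auto intro: DERIV_arctan)

text \<open>The half-line \<open>{1..}\<close> suits both later uses: the squared norm of a matrix
  of determinant 1 under \<open>ln\<close>, and the denominator of \<open>winding\<close>, which
  contains a summand 1, under \<open>inverse\<close>.\<close>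

lemma ln_lipschitz: "1-lipschitz_on {1..} (ln :: real \<Rightarrow> real)"
  by (rule lipschitz_on_real_derivative_le_1[where h' = "\<lambda>x. inverse x"])
    (auto intro: DERIV_ln simp: inverse_le_1_iff)

lemma inverse_lipschitz: "1-lipschitz_on {1..} (inverse :: real \<Rightarrow> real)"
proof (rule lipschitz_on_real_derivative_le_1[where h' = "\<lambda>x. - (inverse x ^ 2)"])
  show "\<bar>- (inverse x ^ 2)\<bar> \<le> 1" if "x \<in> {1..}" for x :: real
    using that by (simp add: power_le_one inverse_le_1_iff)
  show "(inverse has_real_derivative - (inverse x ^ 2)) (at x)" if "x \<in> {1..}" for x :: real
    using that DERIV_inverse[of x UNIV] by (simp add: numeral_2_eq_2)
qed auto

section \<open>Left-invariant curves and loops\<close>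

lemma AE_lborel_shift:
  fixes P :: "'a::euclidean_space \<Rightarrow> bool"
  assumes "AE x in lborel. P x"
  shows "AE x in lborel. P (x - c)"
proof (rule negligible_imp_AE_lborel)
  have "{x. \<not> P (x - c)} = (+) c ` {x. \<not> P x}"
    by (auto simp: image_iff intro!: exI[of _ "_ - c"])
  then show "negligible {x. \<not> P (x - c)}"
    using AE_lborel_imp_negligible[OF assms] by (simp add: negligible_translation)
qed

lemma bounded_bilinear_matrix_mult:
  "bounded_bilinear ((**) :: 'k::{real_normed_field,euclidean_space}^'n^'m \<Rightarrow> 'k^'p^'n \<Rightarrow> 'k^'p^'m)"
proof -
  have "bilinear ((**) :: 'k^'n^'m \<Rightarrow> 'k^'p^'n \<Rightarrow> 'k^'p^'m)"
    unfolding bilinear_def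
    by (intro conjI allI linearI)
      (simp_all add: matrix_matrix_mult_def vec_eq_iff sum.distrib scaleR_sum_right algebra_simps)
  then show ?thesis by (simp only: bilinear_conv_bounded_bilinear)
qed

lemmas matrix_scaleR_left = bounded_bilinear.scaleR_left[OF bounded_bilinear_matrix_mult]
  and matrix_scaleR_right = bounded_bilinear.scaleR_right[OF bounded_bilinear_matrix_mult]
  and matrix_add_left = bounded_bilinear.add_left[OF bounded_bilinear_matrix_mult]
  and matrix_diff_left = bounded_bilinear.diff_left[OF bounded_bilinear_matrix_mult]
  and matrix_diff_right = bounded_bilinear.diff_right[OF bounded_bilinear_matrix_mult]

lemma independent_card3I:
  fixes X Y Z :: "'a::real_vector"
  assumes "\<And>a b c. a *\<^sub>R X + b *\<^sub>R Y + c *\<^sub>R Z = 0 \<Longrightarrow> a = 0 \<and> b = 0 \<and> c = 0"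
  shows "independent {X, Y, Z}" "card {X, Y, Z} = 3"
proof -
  have ne: "X \<noteq> Y" "X \<noteq> Z" "Y \<noteq> Z"
    using assms[of 1 "-1" 0] assms[of 1 0 "-1"] assms[of 0 1 "-1"] by auto
  then show "card {X, Y, Z} = 3" by simp
  show "independent {X, Y, Z}"
  proof (rule independent_if_scalars_zero)
    fix f x assume "(\<Sum>x\<in>{X, Y, Z}. f x *\<^sub>R x) = 0" "x \<in> {X, Y, Z}"
    then show "f x = 0" using ne assms[of "f X" "f Y" "f Z"] by (auto simp: add.assoc)
  qed simp
qed

lemma g_frame_independent2:
  assumes "g_frame L kap chi X1 X2 X3"
  shows "independent {X1, X2}" "X1 \<noteq> X2"
proof -
  have *: "independent {X1, X2, X3}" "card {X1, X2, X3} = 3"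
    using assms by (auto simp: g_frame_def)
  show "independent {X1, X2}" by (rule independent_mono[OF *(1)]) auto
  show "X1 \<noteq> X2" using *(2) by (auto simp: card_insert_if split: if_splits)
qed

lemma g_frame_lin_indep:
  assumes "g_frame L kap chi X1 X2 X3" "a *\<^sub>R X1 + b *\<^sub>R X2 = 0"
  shows "a = 0" "b = 0"
proof -
  have "X2 \<noteq> 0" "X1 \<notin> span {X2}"
    using g_frame_independent2[OF assms(1)] dependent_zero[of "{X1, X2}"]
    by (auto simp: independent_insert)
  show "a = 0"
  proof (rule ccontr)
    assume "a \<noteq> 0"
    have "a *\<^sub>R X1 = (- b) *\<^sub>R X2" using assms(2) by (simp add: add_eq_0_iff2)
    then have "(1 / a) *\<^sub>R (a *\<^sub>R X1) = (1 / a) *\<^sub>R ((- b) *\<^sub>R X2)" by simp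
    then have "X1 = (- b / a) *\<^sub>R X2" using \<open>a \<noteq> 0\<close> by simp
    then show False using \<open>X1 \<notin> span {X2}\<close> by (metis span_base span_scale singletonI)
  qed
  then show "b = 0" using assms(2) \<open>X2 \<noteq> 0\<close> by simp
qed

text \<open>Makes the definite description in \<open>li_coords\<close> meaningful: the left inverse
  cancels \<open>g\<close>, and independence of \<open>X1\<close>, \<open>X2\<close> leaves one pair
  of coefficients.\<close>

lemma li_coords_mult:
  assumes g: "h ** g = mat 1"
    and indep: "\<And>a b. a *\<^sub>R X1 + b *\<^sub>R X2 = 0 \<Longrightarrow> a = 0 \<and> b = 0"
  shows "li_coords X1 X2 g (g ** (a *\<^sub>R X1 + b *\<^sub>R X2)) = (a, b)"
  unfolding li_coords_def
proof (rule the_equality)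
  fix p assume "g ** (a *\<^sub>R X1 + b *\<^sub>R X2) = g ** (fst p *\<^sub>R X1 + snd p *\<^sub>R X2)"
  then have "h ** (g ** (a *\<^sub>R X1 + b *\<^sub>R X2)) = h ** (g ** (fst p *\<^sub>R X1 + snd p *\<^sub>R X2))"
    by simp
  then have "a *\<^sub>R X1 + b *\<^sub>R X2 = fst p *\<^sub>R X1 + snd p *\<^sub>R X2"
    by (simp add: matrix_mul_assoc g matrix_mul_lid)
  then have "(fst p - a) *\<^sub>R X1 + (snd p - b) *\<^sub>R X2 = 0"
    by (simp add: scaleR_left_diff_distrib algebra_simps)
  then show "p = (a, b)" using indep[of "fst p - a" "snd p - b"] by (auto simp: prod_eq_iff)
qed simp

text \<open>A closed timelike curve through the initial point can be traversed arbitrarily often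
  before following any given admissible curve.\<close>
lemma loop_imp_sL_dist_infinite:
  fixes X1 X2 :: "'k::{real_normed_field,euclidean_space}^'n^'n" and c :: "real \<Rightarrow> 'k^'n^'n"
  assumes P: "P > 0" and c0: "\<And>n::nat. c (real n * P) = x0"
    and cG: "\<And>t. c t \<in> G" and inv: "\<And>g. g \<in> G \<Longrightarrow> \<exists>h. h ** g = mat 1"
    and d: "\<And>t. (c has_vector_derivative (c t ** X1)) (at t)"
    and bd: "\<And>t. norm (c t ** X1) \<le> K"
    and indep: "\<And>a b. a *\<^sub>R X1 + b *\<^sub>R X2 = 0 \<Longrightarrow> a = 0 \<and> b = 0"
    and att: "attainable (li_admissible G X1 X2) x0 x1"
  shows "sL_dist (li_admissible G X1 X2) (li_length X1 X2) x0 x1 = \<infinity>"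
proof -
  obtain x t1 where x: "li_admissible G X1 X2 x t1" "x 0 = x0" "x t1 = x1"
    using att by (auto simp: attainable_def)
  then have t1: "0 < t1" and xG: "\<And>t. t \<in> {0..t1} \<Longrightarrow> x t \<in> G"
    and ae: "AE t in lborel. t \<in> {0..t1} \<longrightarrow>
        x differentiable (at t) \<and> li_cone X1 X2 (x t) (vector_derivative x (at t))"
    by (auto simp: li_admissible_def)
  obtain C where C: "C-lipschitz_on {0..t1} x" using x(1) by (auto simp: li_admissible_def)
  have K0: "K \<ge> 0" using bd[of 0] norm_ge_zero order_trans by blast
  have clip: "K-lipschitz_on S c" if "convex S" for S
  proof (rule bounded_derivative_imp_lipschitz)
    show "(c has_derivative (\<lambda>h. h *\<^sub>R (c t ** X1))) (at t within S)" for t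
      using d[of t] by (auto simp: has_vector_derivative_def intro: has_derivative_at_withinI)
    show "onorm (\<lambda>h. h *\<^sub>R (c t ** X1)) \<le> K" for t
      using bd[of t] by (simp add: onorm_scaleR_left[OF bounded_linear_ident] onorm_id)
  qed (use that K0 in auto)
  have ge: "ennreal (real n * P) \<le> sL_dist (li_admissible G X1 X2) (li_length X1 X2) x0 x1" for n
  proof -
    define T where "T = real n * P"
    have T0: "T \<ge> 0" using P by (simp add: T_def)
    define w where "w t = (if t \<le> T then c t else x (t - T))" for t
    have w_lt: "(w has_vector_derivative (c t ** X1)) (at t)" if "t < T" for t
    proof (rule has_vector_derivative_transform_within_open[where S = "{..<T}", OF d])
      show "c s = w s" if "s \<in> {..<T}" for s using that by (simp add: w_def)
    qed (use that in auto)
    have w_gt: "w differentiable (at t) \<and> vector_derivative w (at t) = vector_derivative x (at (t - T))"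
      if "t > T" "x differentiable (at (t - T))" for t
    proof -
      have "(x has_vector_derivative vector_derivative x (at (t - T))) (at (t - T))"
        using that(2) by (simp add: vector_derivative_works)
      moreover have "((\<lambda>t. t - T) has_vector_derivative 1) (at t)"
        by (auto intro!: derivative_eq_intros)
      ultimately have "((x \<circ> (\<lambda>t. t - T)) has_vector_derivative 1 *\<^sub>R vector_derivative x (at (t - T))) (at t)"
        by (rule vector_diff_chain_at[rotated])
      then have "(w has_vector_derivative vector_derivative x (at (t - T))) (at t)"
        using has_vector_derivative_transform_within_open[of "x \<circ> (\<lambda>t. t - T)" _ t "{T<..}" w] that
        by (auto simp: w_def)
      then show ?thesis by (auto simp: vector_derivative_at intro: differentiableI_vector)
    qed
    have "li_admissible G X1 X2 w (T + t1)"
      unfolding li_admissible_def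
    proof (intro conjI ballI)
      show "0 < T + t1" using T0 t1 by simp
      show "w t \<in> G" if "t \<in> {0..T + t1}" for t using that cG xG[of "t - T"] by (auto simp: w_def)
      have "(max K C)-lipschitz_on {0..T + t1} w"
        unfolding w_def
      proof (rule lipschitz_on_concat_max)
        have "(C * 1)-lipschitz_on {T..T + t1} (\<lambda>t. x (t - T))"
        proof (rule lipschitz_on_compose2[of 1 _ "\<lambda>t. t - T" C x])
          show "1-lipschitz_on {T..T + t1} (\<lambda>t. t - T)" by (intro lipschitz_onI) (auto simp: dist_real_def)
          show "C-lipschitz_on ((\<lambda>t. t - T) ` {T..T + t1}) x"
            by (rule lipschitz_on_subset[OF C]) auto
        qed
        then show "C-lipschitz_on {T..T + t1} (\<lambda>t. x (t - T))" by simp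
        show "K-lipschitz_on {0..T} c" by (rule clip) simp
        show "c T = x (T - T)" using c0[of n] x(2) by (simp add: T_def)
      qed
      then show "\<exists>C. C-lipschitz_on {0..T + t1} w" ..
      have "AE t in lborel. t \<noteq> T" by (rule AE_lborel_singleton)
      moreover have "AE t in lborel. t - T \<in> {0..t1} \<longrightarrow>
        x differentiable (at (t - T)) \<and> li_cone X1 X2 (x (t - T)) (vector_derivative x (at (t - T)))"
        by (rule AE_lborel_shift[OF ae])
      ultimately show "AE t in lborel. t \<in> {0..T + t1} \<longrightarrow>
          w differentiable at t \<and> li_cone X1 X2 (w t) (vector_derivative w (at t))"
      proof eventually_elim
        case (elim t)
        show ?case
        proof (cases "t < T")
          case True
          have "li_cone X1 X2 (w t) (c t ** X1)"
            unfolding li_cone_def using True by (intro exI[of _ 1] exI[of _ 0]) (auto simp: w_def)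
          then show ?thesis using w_lt[OF True]
            by (auto simp: vector_derivative_at intro: differentiableI_vector)
        next
          case False
          then have "t > T" using elim by simp
          then show ?thesis using elim w_gt[of t] by (auto simp: w_def)
        qed
      qed
    qed
    moreover have "w 0 = x0" "w (T + t1) = x1"
      using c0[of 0] x(3) t1 T0 by (auto simp: w_def)
    ultimately have "li_length X1 X2 w (T + t1) \<le> sL_dist (li_admissible G X1 X2) (li_length X1 X2) x0 x1"
      unfolding sL_dist_def by (intro SUP_upper2[of "(w, T + t1)"]) auto
    moreover have "ennreal T \<le> li_length X1 X2 w (T + t1)"
    proof -
      \<comment> \<open>On \<open>{0<..<T}\<close> the velocity \<open>c t ** X1\<close> has
        coordinates \<open>(1, 0)\<close>, so its Lorentzian length is 1 and \<open>n\<close> turns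
        contribute \<open>n * P\<close>. The contribution of the appended arc is nonnegative and is
        dropped.\<close>
      have "ennreal T = (\<integral>\<^sup>+ t. indicator {0<..<T} t \<partial>lborel)"
        using T0 by simp
      also have "\<dots> \<le> li_length X1 X2 w (T + t1)"
        unfolding li_length_def
      proof (rule nn_integral_mono)
        fix t
        have "ennreal (sqrt \<bar>li_q X1 X2 (w t) (vector_derivative w (at t))\<bar>) = 1" if "0 < t" "t < T"
        proof -
          have "vector_derivative w (at t) = c t ** (1 *\<^sub>R X1 + 0 *\<^sub>R X2)"
            using vector_derivative_at[OF w_lt[OF that(2)]] by simp
          moreover have "w t = c t" using that by (simp add: w_def)
          moreover obtain h where "h ** c t = mat 1" using inv[OF cG] by blast
          ultimately show ?thesis
            using li_coords_mult[of h "c t" X1 X2 1 0] indep by (simp add: li_q_def)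
        qed
        then show "indicator {0<..<T} t \<le> ennreal (sqrt \<bar>li_q X1 X2 (w t) (vector_derivative w (at t))\<bar>)
              * indicator {0..T + t1} t"
          using t1 by (auto simp: indicator_def)
      qed
      finally show ?thesis .
    qed
    ultimately show ?thesis unfolding T_def by (rule order_trans[rotated])
  qed
  show ?thesis
  proof (rule ccontr)
    assume "sL_dist (li_admissible G X1 X2) (li_length X1 X2) x0 x1 \<noteq> \<infinity>"
    then obtain r where r: "r \<ge> 0" "sL_dist (li_admissible G X1 X2) (li_length X1 X2) x0 x1 = ennreal r"
      by (cases "sL_dist (li_admissible G X1 X2) (li_length X1 X2) x0 x1") auto
    obtain n :: nat where "r < real n * P" using reals_Archimedean3[OF P] by blast
    then show False using ge[of n] r by simp
  qed
qed

section \<open>The group SU(2)\<close>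

lemma matrix2_eqI:
  fixes A B :: "'a^2^2"
  assumes "A $ 1 $ 1 = B $ 1 $ 1" "A $ 1 $ 2 = B $ 1 $ 2" "A $ 2 $ 1 = B $ 2 $ 1" "A $ 2 $ 2 = B $ 2 $ 2"
  shows "A = B"
  using assms by (simp add: vec_eq_iff forall_2)

lemma matrix2_mult_nth:
  fixes A B :: "'a::semiring_1^2^2"
  shows "(A ** B) $ i $ j = A $ i $ 1 * B $ 1 $ j + A $ i $ 2 * B $ 2 $ j"
  by (simp add: matrix_matrix_mult_def sum_2)

lemma mat2_nth:
  "(mat c :: 'a::zero^2^2) $ 1 $ 1 = c" "(mat c :: 'a::zero^2^2) $ 1 $ 2 = 0"
  "(mat c :: 'a::zero^2^2) $ 2 $ 1 = 0" "(mat c :: 'a::zero^2^2) $ 2 $ 2 = c"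
  by (simp_all add: mat_def)

lemma mtrace_2: "mtrace (A :: 'k::comm_ring_1^2^2) = A $ 1 $ 1 + A $ 2 $ 2"
  by (simp add: mtrace_def sum_2)

lemma su2_alg_frame:
  assumes "kap + chi < 0" "kap - chi > 0"
  shows "\<exists>X1 X2 X3. g_frame su2_alg kap chi X1 X2 X3"
proof -
  \<comment> \<open>Scaling the quaternion basis as \<open>x I\<close>, \<open>y J\<close>,
    \<open>2 x y K\<close> gives \<open>[X1, X3] = - 4 x^2 X2\<close> and
    \<open>[X2, X3] = 4 y^2 X1\<close>. Matching the prescribed coefficients fixes \<open>x\<close>
    and \<open>y\<close>, and the hypotheses make both radicands positive.\<close>
  define x y where "x = sqrt (- kap - chi) / 2" and "y = sqrt (kap - chi) / 2"
  have xy: "x > 0" "y > 0" "4 * x\<^sup>2 = - kap - chi" "4 * y\<^sup>2 = kap - chi"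
    using assms by (auto simp: x_def y_def power_divide)
  define I J K :: "complex^2^2" where
    "I = vector [vector [\<i>, 0], vector [0, - \<i>]]" and
    "J = vector [vector [0, 1], vector [- 1, 0]]" and
    "K = vector [vector [0, \<i>], vector [\<i>, 0]]"
  have nth: "I $ 1 $ 1 = \<i>" "I $ 1 $ 2 = 0" "I $ 2 $ 1 = 0" "I $ 2 $ 2 = - \<i>"
    "J $ 1 $ 1 = 0" "J $ 1 $ 2 = 1" "J $ 2 $ 1 = - 1" "J $ 2 $ 2 = 0"
    "K $ 1 $ 1 = 0" "K $ 1 $ 2 = \<i>" "K $ 2 $ 1 = \<i>" "K $ 2 $ 2 = 0"
    by (simp_all add: I_def J_def K_def)
  have br: "lie_br I J = 2 *\<^sub>R K" "lie_br I K = (- 2) *\<^sub>R J" "lie_br J K = 2 *\<^sub>R I"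
    by (auto intro!: matrix2_eqI simp: lie_br_def matrix2_mult_nth nth scaleR_conv_of_real[where 'a = complex])
  have lie_scale: "lie_br (a *\<^sub>R A) (b *\<^sub>R B) = (a * b) *\<^sub>R lie_br A B" for a b and A B :: "complex^2^2"
    by (simp add: lie_br_def matrix_scaleR_left matrix_scaleR_right scaleR_diff_right mult.commute)
  define X1 X2 X3 where "X1 = x *\<^sub>R I" and "X2 = y *\<^sub>R J" and "X3 = (2 * x * y) *\<^sub>R K"
  have mem: "X1 \<in> su2_alg" "X2 \<in> su2_alg" "X3 \<in> su2_alg"
    by (auto intro!: matrix2_eqI simp: su2_alg_def cstar_def mtrace_2 X1_def X2_def X3_def nth
        scaleR_conv_of_real[where 'a = complex])
  have indep: "a = 0 \<and> b = 0 \<and> c = 0" if "a *\<^sub>R X1 + b *\<^sub>R X2 + c *\<^sub>R X3 = 0" for a b c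
  proof -
    have "(a *\<^sub>R X1 + b *\<^sub>R X2 + c *\<^sub>R X3) $ i $ j = 0" for i j using that by simp
    from this[of 1 1] this[of 1 2] show ?thesis
      using xy(1,2) by (simp add: X1_def X2_def X3_def nth complex_eq_iff)
  qed
  have sp: "A \<in> span {X1, X2, X3}" if A: "A \<in> su2_alg" for A
  proof -
    have c: "cnj (A $ j $ i) = - A $ i $ j" for i j
      using A by (simp add: su2_alg_def cstar_def vec_eq_iff)
    have tr: "A $ 1 $ 1 + A $ 2 $ 2 = 0" using A by (simp add: su2_alg_def mtrace_2)
    have "A = (Im (A $ 1 $ 1) / x) *\<^sub>R X1 + (Re (A $ 1 $ 2) / y) *\<^sub>R X2 + (Im (A $ 1 $ 2) / (2 * x * y)) *\<^sub>R X3"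
      using xy(1,2) c[of 1 1] c[of 1 2] c[of 2 1] tr
      by (intro matrix2_eqI) (auto simp: X1_def X2_def X3_def nth complex_eq_iff)
    then show ?thesis
      by (metis (no_types, lifting) insertCI span_add span_base span_scale)
  qed
  have "lie_br X1 X2 = X3" "lie_br X1 X3 = (kap + chi) *\<^sub>R X2" "lie_br X2 X3 = (kap - chi) *\<^sub>R X1"
  proof -
    have "x * (2 * x * y) * (- 2) = (- (4 * x\<^sup>2)) * y" "y * (2 * x * y) * 2 = (4 * y\<^sup>2) * x"
      by (simp_all add: power2_eq_square algebra_simps)
    then have "x * (2 * x * y) * (- 2) = (kap + chi) * y" "y * (2 * x * y) * 2 = (kap - chi) * x"
      unfolding xy(3,4) by simp_all
    then show "lie_br X1 X2 = X3" "lie_br X1 X3 = (kap + chi) *\<^sub>R X2" "lie_br X2 X3 = (kap - chi) *\<^sub>R X1"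
      unfolding X1_def X2_def X3_def lie_scale br scaleR_scaleR by (simp_all add: mult.commute)
  qed
  then show ?thesis
    using mem independent_card3I[OF indep] sp unfolding g_frame_def by blast
qed

text \<open>Cayley-Hamilton: a traceless 2 by 2 matrix squares to \<open>- det X\<close> times the
  identity, and for an antihermitian one \<open>det X\<close> is this sum of squared moduli. It
  makes the one-parameter group of \<open>X\<close> trigonometric, hence periodic.\<close>

lemma su2_alg_square:
  assumes "X \<in> su2_alg"
  shows "X ** X = - ((cmod (X $ 1 $ 1))\<^sup>2 + (cmod (X $ 1 $ 2))\<^sup>2) *\<^sub>R mat 1"
proof -
  have c: "cnj (X $ j $ i) = - X $ i $ j" for i j
    using assms by (simp add: su2_alg_def cstar_def vec_eq_iff)
  have tr: "X $ 2 $ 2 = - X $ 1 $ 1" using assms by (simp add: su2_alg_def mtrace_2 add_eq_0_iff)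
  have 11: "X $ 1 $ 1 * X $ 1 $ 1 = - of_real ((cmod (X $ 1 $ 1))\<^sup>2)"
    using c[of 1 1] complex_norm_square[of "X $ 1 $ 1"] by simp
  have 21: "X $ 2 $ 1 = - cnj (X $ 1 $ 2)" using c[of 1 2] by simp
  have 12: "X $ 1 $ 2 * cnj (X $ 1 $ 2) = of_real ((cmod (X $ 1 $ 2))\<^sup>2)"
    using complex_norm_square[of "X $ 1 $ 2"] by simp
  show ?thesis
    by (intro matrix2_eqI)
      (simp_all add: matrix2_mult_nth tr 21 11 12 mat2_nth scaleR_conv_of_real[where 'a = complex] mult.commute[of "cnj _"] algebra_simps)
qed

lemma cstar_mult: "cstar (A ** B) = cstar B ** cstar A"
  by (simp add: cstar_def matrix_matrix_mult_def vec_eq_iff mult.commute)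

lemma SU2_mult:
  assumes "A \<in> SU2" "B \<in> SU2"
  shows "A ** B \<in> SU2"
proof -
  have "A ** B ** (cstar B ** cstar A) = A ** (B ** cstar B) ** cstar A"
    by (simp add: matrix_mul_assoc)
  then show ?thesis using assms by (simp add: SU2_def cstar_mult det_mul)
qed

lemma SU2_sL_dist_infinite:
  assumes frame: "g_frame su2_alg kap chi X1 X2 X3" and x0: "x0 \<in> SU2"
    and att: "attainable (li_admissible SU2 X1 X2) x0 x1"
  shows "sL_dist (li_admissible SU2 X1 X2) (li_length X1 X2) x0 x1 = \<infinity>"
proof -
  have X: "X1 \<in> su2_alg" using frame by (simp add: g_frame_def)
  have indep: "a = 0 \<and> b = 0" if "a *\<^sub>R X1 + b *\<^sub>R X2 = 0" for a b
    using g_frame_lin_indep[OF frame that] by simp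
  define d where "d = (cmod (X1 $ 1 $ 1))\<^sup>2 + (cmod (X1 $ 1 $ 2))\<^sup>2"
  define l where "l = sqrt d"
  have sq: "X1 ** X1 = - d *\<^sub>R mat 1" unfolding d_def by (rule su2_alg_square[OF X])
  have c: "cnj (X1 $ j $ i) = - X1 $ i $ j" for i j
    using X by (simp add: su2_alg_def cstar_def vec_eq_iff)
  have tr: "X1 $ 2 $ 2 = - X1 $ 1 $ 1" using X by (simp add: su2_alg_def mtrace_2 add_eq_0_iff)
  have "d \<noteq> 0"
  proof
    assume "d = 0"
    then have "X1 $ 1 $ 1 = 0" "X1 $ 1 $ 2 = 0" by (simp_all add: d_def add_nonneg_eq_0_iff)
    moreover from this have "X1 $ 2 $ 1 = 0" using c[of 1 2] by simp
    ultimately have "X1 = 0" using tr by (intro matrix2_eqI) auto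
    then show False using indep[of 1 0] by simp
  qed
  then have d: "d > 0" by (simp add: d_def less_le)
  then have l: "l > 0" "l\<^sup>2 = d" by (simp_all add: l_def)
  \<comment> \<open>This is \<open>exp (t X1)\<close>: since \<open>X1 ** X1\<close> is
    \<open>- l^2\<close> times the identity, the exponential series splits into cosine and sine,
    with period \<open>2 * pi / l\<close>.\<close>
  define E where "E t = cos (l * t) *\<^sub>R mat 1 + (sin (l * t) / l) *\<^sub>R X1" for t
  have EX: "E t ** X1 = (- l * sin (l * t)) *\<^sub>R mat 1 + cos (l * t) *\<^sub>R X1" for t
    using l by (simp add: E_def matrix_add_left matrix_scaleR_left sq power2_eq_square
        flip: l(2))
  have E_SU2: "E t \<in> SU2" for t
  proof -
    have cs: "cstar (E t) = cos (l * t) *\<^sub>R mat 1 - (sin (l * t) / l) *\<^sub>R X1"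
      using c by (simp add: E_def cstar_def vec_eq_iff mat_def)
    have one: "(cos (l * t))\<^sup>2 + (sin (l * t) / l)\<^sup>2 * d = 1"
      using l d by (simp add: power_divide)
    have "E t ** cstar (E t) = ((cos (l * t))\<^sup>2 + (sin (l * t) / l)\<^sup>2 * d) *\<^sub>R mat 1"
      unfolding cs unfolding E_def
      by (simp add: matrix_add_left matrix_diff_right matrix_scaleR_left matrix_scaleR_right sq
          algebra_simps power2_eq_square)
    \<comment> \<open>Unitarity fixes only the modulus of the determinant, so its value is computed
      separately.\<close>
    moreover have "det (E t) = of_real ((cos (l * t))\<^sup>2 + (sin (l * t) / l)\<^sup>2 * d)"
    proof -
      have "X1 $ 1 $ 1 * X1 $ 1 $ 1 + X1 $ 1 $ 2 * X1 $ 2 $ 1 = - of_real d"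
        using arg_cong[OF sq, of "\<lambda>A. A $ 1 $ 1"] by (simp add: matrix2_mult_nth mat2_nth scaleR_conv_of_real[where 'a = complex])
      then have e: "X1 $ 1 $ 2 * X1 $ 2 $ 1 = - of_real d - X1 $ 1 $ 1 * X1 $ 1 $ 1"
        by (simp add: eq_diff_eq add.commute)
      define v where "v = complex_of_real (sin (l * t) / l)"
      have "det (E t) = of_real (cos (l * t)) * of_real (cos (l * t)) - v * v * (X1 $ 1 $ 1 * X1 $ 1 $ 1)
         - v * v * (X1 $ 1 $ 2 * X1 $ 2 $ 1)"
        by (simp add: E_def det_2 mat2_nth tr scaleR_conv_of_real[where 'a = complex] v_def algebra_simps)
      also have "\<dots> = of_real (cos (l * t)) * of_real (cos (l * t)) + v * v * of_real d"
        unfolding e by (simp add: algebra_simps)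
      finally show ?thesis by (simp add: v_def power2_eq_square)
    qed
    ultimately show ?thesis by (simp add: SU2_def one)
  qed
  define cv where "cv t = x0 ** E t" for t
  have cv_alt: "cv = (\<lambda>t. cos (l * t) *\<^sub>R x0 + (sin (l * t) / l) *\<^sub>R (x0 ** X1))"
    by (auto simp: cv_def E_def matrix_add_ldistrib matrix_scaleR_right)
  have cvX: "cv t ** X1 = (- l * sin (l * t)) *\<^sub>R x0 + cos (l * t) *\<^sub>R (x0 ** X1)" for t
  proof -
    have "cv t ** X1 = x0 ** (E t ** X1)" by (simp add: cv_def matrix_mul_assoc)
    then show ?thesis by (simp only: EX matrix_add_ldistrib matrix_scaleR_right matrix_mul_rid)
  qed
  show ?thesis
  proof (rule loop_imp_sL_dist_infinite[where c = cv and P = "2 * pi / l" and K = "l * norm x0 + norm (x0 ** X1)"])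
    show "0 < 2 * pi / l" using l by simp
    show "cv (real n * (2 * pi / l)) = x0" for n
    proof -
      have "l * (real n * (2 * pi / l)) = 2 * pi * of_int (int n)" using l by simp
      then show ?thesis by (simp only: cv_alt cos_int_2pin sin_int_2pin) simp
    qed
    show "cv t \<in> SU2" for t unfolding cv_def by (rule SU2_mult[OF x0 E_SU2])
    show "\<exists>h. h ** g = mat 1" if "g \<in> SU2" for g
      using that by (auto simp: SU2_def intro!: exI[of _ "cstar g"] simp: matrix_left_right_inverse)
    show "(cv has_vector_derivative cv t ** X1) (at t)" for t
      unfolding cvX unfolding cv_alt
      using l by (auto intro!: derivative_eq_intros simp: has_vector_derivative_def fun_eq_iff algebra_simps)
    show "norm (cv t ** X1) \<le> l * norm x0 + norm (x0 ** X1)" for t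
    proof -
      have "norm (cv t ** X1) \<le> \<bar>- l * sin (l * t)\<bar> * norm x0 + \<bar>cos (l * t)\<bar> * norm (x0 ** X1)"
        unfolding cvX by (metis norm_triangle_ineq norm_scaleR)
      also have "\<dots> \<le> l * norm x0 + 1 * norm (x0 ** X1)"
        using l by (intro add_mono mult_right_mono) (auto simp: abs_mult)
      finally show ?thesis by simp
    qed
  qed (use indep att in auto)
qed

section \<open>The Lie algebra of SL(2,R)\<close>

lemma sl2_alg_frame:
  assumes "kap + chi < 0" "kap - chi < 0"
  shows "\<exists>X1 X2 X3. g_frame sl2_alg kap chi X1 X2 X3"
proof -
  \<comment> \<open>For the rotation generator \<open>J\<close> and the symmetric matrices
    \<open>H\<close>, \<open>S\<close>, the scaling \<open>x J\<close>, \<open>y H\<close>,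
    \<open>2 x y S\<close> gives \<open>[X1, X3] = - 4 x^2 X2\<close> and
    \<open>[X2, X3] = - 4 y^2 X1\<close>, which dictates \<open>x\<close> and
    \<open>y\<close>.\<close>
  define x y where "x = sqrt (- kap - chi) / 2" and "y = sqrt (chi - kap) / 2"
  have xy: "x > 0" "y > 0" "4 * x\<^sup>2 = - kap - chi" "4 * y\<^sup>2 = chi - kap"
    using assms by (auto simp: x_def y_def power_divide)
  define J H S :: "real^2^2" where
    "J = vector [vector [0, - 1], vector [1, 0]]" and
    "H = vector [vector [1, 0], vector [0, - 1]]" and
    "S = vector [vector [0, 1], vector [1, 0]]"
  have nth: "J $ 1 $ 1 = 0" "J $ 1 $ 2 = - 1" "J $ 2 $ 1 = 1" "J $ 2 $ 2 = 0"
    "H $ 1 $ 1 = 1" "H $ 1 $ 2 = 0" "H $ 2 $ 1 = 0" "H $ 2 $ 2 = - 1"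
    "S $ 1 $ 1 = 0" "S $ 1 $ 2 = 1" "S $ 2 $ 1 = 1" "S $ 2 $ 2 = 0"
    by (simp_all add: J_def H_def S_def)
  have br: "lie_br J H = 2 *\<^sub>R S" "lie_br J S = (- 2) *\<^sub>R H" "lie_br H S = (- 2) *\<^sub>R J"
    by (auto intro!: matrix2_eqI simp: lie_br_def matrix2_mult_nth nth)
  have lie_scale: "lie_br (a *\<^sub>R A) (b *\<^sub>R B) = (a * b) *\<^sub>R lie_br A B" for a b and A B :: "real^2^2"
    by (simp add: lie_br_def matrix_scaleR_left matrix_scaleR_right scaleR_diff_right mult.commute)
  define X1 X2 X3 where "X1 = x *\<^sub>R J" and "X2 = y *\<^sub>R H" and "X3 = (2 * x * y) *\<^sub>R S"
  have mem: "X1 \<in> sl2_alg" "X2 \<in> sl2_alg" "X3 \<in> sl2_alg"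
    by (auto simp: sl2_alg_def mtrace_2 X1_def X2_def X3_def nth)
  have indep: "a = 0 \<and> b = 0 \<and> c = 0" if "a *\<^sub>R X1 + b *\<^sub>R X2 + c *\<^sub>R X3 = 0" for a b c
  proof -
    have e: "(a *\<^sub>R X1 + b *\<^sub>R X2 + c *\<^sub>R X3) $ i $ j = 0" for i j using that by simp
    have "b = 0" using e[of 1 1] xy(1,2) by (simp add: X1_def X2_def X3_def nth)
    moreover have "c * (2 * x * y) - a * x = 0" "a * x + c * (2 * x * y) = 0"
      using e[of 1 2] e[of 2 1] by (simp_all only: X1_def X2_def X3_def nth vector_add_component vector_scaleR_component) simp_all
    then have "a * x = 0" "c * (2 * x * y) = 0" by linarith+
    ultimately show ?thesis using xy(1,2) by simp
  qed
  have sp: "A \<in> span {X1, X2, X3}" if A: "A \<in> sl2_alg" for A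
  proof -
    have tr: "A $ 2 $ 2 = - A $ 1 $ 1" using A by (simp add: sl2_alg_def mtrace_2)
    have "A = ((A $ 2 $ 1 - A $ 1 $ 2) / (2 * x)) *\<^sub>R X1 + (A $ 1 $ 1 / y) *\<^sub>R X2
        + ((A $ 2 $ 1 + A $ 1 $ 2) / (4 * x * y)) *\<^sub>R X3"
      using xy(1,2) tr by (intro matrix2_eqI) (auto simp: X1_def X2_def X3_def nth field_simps)
    then show ?thesis
      by (metis (no_types, lifting) insertCI span_add span_base span_scale)
  qed
  have "lie_br X1 X2 = X3" "lie_br X1 X3 = (kap + chi) *\<^sub>R X2" "lie_br X2 X3 = (kap - chi) *\<^sub>R X1"
  proof -
    have "x * (2 * x * y) * (- 2) = (- (4 * x\<^sup>2)) * y" "y * (2 * x * y) * (- 2) = (- (4 * y\<^sup>2)) * x"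
      by (simp_all add: power2_eq_square algebra_simps)
    then have "x * (2 * x * y) * (- 2) = (kap + chi) * y" "y * (2 * x * y) * (- 2) = (kap - chi) * x"
      unfolding xy(3,4) by simp_all
    then show "lie_br X1 X2 = X3" "lie_br X1 X3 = (kap + chi) *\<^sub>R X2" "lie_br X2 X3 = (kap - chi) *\<^sub>R X1"
      unfolding X1_def X2_def X3_def lie_scale br scaleR_scaleR by (simp_all add: mult.commute)
  qed
  then show ?thesis
    using mem independent_card3I[OF indep] sp unfolding g_frame_def by blast
qed

section \<open>Invariants of an arbitrary frame and the direction of rotation\<close>

text \<open>For traceless matrices \<open>X ** X\<close> is \<open>- det X\<close> and
  \<open>X ** Y + Y ** X\<close> is \<open>mtrace (X ** Y)\<close>, each times the identity;
  substitute both into \<open>X X Y - 2 X Y X + Y X X\<close>.\<close>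

lemma sl2_double_bracket:
  fixes X Y :: "real^2^2"
  assumes "mtrace X = 0" "mtrace Y = 0"
  shows "lie_br X (lie_br X Y) = (- 4 * det X) *\<^sub>R Y - (2 * mtrace (X ** Y)) *\<^sub>R X"
proof -
  have "X $ 2 $ 2 = - X $ 1 $ 1" "Y $ 2 $ 2 = - Y $ 1 $ 1" using assms by (simp_all add: mtrace_2)
  then show ?thesis
    by (intro matrix2_eqI) (simp_all add: lie_br_def matrix2_mult_nth mtrace_2 det_2 algebra_simps)
qed

text \<open>The bracket relations evaluate the double brackets of \<open>X1\<close> and
  \<open>X2\<close> a second time. Comparing coefficients with \<open>sl2_double_bracket\<close>
  yields \<open>mtrace (X1 ** X2) = 0\<close>, \<open>det X1 = - (kap + chi) / 4\<close> and
  \<open>det X2 = (kap - chi) / 4\<close> for every frame.\<close>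

lemma sl2_frame_det:
  assumes frame: "g_frame sl2_alg kap chi X1 X2 X3"
  shows "det (u1 *\<^sub>R X1 + u2 *\<^sub>R X2) = (- (kap + chi) * u1\<^sup>2 + (kap - chi) * u2\<^sup>2) / 4"
proof -
  have tr: "mtrace X1 = 0" "mtrace X2 = 0" using frame by (auto simp: g_frame_def sl2_alg_def)
  have br: "lie_br X1 X2 = X3" "lie_br X1 X3 = (kap + chi) *\<^sub>R X2" "lie_br X2 X3 = (kap - chi) *\<^sub>R X1"
    using frame by (auto simp: g_frame_def)
  have "(- (2 * mtrace (X1 ** X2))) *\<^sub>R X1 + (- 4 * det X1 - (kap + chi)) *\<^sub>R X2 = 0"
    using sl2_double_bracket[OF tr] br(1,2) by (simp add: algebra_simps)
  from g_frame_lin_indep[OF frame this] have *: "mtrace (X1 ** X2) = 0" "det X1 = - (kap + chi) / 4"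
    by auto
  have "lie_br X2 X1 = - X3" unfolding br(1)[symmetric] by (simp add: lie_br_def)
  then have "lie_br X2 (lie_br X2 X1) = - lie_br X2 X3"
    by (simp add: lie_br_def bounded_bilinear.minus_left[OF bounded_bilinear_matrix_mult]
        bounded_bilinear.minus_right[OF bounded_bilinear_matrix_mult])
  then have "(- 4 * det X2 + (kap - chi)) *\<^sub>R X1 + (- (2 * mtrace (X2 ** X1))) *\<^sub>R X2 = 0"
    using sl2_double_bracket[OF tr(2,1)] br(3) by (simp add: algebra_simps)
  from g_frame_lin_indep(1)[OF frame this] have d2: "det X2 = (kap - chi) / 4" by simp
  have "det (u1 *\<^sub>R X1 + u2 *\<^sub>R X2) = u1\<^sup>2 * det X1 + u2\<^sup>2 * det X2 - u1 * u2 * mtrace (X1 ** X2)"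
  proof -
    have "X1 $ 2 $ 2 = - X1 $ 1 $ 1" "X2 $ 2 $ 2 = - X2 $ 1 $ 1" using tr by (simp_all add: mtrace_2)
    then show ?thesis
      by (simp add: det_2 mtrace_2 matrix2_mult_nth algebra_simps power2_eq_square)
  qed
  then show ?thesis by (simp only: * d2) (simp add: field_simps)
qed

text \<open>For traceless \<open>M\<close> this is \<open>z' w - z w'\<close> when the row
  \<open>(z, w)\<close> moves by \<open>(z, w)' = (z, w) M\<close>: its clockwise angular speed
  times its squared length. Rows matter because a curve with \<open>g' = g M\<close> moves each row
  of \<open>g\<close> in this way.\<close>

definition angular_form :: "real^2^2 \<Rightarrow> real \<Rightarrow> real \<Rightarrow> real" where
  "angular_form M z w = M $ 2 $ 1 * w\<^sup>2 - M $ 1 $ 2 * z\<^sup>2 + 2 * M $ 1 $ 1 * z * w"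

text \<open>Let \<open>Q\<close> be the symmetric matrix of the quadratic form
  \<open>angular_form M\<close>. Its trace is \<open>M $ 2 $ 1 - M $ 1 $ 2\<close> and its
  determinant is \<open>det M\<close>, so this is Cayley-Hamilton,
  \<open>tr Q * Q = det Q + Q * Q\<close>, evaluated on \<open>(z, w)\<close>. It bounds the form
  from below without eigenvalues.\<close>

lemma angular_form_identity:
  assumes "mtrace M = 0"
  shows "(M $ 2 $ 1 - M $ 1 $ 2) * angular_form M z w =
    det M * (z\<^sup>2 + w\<^sup>2) + (M $ 1 $ 1 * w - M $ 1 $ 2 * z)\<^sup>2 + (M $ 1 $ 1 * z + M $ 2 $ 1 * w)\<^sup>2"
proof -
  have "M $ 2 $ 2 = - M $ 1 $ 1" using assms by (simp add: mtrace_2)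
  then show ?thesis by (simp add: angular_form_def det_2 power2_eq_square algebra_simps)
qed

text \<open>Since \<open>-kap - chi > chi - kap > 0\<close>, the determinant is positive on the closed cone
  \<open>\<bar>u2\<bar> \<le> u1\<close>, so all nonzero admissible velocities rotate in the same direction.\<close>
lemma sl2_cone_definite:
  assumes frame: "g_frame sl2_alg kap chi X1 X2 X3" and "kap < chi" "chi < 0"
  obtains s c :: real where "\<bar>s\<bar> = 1" "c > 0"
    "\<And>u1 u2 z w. \<bar>u2\<bar> \<le> u1 \<Longrightarrow> c * u1 * (z\<^sup>2 + w\<^sup>2) \<le> s * angular_form (u1 *\<^sub>R X1 + u2 *\<^sub>R X2) z w"
proof -
  define A where "A u1 u2 = u1 *\<^sub>R X1 + u2 *\<^sub>R X2" for u1 u2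
  define l where "l M = M $ 2 $ 1 - M $ 1 $ 2" for M :: "real^2^2"
  have tr: "mtrace (A u1 u2) = 0" for u1 u2
    using frame by (auto simp: g_frame_def sl2_alg_def mtrace_2 A_def algebra_simps simp flip: distrib_left)
  have lA: "l (A u1 u2) = u1 * l X1 + u2 * l X2" for u1 u2
    by (simp add: l_def A_def algebra_simps)
  \<comment> \<open>Four times the determinant is least at \<open>\<bar>u2\<bar> = u1\<close>, where
    it equals \<open>(- (kap + chi) + (kap - chi)) * u1^2 = - 2 * chi * u1^2\<close>.\<close>
  have detA: "det (A u1 u2) \<ge> (- chi / 2) * u1\<^sup>2" if "\<bar>u2\<bar> \<le> u1" for u1 u2
  proof -
    have "u2\<^sup>2 \<le> u1\<^sup>2" using that by (metis abs_ge_zero order_trans power2_abs power_mono)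
    then have "(kap - chi) * u1\<^sup>2 \<le> (kap - chi) * u2\<^sup>2"
      using assms(2) by (intro mult_left_mono_neg) auto
    then show ?thesis
      unfolding A_def sl2_frame_det[OF frame] by (simp add: algebra_simps)
  qed
  have l_nz: "l (A u1 u2) \<noteq> 0" if "\<bar>u2\<bar> \<le> u1" "u1 > 0" for u1 u2
  proof
    assume "l (A u1 u2) = 0"
    then have "A u1 u2 $ 2 $ 1 = A u1 u2 $ 1 $ 2" by (simp add: l_def)
    moreover have "A u1 u2 $ 2 $ 2 = - A u1 u2 $ 1 $ 1" using tr[of u1 u2] by (simp add: mtrace_2)
    ultimately have "det (A u1 u2) = - (A u1 u2 $ 1 $ 1)\<^sup>2 - (A u1 u2 $ 1 $ 2)\<^sup>2"
      by (simp add: det_2 power2_eq_square)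
    then have "det (A u1 u2) \<le> 0"
      using zero_le_power2[of "A u1 u2 $ 1 $ 1"] zero_le_power2[of "A u1 u2 $ 1 $ 2"] by linarith
    moreover have "(- chi / 2) * u1\<^sup>2 > 0" using that assms(3) by (intro mult_pos_pos) auto
    ultimately show False using detA[OF that(1)] by linarith
  qed
  \<comment> \<open>The direction of rotation depends on the frame; \<open>s\<close> records that of
    \<open>X1\<close>.\<close>
  define s where "s = sgn (l X1)"
  have s1: "l X1 \<noteq> 0" using l_nz[of 0 1] lA[of 1 0] by simp
  have s: "\<bar>s\<bar> = 1" "s * l X1 = \<bar>l X1\<bar>" "s * s = 1" using s1 by (auto simp: s_def sgn_if)
  have l_pos: "s * l (A u1 u2) > 0" if u: "\<bar>u2\<bar> \<le> u1" "u1 > 0" for u1 u2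
  proof (rule ccontr)
    assume "\<not> ?thesis"
    then have le: "u1 * \<bar>l X1\<bar> + u2 * (s * l X2) \<le> 0"
      unfolding s(2)[symmetric] lA by (simp add: algebra_simps)
    have pos: "u1 * \<bar>l X1\<bar> > 0" using u s1 by simp
    \<comment> \<open>If the sign differed from that of \<open>X1\<close>, the linear function
      \<open>l\<close> would vanish somewhere between \<open>(u1, 0)\<close> and
      \<open>(u1, u2)\<close>. That segment lies in the cone, where \<open>l_nz\<close> forbids a
      zero; \<open>r\<close> locates it.\<close>
    define y where "y = - (u2 * (s * l X2))"
    define r where "r = u1 * \<bar>l X1\<bar> / y"
    have y: "y > 0" "u1 * \<bar>l X1\<bar> \<le> y" using le pos by (auto simp: y_def)
    then have r: "0 < r" "r \<le> 1" using pos by (auto simp: r_def)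
    have "\<bar>r * u2\<bar> \<le> 1 * u1"
      unfolding abs_mult using r u by (intro mult_mono) auto
    then have "l (A u1 (r * u2)) \<noteq> 0" using l_nz u by simp
    moreover have "s * l (A u1 (r * u2)) = u1 * \<bar>l X1\<bar> - r * y"
      unfolding s(2)[symmetric] lA y_def by (simp add: algebra_simps)
    moreover have "u1 * \<bar>l X1\<bar> - r * y = 0" using y(1) by (simp add: r_def)
    ultimately show False using s(1) by auto
  qed
  define K where "K = \<bar>l X1\<bar> + \<bar>l X2\<bar>"
  have K: "K > 0" using s1 by (simp add: K_def)
  \<comment> \<open>Dividing the bound \<open>(- chi / 2) * u1^2\<close> on the determinant by the
    largest possible trace \<open>u1 * K\<close> of the form leaves this constant times
    \<open>u1\<close>.\<close>
  define c where "c = - chi / (2 * K)"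
  show thesis
  proof (rule that)
    show "\<bar>s\<bar> = 1" by (rule s)
    show "c > 0" unfolding c_def using K assms(3) by (intro divide_pos_pos) auto
    fix u1 u2 z w :: real assume u: "\<bar>u2\<bar> \<le> u1"
    show "c * u1 * (z\<^sup>2 + w\<^sup>2) \<le> s * angular_form (u1 *\<^sub>R X1 + u2 *\<^sub>R X2) z w"
    proof (cases "u1 = 0")
      case True
      then show ?thesis using u by (simp add: angular_form_def)
    next
      case False
      then have u1: "u1 > 0" using u by simp
      define L where "L = s * l (A u1 u2)"
      have L: "L > 0" unfolding L_def using l_pos[OF u u1] .
      have "L \<le> \<bar>l (A u1 u2)\<bar>" using s(1) by (simp add: L_def abs_mult flip: abs_mult) (metis abs_ge_self abs_mult mult_1)
      also have "\<dots> \<le> u1 * \<bar>l X1\<bar> + \<bar>u2\<bar> * \<bar>l X2\<bar>"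
        unfolding lA using u1 by (metis abs_mult abs_of_pos abs_triangle_ineq)
      also have "\<dots> \<le> u1 * K"
        unfolding K_def using u by (simp add: distrib_left mult_right_mono)
      finally have LK: "L \<le> u1 * K" .
      have "(- chi / 2) * u1\<^sup>2 * (z\<^sup>2 + w\<^sup>2) \<le> det (A u1 u2) * (z\<^sup>2 + w\<^sup>2)"
        using detA[OF u] by (intro mult_right_mono) auto
      also have "\<dots> \<le> l (A u1 u2) * angular_form (A u1 u2) z w"
        unfolding l_def angular_form_identity[OF tr] by simp
      also have "\<dots> = L * (s * angular_form (A u1 u2) z w)"
        using s(3) by (simp add: L_def algebra_simps flip: mult.assoc)
      finally have main: "(- chi / 2) * u1\<^sup>2 * (z\<^sup>2 + w\<^sup>2) \<le> L * (s * angular_form (A u1 u2) z w)" .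
      have "L * (c * u1 * (z\<^sup>2 + w\<^sup>2)) \<le> (u1 * K) * (c * u1 * (z\<^sup>2 + w\<^sup>2))"
        using LK \<open>c > 0\<close> u1 by (intro mult_right_mono) auto
      also have "\<dots> = (- chi / 2) * u1\<^sup>2 * (z\<^sup>2 + w\<^sup>2)"
        using K by (simp add: c_def power2_eq_square)
      finally have "L * (c * u1 * (z\<^sup>2 + w\<^sup>2)) \<le> L * (s * angular_form (A u1 u2) z w)"
        using main by linarith
      then show ?thesis using L by (simp add: A_def)
    qed
  qed
qed

section \<open>The winding function\<close>

lemma has_real_derivative_matrix_nth:
  fixes g :: "real \<Rightarrow> real^'n^'m"
  assumes "(g has_vector_derivative d) (at t)"
  shows "((\<lambda>s. g s $ i $ j) has_real_derivative d $ i $ j) (at t)"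
proof -
  have "bounded_linear (\<lambda>A :: real^'n^'m. A $ i $ j)"
    by (rule bounded_linear_compose[OF bounded_linear_vec_nth bounded_linear_vec_nth])
  from bounded_linear.has_vector_derivative[OF this assms] show ?thesis
    by (simp add: has_real_derivative_iff_has_vector_derivative)
qed

text \<open>The rotation angle of the orthogonal factor in the polar decomposition of \<open>g\<close>, lifted
  to the universal cover.\<close>
definition winding :: "(real^2^2) \<times> real \<Rightarrow> real" where
  "winding x = snd x - arctan ((fst x $ 1 $ 1 * fst x $ 1 $ 2 + fst x $ 2 $ 1 * fst x $ 2 $ 2)
      / ((fst x $ 1 $ 1)\<^sup>2 + (fst x $ 2 $ 1)\<^sup>2 + 1))"

text \<open>Here \<open>N\<close>, \<open>W\<close> and \<open>D\<close> are the squared lengths and the inner product of the columns of \<open>g\<close>,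
  and \<open>p\<close>, \<open>q\<close>, \<open>r\<close> are the entries of the traceless velocity \<open>M\<close> in \<open>g' = g M\<close>.\<close>
lemma winding_rate_identity:
  fixes N W D p q r :: real
  assumes NW: "N * W = 1 + D\<^sup>2" and N: "N > 0" and W: "W > 0"
  shows "r / N - ((r * W + q * N) * (N + 1) - D * (2 * (p * N + r * D))) / (N + 1)\<^sup>2 / (1 + (D / (N + 1))\<^sup>2)
      = (r * (1 + W) - q * (1 + N) + 2 * p * D) / (N + W + 2)"
proof -
  define Y where "Y = (r * W + q * N) * (N + 1) - D * (2 * (p * N + r * D))"
  \<comment> \<open>Since \<open>D^2 = N * W - 1\<close>, the denominator
    \<open>(N + 1)^2 + D^2\<close> factors as \<open>N * (N + W + 2)\<close>. The numerator over the
    common denominator also contains \<open>N\<close>; its cancellation removes the column length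
    that spoils the rate of the plain angle.\<close>
  have e: "(N + 1)\<^sup>2 * (1 + (D / (N + 1))\<^sup>2) = (N + 1)\<^sup>2 + D\<^sup>2"
    using N by (simp add: distrib_left power_divide)
  have "(N + 1)\<^sup>2 + D\<^sup>2 = N * (N + W + 2)"
    using NW by (simp add: power2_eq_square algebra_simps)
  then have "Y / (N + 1)\<^sup>2 / (1 + (D / (N + 1))\<^sup>2) = Y / (N * (N + W + 2))"
    by (simp add: e)
  moreover have "r / N = (r * (N + W + 2)) / (N * (N + W + 2))"
    using N W by simp
  moreover have "r * (N + W + 2) - Y = N * (r * (1 + W) - q * (1 + N) + 2 * p * D)"
  proof -
    have "r * D\<^sup>2 = r * (N * W - 1)" using NW by simp
    then show ?thesis by (simp add: Y_def power2_eq_square algebra_simps)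
  qed
  ultimately have "r / N - Y / (N + 1)\<^sup>2 / (1 + (D / (N + 1))\<^sup>2) =
      (N * (r * (1 + W) - q * (1 + N) + 2 * p * D)) / (N * (N + W + 2))"
    by (metis diff_divide_distrib)
  then show ?thesis using N by (simp add: Y_def)
qed

text \<open>The numerator sums \<open>angular_form\<close> over four rows, two of the identity and
  two of \<open>g\<close>; the denominator is the sum of the squared lengths of the same four rows.
  The rate is thus a weighted mean of angular speeds, and a definite form bounds it independently of
  \<open>g\<close>.\<close>

lemma winding_has_derivative:
  fixes g :: "real \<Rightarrow> real^2^2" and M :: "real^2^2"
  assumes g: "(g has_vector_derivative (g t ** M)) (at t)" and det: "det (g t) = 1"
    and tr: "mtrace M = 0"
    and th: "(\<theta> has_real_derivative M $ 2 $ 1 / ((g t $ 1 $ 1)\<^sup>2 + (g t $ 2 $ 1)\<^sup>2)) (at t)"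
  shows "((\<lambda>s. winding (g s, \<theta> s)) has_real_derivative
    (angular_form M 0 1 + angular_form M 1 0 + angular_form M (g t $ 1 $ 1) (g t $ 1 $ 2)
      + angular_form M (g t $ 2 $ 1) (g t $ 2 $ 2)) /
    ((g t $ 1 $ 1)\<^sup>2 + (g t $ 2 $ 1)\<^sup>2 + ((g t $ 1 $ 2)\<^sup>2 + (g t $ 2 $ 2)\<^sup>2) + 2)) (at t)"
proof -
  define z1 z2 w1 w2 where "z1 = g t $ 1 $ 1" and "z2 = g t $ 2 $ 1" and "w1 = g t $ 1 $ 2" and "w2 = g t $ 2 $ 2"
  define p q r where "p = M $ 1 $ 1" and "q = M $ 1 $ 2" and "r = M $ 2 $ 1"
  have m: "M $ 2 $ 2 = - p" using tr by (simp add: mtrace_2 p_def)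
  have det1: "z1 * w2 - w1 * z2 = 1" using det by (simp add: det_2 z1_def z2_def w1_def w2_def)
  define N W D where "N = z1\<^sup>2 + z2\<^sup>2" and "W = w1\<^sup>2 + w2\<^sup>2" and "D = z1 * w1 + z2 * w2"
  have "N * W = (z1 * w2 - w1 * z2)\<^sup>2 + D\<^sup>2"
    by (simp add: N_def W_def D_def power2_eq_square algebra_simps)
  then have NW: "N * W = 1 + D\<^sup>2" by (simp add: det1)
  have N: "N > 0"
  proof -
    have "z1 \<noteq> 0 \<or> z2 \<noteq> 0" using det1 by auto
    then show ?thesis by (auto simp: N_def sum_power2_gt_zero_iff)
  qed
  have W: "W > 0"
  proof -
    have "w1 \<noteq> 0 \<or> w2 \<noteq> 0" using det1 by auto
    then show ?thesis by (auto simp: W_def sum_power2_gt_zero_iff)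
  qed
  have d11: "((\<lambda>s. g s $ 1 $ 1) has_real_derivative (p * z1 + r * w1)) (at t)"
    and d12: "((\<lambda>s. g s $ 1 $ 2) has_real_derivative (q * z1 - p * w1)) (at t)"
    and d21: "((\<lambda>s. g s $ 2 $ 1) has_real_derivative (p * z2 + r * w2)) (at t)"
    and d22: "((\<lambda>s. g s $ 2 $ 2) has_real_derivative (q * z2 - p * w2)) (at t)"
    using has_real_derivative_matrix_nth[OF g, of 1 1] has_real_derivative_matrix_nth[OF g, of 1 2]
      has_real_derivative_matrix_nth[OF g, of 2 1] has_real_derivative_matrix_nth[OF g, of 2 2]
    by (simp_all add: matrix2_mult_nth m p_def[symmetric] q_def r_def z1_def z2_def w1_def w2_def mult.commute)
  have dD: "((\<lambda>s. g s $ 1 $ 1 * g s $ 1 $ 2 + g s $ 2 $ 1 * g s $ 2 $ 2) has_real_derivative (r * W + q * N)) (at t)"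
  proof -
    have e: "(p * z1 + r * w1) * w1 + (q * z1 - p * w1) * z1 + ((p * z2 + r * w2) * w2 + (q * z2 - p * w2) * z2)
        = r * W + q * N"
      by (simp add: W_def N_def power2_eq_square algebra_simps)
    show ?thesis unfolding e[symmetric]
      using DERIV_add[OF DERIV_mult[OF d11 d12] DERIV_mult[OF d21 d22]]
      by (simp add: z1_def z2_def w1_def w2_def)
  qed
  have dN: "((\<lambda>s. (g s $ 1 $ 1)\<^sup>2 + (g s $ 2 $ 1)\<^sup>2 + 1) has_real_derivative (2 * (p * N + r * D))) (at t)"
  proof -
    have e: "2 * z1 * (p * z1 + r * w1) + 2 * z2 * (p * z2 + r * w2) + 0 = 2 * (p * N + r * D)"
      by (simp add: D_def N_def power2_eq_square algebra_simps)
    show ?thesis unfolding e[symmetric]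
      by (intro DERIV_add DERIV_const) (auto intro!: derivative_eq_intros d11 d21 simp: z1_def z2_def)
  qed
  have quot: "((\<lambda>s. (g s $ 1 $ 1 * g s $ 1 $ 2 + g s $ 2 $ 1 * g s $ 2 $ 2) / ((g s $ 1 $ 1)\<^sup>2 + (g s $ 2 $ 1)\<^sup>2 + 1))
     has_real_derivative ((r * W + q * N) * (N + 1) - D * (2 * (p * N + r * D))) / (N + 1)\<^sup>2) (at t)"
    using DERIV_divide[OF dD dN] N
    by (simp add: z1_def z2_def w1_def w2_def N_def D_def power2_eq_square)
  have val: "(g t $ 1 $ 1 * g t $ 1 $ 2 + g t $ 2 $ 1 * g t $ 2 $ 2) / ((g t $ 1 $ 1)\<^sup>2 + (g t $ 2 $ 1)\<^sup>2 + 1) = D / (N + 1)"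
    by (simp add: z1_def z2_def w1_def w2_def N_def D_def)
  have th': "(\<theta> has_real_derivative r / N) (at t)"
    using th by (simp add: r_def N_def z1_def z2_def)
  have "((\<lambda>s. winding (g s, \<theta> s)) has_real_derivative
      r / N - ((r * W + q * N) * (N + 1) - D * (2 * (p * N + r * D))) / (N + 1)\<^sup>2 / (1 + (D / (N + 1))\<^sup>2)) (at t)"
    unfolding winding_def fst_conv snd_conv
    using DERIV_diff[OF th' DERIV_chain2[OF DERIV_arctan quot]]
    unfolding val by (simp add: divide_inverse mult.commute)
  then have "((\<lambda>s. winding (g s, \<theta> s)) has_real_derivative
      (r * (1 + W) - q * (1 + N) + 2 * p * D) / (N + W + 2)) (at t)"
    unfolding winding_rate_identity[OF NW N W] .
  moreover have "r * (1 + W) - q * (1 + N) + 2 * p * D = angular_form M 0 1 + angular_form M 1 0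
      + angular_form M z1 w1 + angular_form M z2 w2"
    by (simp add: angular_form_def p_def q_def r_def N_def W_def D_def algebra_simps)
  ultimately show ?thesis
    by (simp add: N_def W_def z1_def z2_def w1_def w2_def)
qed

section \<open>Controls of admissible curves\<close>

lemma bounded_borel_integrable_on:
  fixes f :: "real \<Rightarrow> real"
  assumes "f \<in> borel_measurable borel" "\<And>t. \<bar>f t\<bar> \<le> B"
  shows "f integrable_on {a..b}"
proof (rule measurable_bounded_by_integrable_imp_integrable_real)
  have "f \<in> borel_measurable lebesgue"
    using assms(1) by (simp add: measurable_completion)
  then show "f \<in> borel_measurable (lebesgue_on {a..b})"
    by (rule measurable_restrict_space1)
qed (use assms(2) in auto)

lemma lipschitz_on_leI_dist:
  assumes "C-lipschitz_on S f" "\<And>x y. dist (h x) (h y) \<le> dist (f x) (f y)"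
  shows "C-lipschitz_on S h"
  using assms unfolding lipschitz_on_def by (meson order_trans)

lemma adjugate_left_inverse:
  fixes g :: "real^2^2"
  assumes "det g = 1"
  shows "(mtrace g *\<^sub>R mat 1 - g) ** g = mat 1"
proof -
  have "g $ 1 $ 1 * g $ 2 $ 2 = 1 + g $ 1 $ 2 * g $ 2 $ 1" using assms by (simp add: det_2)
  then show ?thesis
    by (intro matrix2_eqI) (simp_all add: matrix2_mult_nth mat2_nth mtrace_2 algebra_simps)
qed

text \<open>Only equations and a weak inequality remain on the right, so membership passes to
  limits, and the equation for the angle can be differentiated. Positivity of \<open>r\<close> is
  recovered from the determinant: \<open>r = 0\<close> would make the first column vanish.\<close>

lemma USL2_iff:
  "(g, \<theta>) \<in> USL2 \<longleftrightarrow> det g = 1 \<and> g $ 1 $ 1 * sin \<theta> = g $ 2 $ 1 * cos \<theta> \<and>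
     0 \<le> g $ 1 $ 1 * cos \<theta> + g $ 2 $ 1 * sin \<theta>"
proof
  assume "(g, \<theta>) \<in> USL2"
  then obtain r where r: "det g = 1" "r > 0" "g $ 1 $ 1 = r * cos \<theta>" "g $ 2 $ 1 = r * sin \<theta>"
    by (auto simp: USL2_def SL2_def)
  have "r * cos \<theta> * cos \<theta> + r * sin \<theta> * sin \<theta> = r * ((cos \<theta>)\<^sup>2 + (sin \<theta>)\<^sup>2)"
    by algebra
  then have "r * cos \<theta> * cos \<theta> + r * sin \<theta> * sin \<theta> = r"
    by (simp only: sin_cos_squared_add2 mult_1_right)
  then show "det g = 1 \<and> g $ 1 $ 1 * sin \<theta> = g $ 2 $ 1 * cos \<theta> \<and>
     0 \<le> g $ 1 $ 1 * cos \<theta> + g $ 2 $ 1 * sin \<theta>"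
    unfolding r(3,4) using r(1,2) by (simp only:) simp
next
  assume *: "det g = 1 \<and> g $ 1 $ 1 * sin \<theta> = g $ 2 $ 1 * cos \<theta> \<and>
     0 \<le> g $ 1 $ 1 * cos \<theta> + g $ 2 $ 1 * sin \<theta>"
  define a b where "a = g $ 1 $ 1" and "b = g $ 2 $ 1"
  define r where "r = a * cos \<theta> + b * sin \<theta>"
  have ab: "a * sin \<theta> = b * cos \<theta>" using * by (simp add: a_def b_def)
  have "r * cos \<theta> = a * (cos \<theta>)\<^sup>2 + (b * cos \<theta>) * sin \<theta>"
    by (simp add: r_def power2_eq_square algebra_simps)
  also have "\<dots> = a * ((cos \<theta>)\<^sup>2 + (sin \<theta>)\<^sup>2)"
    unfolding ab[symmetric] by algebra
  finally have a: "a = r * cos \<theta>" by simp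
  have "r * sin \<theta> = (a * sin \<theta>) * cos \<theta> + b * (sin \<theta>)\<^sup>2"
    by (simp add: r_def power2_eq_square algebra_simps)
  also have "\<dots> = b * ((cos \<theta>)\<^sup>2 + (sin \<theta>)\<^sup>2)"
    unfolding ab by algebra
  finally have b: "b = r * sin \<theta>" by simp
  have "r \<noteq> 0"
  proof
    assume "r = 0"
    then have "g $ 1 $ 1 = 0" "g $ 2 $ 1 = 0" using a b by (simp_all add: a_def b_def)
    then show False using * by (simp add: det_2)
  qed
  then have "r > 0" using * by (simp add: r_def a_def b_def)
  then show "(g, \<theta>) \<in> USL2"
    using * a b by (auto simp: USL2_def SL2_def a_def b_def)
qed

text \<open>Admissibility prescribes only the matrix velocity. The angle follows by differentiating
  \<open>g11 sin = g21 cos\<close>, an identity on a neighbourhood of \<open>t\<close>; with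
  \<open>det g = 1\<close> the result simplifies to the stated quotient.\<close>

lemma USL2_angle_derivative:
  fixes x :: "real \<Rightarrow> (real^2^2) \<times> real"
  assumes x: "\<And>t. t \<in> {a<..<b} \<Longrightarrow> x t \<in> USL2" and t: "t \<in> {a<..<b}"
    and dg: "((\<lambda>t. fst (x t)) has_vector_derivative (fst (x t) ** M)) (at t)"
    and dth: "((\<lambda>t. snd (x t)) has_real_derivative e) (at t)"
  shows "e = M $ 2 $ 1 / ((fst (x t) $ 1 $ 1)\<^sup>2 + (fst (x t) $ 2 $ 1)\<^sup>2)"
proof -
  define g \<theta> where "g s = fst (x s)" and "\<theta> s = snd (x s)" for s
  have U: "det (g s) = 1" "g s $ 1 $ 1 * sin (\<theta> s) - g s $ 2 $ 1 * cos (\<theta> s) = 0" if "s \<in> {a<..<b}" for s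
    using x[OF that] USL2_iff[of "g s" "\<theta> s"] by (simp_all add: g_def \<theta>_def)
  obtain r where r: "r > 0" "g t $ 1 $ 1 = r * cos (\<theta> t)" "g t $ 2 $ 1 = r * sin (\<theta> t)"
    using x[OF t] by (auto simp: USL2_def g_def \<theta>_def case_prod_beta)
  have d1: "((\<lambda>s. g s $ 1 $ 1) has_real_derivative (g t ** M) $ 1 $ 1) (at t)"
    and d2: "((\<lambda>s. g s $ 2 $ 1) has_real_derivative (g t ** M) $ 2 $ 1) (at t)"
    using has_real_derivative_matrix_nth[OF dg] by (simp_all add: g_def)
  have d3: "(\<theta> has_real_derivative e) (at t)" using dth by (simp add: \<theta>_def[abs_def])
  have "((\<lambda>s. g s $ 1 $ 1 * sin (\<theta> s) - g s $ 2 $ 1 * cos (\<theta> s)) has_real_derivative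
      (g t ** M) $ 1 $ 1 * sin (\<theta> t) + g t $ 1 $ 1 * (cos (\<theta> t) * e)
      - ((g t ** M) $ 2 $ 1 * cos (\<theta> t) + g t $ 2 $ 1 * (- sin (\<theta> t) * e))) (at t)"
    by (auto intro!: derivative_eq_intros d1 d2 d3)
  moreover have "((\<lambda>s. g s $ 1 $ 1 * sin (\<theta> s) - g s $ 2 $ 1 * cos (\<theta> s)) has_real_derivative 0) (at t)"
    by (rule has_field_derivative_transform_within_open[OF DERIV_const open_greaterThanLessThan t])
      (use U(2) in auto)
  ultimately have 0: "(g t ** M) $ 1 $ 1 * sin (\<theta> t) + g t $ 1 $ 1 * (cos (\<theta> t) * e)
      - ((g t ** M) $ 2 $ 1 * cos (\<theta> t) + g t $ 2 $ 1 * (- sin (\<theta> t) * e)) = 0"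
    by (rule DERIV_unique)
  define m1 m2 where "m1 = (g t ** M) $ 1 $ 1" and "m2 = (g t ** M) $ 2 $ 1"
  have N: "(g t $ 1 $ 1)\<^sup>2 + (g t $ 2 $ 1)\<^sup>2 = r\<^sup>2"
    unfolding r by (simp add: power_mult_distrib flip: distrib_left)
  have "r * e * ((cos (\<theta> t))\<^sup>2 + (sin (\<theta> t))\<^sup>2) = m2 * cos (\<theta> t) - m1 * sin (\<theta> t)"
    using 0 unfolding r(2,3) m1_def[symmetric] m2_def[symmetric] by algebra
  then have "r * (r * e) = r * (m2 * cos (\<theta> t) - m1 * sin (\<theta> t))" by simp
  also have "\<dots> = m2 * g t $ 1 $ 1 - m1 * g t $ 2 $ 1" unfolding r(2,3) by (simp add: algebra_simps)
  also have "\<dots> = det (g t) * M $ 2 $ 1"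
    by (simp add: m1_def m2_def matrix2_mult_nth det_2 algebra_simps)
  finally have "r\<^sup>2 * e = M $ 2 $ 1" using U(1)[OF t] by (simp add: power2_eq_square)
  then have "e = M $ 2 $ 1 / r\<^sup>2" using r(1) by (simp add: nonzero_eq_divide_eq mult.commute)
  then show ?thesis unfolding N[symmetric] by (simp add: g_def)
qed

section \<open>Frames with definite rotation and the controls of their curves\<close>

text \<open>Isolates the consequence of \<open>kap < chi < 0\<close> on which the existence proof
  rests: admissible velocities rotate in the direction \<open>s\<close> at a rate of at least
  \<open>c * u1\<close>.\<close>

locale elliptic_frame =
  fixes kap chi :: real and X1 X2 X3 :: "real^2^2" and s c :: real
  assumes frame: "g_frame sl2_alg kap chi X1 X2 X3"
    and s: "\<bar>s\<bar> = 1" and c: "c > 0"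
    and definite: "\<And>u1 u2 z w. \<bar>u2\<bar> \<le> u1 \<Longrightarrow>
      c * u1 * (z\<^sup>2 + w\<^sup>2) \<le> s * angular_form (u1 *\<^sub>R X1 + u2 *\<^sub>R X2) z w"
begin

definition vel :: "real \<Rightarrow> real \<Rightarrow> real^2^2" where
  "vel u1 u2 = u1 *\<^sub>R X1 + u2 *\<^sub>R X2"

lemma indep: "a *\<^sub>R X1 + b *\<^sub>R X2 = 0 \<Longrightarrow> a = 0 \<and> b = 0"
  using g_frame_lin_indep[OF frame] by blast

lemma mtrace_vel: "mtrace (vel u1 u2) = 0"
  using frame by (auto simp: g_frame_def sl2_alg_def mtrace_2 vel_def algebra_simps simp flip: distrib_left)

text \<open>Extending the coordinates to linear functionals on all matrices makes them continuous
  there, so controls read off from a Borel velocity are again Borel.\<close>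

lemma vel_coordinates:
  obtains c1 c2 :: "real^2^2 \<Rightarrow> real" where "linear c1" "linear c2"
    "\<And>a b. c1 (vel a b) = a" "\<And>a b. c2 (vel a b) = b"
proof -
  note ext = linear_independent_extend[OF g_frame_independent2(1)[OF frame]]
  obtain c1 :: "real^2^2 \<Rightarrow> real" where c1: "linear c1" "\<forall>x\<in>{X1, X2}. c1 x = (if x = X1 then 1 else 0)"
    using ext[of "\<lambda>x. if x = X1 then 1 else 0"] by blast
  obtain c2 :: "real^2^2 \<Rightarrow> real" where c2: "linear c2" "\<forall>x\<in>{X1, X2}. c2 x = (if x = X1 then 0 else 1)"
    using ext[of "\<lambda>x. if x = X1 then 0 else 1"] by blast
  show thesis
    by (rule that[OF c1(1) c2(1)])
      (use c1 c2 g_frame_independent2(2)[OF frame] in \<open>auto simp: vel_def linear_add linear_cmul\<close>)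
qed

lemma li_coords_vel: "det g = 1 \<Longrightarrow> li_coords X1 X2 g (g ** vel a b) = (a, b)"
  unfolding vel_def by (rule li_coords_mult[OF adjugate_left_inverse indep])

text \<open>Measurability, bound and cone condition hold on the whole line, so that integrals of the
  controls over any interval exist and are ordered; exceptional null sets enter only through the
  link to the curve.\<close>

definition controlled :: "(real \<Rightarrow> (real^2^2) \<times> real) \<Rightarrow> real \<Rightarrow> (real \<Rightarrow> real) \<Rightarrow> (real \<Rightarrow> real) \<Rightarrow> bool" where
  "controlled x T u1 u2 \<longleftrightarrow>
     u1 \<in> borel_measurable borel \<and> u2 \<in> borel_measurable borel \<and>
     (\<forall>t. \<bar>u2 t\<bar> \<le> u1 t) \<and> (\<exists>B. \<forall>t. u1 t \<le> B) \<and>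
     (AE t in lborel. t \<in> {0..T} \<longrightarrow>
        ((\<lambda>t. fst (x t)) has_vector_derivative (fst (x t) ** vel (u1 t) (u2 t))) (at t) \<and>
        ((\<lambda>t. snd (x t)) has_real_derivative
          vel (u1 t) (u2 t) $ 2 $ 1 / ((fst (x t) $ 1 $ 1)\<^sup>2 + (fst (x t) $ 2 $ 1)\<^sup>2)) (at t))"

text \<open>The cone condition provides coefficients pointwise, with no measurability. They are
  recovered measurably by an explicit formula: the linear coordinates of the inverse of
  \<open>g\<close> times a Borel version of the derivative.\<close>

lemma admissible_controlled:
  assumes adm: "usl2_admissible X1 X2 x T"
  obtains u1 u2 where "controlled x T u1 u2"
proof -
  have xU: "\<And>t. t \<in> {0..T} \<Longrightarrow> x t \<in> USL2" and "0 < T"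
    and ae: "AE t in lborel. t \<in> {0..T} \<longrightarrow> (fst \<circ> x) differentiable (at t) \<and>
      li_cone X1 X2 ((fst \<circ> x) t) (vector_derivative (fst \<circ> x) (at t))"
    using adm by (auto simp: usl2_admissible_def li_admissible_def)
  obtain C where C: "C-lipschitz_on {0..T} x" using adm by (auto simp: usl2_admissible_def)
  have lip1: "C-lipschitz_on {0..T} (\<lambda>t. fst (x t))"
    by (rule lipschitz_on_leI_dist[OF C dist_fst_le])
  have lip2: "C-lipschitz_on {0..T} (\<lambda>t. snd (x t))"
    by (rule lipschitz_on_leI_dist[OF C dist_snd_le])
  obtain d where d: "d \<in> borel_measurable borel" "\<And>t. norm (d t) \<le> C"
    "AE t in lborel. t \<in> {0..T} \<longrightarrow> ((\<lambda>t. fst (x t)) has_vector_derivative d t) (at t)"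
    by (rule lipschitz_interval_AE_derivative[OF lip1]) blast
  obtain e where e: "AE t in lborel. t \<in> {0..T} \<longrightarrow> ((\<lambda>t. snd (x t)) has_vector_derivative e t) (at t)"
    by (rule lipschitz_interval_AE_derivative[OF lip2]) blast
  \<comment> \<open>Freezing the curve outside \<open>{0..T}\<close> gives a continuous, hence
    Borel, function on the line.\<close>
  define G where "G t = fst (x (max 0 (min T t)))" for t
  have Gcont: "continuous_on UNIV G"
    unfolding G_def using \<open>0 < T\<close>
    by (intro continuous_on_compose2[OF lipschitz_on_continuous_on[OF lip1]] continuous_intros) auto
  have Gmeas: "G \<in> borel_measurable borel" by (rule borel_measurable_continuous_onI[OF Gcont])
  have GT: "G t = fst (x t)" if "t \<in> {0..T}" for t using that by (simp add: G_def)
  have "compact (G ` {0..T})"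
    by (rule compact_continuous_image[OF continuous_on_subset[OF Gcont]]) auto
  then obtain R where R: "\<And>t. t \<in> {0..T} \<Longrightarrow> norm (G t) \<le> R"
    by (meson bounded_iff compact_imp_bounded imageI)
  obtain c1 c2 :: "real^2^2 \<Rightarrow> real" where cc: "linear c1" "linear c2"
    "\<And>a b. c1 (vel a b) = a" "\<And>a b. c2 (vel a b) = b"
    using vel_coordinates by blast
  \<comment> \<open>For \<open>det g = 1\<close> the left factor is the adjugate, so
    \<open>H (g, d)\<close> is the inverse of \<open>g\<close> times \<open>d\<close>. As a
    polynomial it is continuous on all pairs.\<close>
  define H where "H = (\<lambda>p :: (real^2^2) \<times> (real^2^2). (mtrace (fst p) *\<^sub>R mat 1 - fst p) ** snd p)"
  have Hcont: "continuous_on UNIV H"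
    unfolding H_def mtrace_2
    by (intro bounded_bilinear.continuous_on[OF bounded_bilinear_matrix_mult] continuous_intros)
  have c1H: "continuous_on UNIV (\<lambda>p. c1 (H p))" and c2H: "continuous_on UNIV (\<lambda>p. c2 (H p))"
    using linear_continuous_on_compose[OF Hcont] cc by blast+
  define v1 v2 where "v1 t = c1 (H (G t, d t))" and "v2 t = c2 (H (G t, d t))" for t
  have vm: "v1 \<in> borel_measurable borel" "v2 \<in> borel_measurable borel"
    unfolding v1_def v2_def
    using borel_measurable_continuous_Pair[OF Gmeas d(1), of "\<lambda>a b. c1 (H (a, b))"]
      borel_measurable_continuous_Pair[OF Gmeas d(1), of "\<lambda>a b. c2 (H (a, b))"] c1H c2H by simp_all
  have "bounded ((\<lambda>p. c1 (H p)) ` (cball 0 R \<times> cball 0 C))"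
    by (intro compact_imp_bounded compact_continuous_image continuous_on_subset[OF c1H] compact_Times) auto
  then obtain B where B: "\<And>p. p \<in> cball 0 R \<times> cball 0 C \<Longrightarrow> \<bar>c1 (H p)\<bar> \<le> B"
    by (auto simp: bounded_iff)
  have v1B: "v1 t \<le> B" if "t \<in> {0..T}" for t
    using B[of "(G t, d t)"] R[OF that] d(2)[of t] by (auto simp: v1_def)
  \<comment> \<open>True for almost every \<open>t\<close> in \<open>{0..T}\<close>. Setting both
    controls to 0 elsewhere stays in the cone and makes the constraints hold everywhere.\<close>
  define good where "good t \<longleftrightarrow> \<bar>v2 t\<bar> \<le> v1 t \<and> v1 t \<le> \<bar>B\<bar>" for t
  define u1 u2 where "u1 t = (if good t then v1 t else 0)" and "u2 t = (if good t then v2 t else 0)" for t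
  have goodm: "{t. good t} \<in> sets borel"
    unfolding good_def using vm by measurable
  have "controlled x T u1 u2"
    unfolding controlled_def
  proof (intro conjI)
    show "u1 \<in> borel_measurable borel" "u2 \<in> borel_measurable borel"
      unfolding u1_def u2_def using vm goodm by (auto intro!: measurable_If)
    show "\<forall>t. \<bar>u2 t\<bar> \<le> u1 t" by (auto simp: u1_def u2_def good_def)
    show "\<exists>B. \<forall>t. u1 t \<le> B" by (intro exI[of _ "\<bar>B\<bar>"]) (auto simp: u1_def good_def)
    have "AE t in lborel. t \<noteq> 0" "AE t in lborel. t \<noteq> T" by (rule AE_lborel_singleton)+
    with ae d(3) e show "AE t in lborel. t \<in> {0..T} \<longrightarrow>
        ((\<lambda>t. fst (x t)) has_vector_derivative (fst (x t) ** vel (u1 t) (u2 t))) (at t) \<and>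
        ((\<lambda>t. snd (x t)) has_real_derivative
          vel (u1 t) (u2 t) $ 2 $ 1 / ((fst (x t) $ 1 $ 1)\<^sup>2 + (fst (x t) $ 2 $ 1)\<^sup>2)) (at t)"
    proof eventually_elim
      case (elim t)
      show ?case
      proof (intro impI)
        assume t: "t \<in> {0..T}"
        then have dt: "((\<lambda>t. fst (x t)) has_vector_derivative d t) (at t)" using elim by blast
        then have "vector_derivative (fst \<circ> x) (at t) = d t"
          by (auto simp: comp_def intro: vector_derivative_at)
        then obtain a b where ab: "d t = fst (x t) ** vel a b" "b\<^sup>2 - a\<^sup>2 \<le> 0" "0 \<le> a"
          using elim t by (auto simp: li_cone_def vel_def)
        have "det (fst (x t)) = 1" using xU[OF t] by (auto simp: USL2_def SL2_def)
        then have "H (G t, d t) = vel a b"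
          by (simp add: H_def GT[OF t] ab(1) matrix_mul_assoc adjugate_left_inverse)
        then have v: "v1 t = a" "v2 t = b" using cc by (simp_all add: v1_def v2_def)
        have "\<bar>b\<bar> \<le> a" using ab(2,3) by (simp add: abs_le_square_iff[symmetric])
        then have "good t" using v1B[OF t] v by (auto simp: good_def)
        then have u: "u1 t = a" "u2 t = b" by (simp_all add: u1_def u2_def v)
        have dg: "((\<lambda>t. fst (x t)) has_vector_derivative (fst (x t) ** vel (u1 t) (u2 t))) (at t)"
          using dt by (simp add: u ab(1))
        have dth: "((\<lambda>t. snd (x t)) has_real_derivative e t) (at t)"
          using elim t by (simp add: has_real_derivative_iff_has_vector_derivative)
        have "e t = vel (u1 t) (u2 t) $ 2 $ 1 / ((fst (x t) $ 1 $ 1)\<^sup>2 + (fst (x t) $ 2 $ 1)\<^sup>2)"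
        proof (rule USL2_angle_derivative[of 0 T, OF _ _ dg dth])
          show "t \<in> {0<..<T}" using t elim(4,5) by simp
          show "x t \<in> USL2" if "t \<in> {0<..<T}" for t using xU that by simp
        qed
        then show "((\<lambda>t. fst (x t)) has_vector_derivative (fst (x t) ** vel (u1 t) (u2 t))) (at t) \<and>
          ((\<lambda>t. snd (x t)) has_real_derivative
          vel (u1 t) (u2 t) $ 2 $ 1 / ((fst (x t) $ 1 $ 1)\<^sup>2 + (fst (x t) $ 2 $ 1)\<^sup>2)) (at t)"
          using dg dth by simp
      qed
    qed
  qed
  then show thesis by (rule that)
qed

end

section \<open>Concavity of the Lorentzian length\<close>

text \<open>The right-hand side is minimal at \<open>l = sqrt M / sqrt P\<close>, with value
  \<open>sqrt (P * M)\<close>. If \<open>P\<close> or \<open>M\<close> vanishes, the infimum 0 is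
  only approached or the optimal \<open>l\<close> degenerates, so there \<open>l\<close> is chosen
  from a given \<open>e > 0\<close>, large or small.\<close>

lemma le_sqrt_mult_of_AM_GM:
  fixes x P M :: real
  assumes P: "P \<ge> 0" and M: "M \<ge> 0" and le: "\<And>l. l > 0 \<Longrightarrow> x \<le> (l * P + M / l) / 2"
  shows "x \<le> sqrt (P * M)"
proof (cases "P = 0 \<or> M = 0")
  case True
  have "x \<le> 0"
  proof (rule field_le_epsilon)
    fix e :: real assume "e > 0"
    show "x \<le> 0 + e"
    proof (cases "P = 0")
      case P0: True
      define l where "l = (M + 1) / e"
      have "l > 0" using M \<open>e > 0\<close> by (simp add: l_def)
      have "M / l = e * (M / (M + 1))" by (simp add: l_def)
      also have "\<dots> \<le> e * 1" using M \<open>e > 0\<close> by (intro mult_left_mono) auto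
      finally show ?thesis using le[OF \<open>l > 0\<close>] P0 \<open>e > 0\<close> by simp
    next
      case False
      then have M0: "M = 0" using True by simp
      define l where "l = e / (P + 1)"
      have "l > 0" using P \<open>e > 0\<close> by (simp add: l_def)
      have "l * P = e * (P / (P + 1))" by (simp add: l_def)
      also have "\<dots> \<le> e * 1" using P \<open>e > 0\<close> by (intro mult_left_mono) auto
      finally show ?thesis using le[OF \<open>l > 0\<close>] M0 \<open>e > 0\<close> by simp
    qed
  qed
  then show ?thesis using True by auto
next
  case False
  then have PM: "P > 0" "M > 0" using P M by auto
  define l where "l = sqrt M / sqrt P"
  have "l > 0" using PM by (simp add: l_def)
  have "l * P = sqrt M * (P / sqrt P)" by (simp add: l_def)
  then have "l * P = sqrt P * sqrt M" using PM by (simp add: real_div_sqrt)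
  moreover have "M / l = (M / sqrt M) * sqrt P" by (simp add: l_def)
  then have "M / l = sqrt P * sqrt M" using PM by (simp add: real_div_sqrt)
  ultimately show ?thesis using le[OF \<open>l > 0\<close>] by (simp add: real_sqrt_mult mult.commute)
qed

text \<open>Concavity of \<open>(u1, u2) \<mapsto> sqrt (u1\<^sup>2 - u2\<^sup>2)\<close> on the cone: by AM-GM it is the infimum of the
  linear functions \<open>(l (u1 + u2) + (u1 - u2) / l) / 2\<close>.\<close>
lemma integral_lorentz_le:
  fixes u1 u2 :: "real \<Rightarrow> real"
  assumes i1: "u1 integrable_on S" and i2: "u2 integrable_on S"
    and i: "(\<lambda>t. sqrt ((u1 t)\<^sup>2 - (u2 t)\<^sup>2)) integrable_on S"
    and cone: "\<And>t. \<bar>u2 t\<bar> \<le> u1 t"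
  shows "integral S (\<lambda>t. sqrt ((u1 t)\<^sup>2 - (u2 t)\<^sup>2)) \<le> sqrt ((integral S u1)\<^sup>2 - (integral S u2)\<^sup>2)"
proof -
  have p: "integral S (\<lambda>t. u1 t + u2 t) = integral S u1 + integral S u2"
    and q: "integral S (\<lambda>t. u1 t - u2 t) = integral S u1 - integral S u2"
    using i1 i2 by (simp_all add: integral_add integral_diff)
  have nn: "0 \<le> u1 t + u2 t" "0 \<le> u1 t - u2 t" for t using cone[of t] by auto
  have "0 \<le> integral S (\<lambda>t. u1 t + u2 t)" "0 \<le> integral S (\<lambda>t. u1 t - u2 t)"
    using i1 i2 nn by (auto intro!: integral_nonneg integrable_add integrable_diff)
  then have pos: "0 \<le> integral S u1 + integral S u2" "0 \<le> integral S u1 - integral S u2"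
    by (simp_all add: p q)
  have "integral S (\<lambda>t. sqrt ((u1 t)\<^sup>2 - (u2 t)\<^sup>2)) \<le> sqrt ((integral S u1 + integral S u2) * (integral S u1 - integral S u2))"
  proof (rule le_sqrt_mult_of_AM_GM[OF pos])
    fix l :: real assume l: "l > 0"
    have "((\<lambda>t. (l * (u1 t + u2 t) + (u1 t - u2 t) / l) / 2) has_integral
        (l * (integral S u1 + integral S u2) + (integral S u1 - integral S u2) / l) / 2) S"
      using i1 i2 by (intro has_integral_divide has_integral_add has_integral_mult_right has_integral_diff integrable_integral)
    moreover have "sqrt ((u1 t)\<^sup>2 - (u2 t)\<^sup>2) \<le> (l * (u1 t + u2 t) + (u1 t - u2 t) / l) / 2" for t
    proof -
      have "(l * (u1 t + u2 t)) * ((u1 t - u2 t) / l) = (u1 t)\<^sup>2 - (u2 t)\<^sup>2"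
        using l by (simp add: square_diff_square_factored power2_eq_square)
      then have "sqrt ((u1 t)\<^sup>2 - (u2 t)\<^sup>2) = sqrt ((l * (u1 t + u2 t)) * ((u1 t - u2 t) / l))"
        by simp
      also have "\<dots> \<le> (l * (u1 t + u2 t) + (u1 t - u2 t) / l) / 2"
        using nn l by (intro arith_geo_mean_sqrt) auto
      finally show ?thesis .
    qed
    ultimately show "integral S (\<lambda>t. sqrt ((u1 t)\<^sup>2 - (u2 t)\<^sup>2))
      \<le> (l * (integral S u1 + integral S u2) + (integral S u1 - integral S u2) / l) / 2"
      using has_integral_le[OF integrable_integral[OF i]] by blast
  qed
  then show ?thesis by (simp add: power2_eq_square algebra_simps)
qed

context elliptic_frame
begin

lemma norm_vel_le: "\<bar>u2\<bar> \<le> u1 \<Longrightarrow> norm (vel u1 u2) \<le> (norm X1 + norm X2) * u1"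
proof -
  assume u: "\<bar>u2\<bar> \<le> u1"
  have "norm (vel u1 u2) \<le> \<bar>u1\<bar> * norm X1 + \<bar>u2\<bar> * norm X2"
    unfolding vel_def by (metis norm_scaleR norm_triangle_ineq)
  also have "\<dots> \<le> u1 * norm X1 + u1 * norm X2"
    using u by (intro add_mono mult_right_mono) auto
  finally show ?thesis by (simp add: algebra_simps)
qed

lemma controlledD:
  assumes "controlled x T u1 u2"
  shows "\<bar>u2 t\<bar> \<le> u1 t" "0 \<le> u1 t"
    "u1 integrable_on {a..b}" "u2 integrable_on {a..b}" "(\<lambda>t. sqrt ((u1 t)\<^sup>2 - (u2 t)\<^sup>2)) integrable_on {a..b}"
proof -
  obtain B where u: "u1 \<in> borel_measurable borel" "u2 \<in> borel_measurable borel"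
    "\<And>t. \<bar>u2 t\<bar> \<le> u1 t" "\<And>t. u1 t \<le> B"
    using assms by (auto simp: controlled_def)
  show "\<bar>u2 t\<bar> \<le> u1 t" "0 \<le> u1 t" using u(3)[of t] by linarith+
  have B: "\<bar>u1 t\<bar> \<le> B" "\<bar>u2 t\<bar> \<le> B" for t using u(3,4)[of t] by auto
  show "u1 integrable_on {a..b}" "u2 integrable_on {a..b}"
    using u(1,2) B bounded_borel_integrable_on by blast+
  show "(\<lambda>t. sqrt ((u1 t)\<^sup>2 - (u2 t)\<^sup>2)) integrable_on {a..b}"
  proof (rule bounded_borel_integrable_on)
    show "(\<lambda>t. sqrt ((u1 t)\<^sup>2 - (u2 t)\<^sup>2)) \<in> borel_measurable borel" using u(1,2) by measurable
    fix t
    have "(u2 t)\<^sup>2 \<le> (u1 t)\<^sup>2" using u(3)[of t] by (simp add: abs_le_square_iff[symmetric])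
    moreover have "sqrt ((u1 t)\<^sup>2 - (u2 t)\<^sup>2) \<le> sqrt ((u1 t)\<^sup>2)" by (intro real_sqrt_le_mono) simp
    ultimately show "\<bar>sqrt ((u1 t)\<^sup>2 - (u2 t)\<^sup>2)\<bar> \<le> B" using B(1)[of t] by simp
  qed
qed

lemma speed_bound:
  obtains k where "k > 0" "\<And>g u1 u2. \<bar>u2\<bar> \<le> u1 \<Longrightarrow> norm ((g::real^2^2) ** vel u1 u2) \<le> k * norm g * u1"
proof -
  obtain K where K: "K > 0" "\<And>a b. norm ((a::real^2^2) ** (b::real^2^2)) \<le> norm a * norm b * K"
    using bounded_bilinear.pos_bounded[OF bounded_bilinear_matrix_mult] by metis
  define k where "k = (norm X1 + norm X2) * K"
  have "X1 \<noteq> 0" using indep[of 1 0] by auto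
  then have "k > 0" using K(1) by (simp add: k_def add_pos_nonneg)
  moreover have "norm ((g::real^2^2) ** vel u1 u2) \<le> k * norm g * u1" if "\<bar>u2\<bar> \<le> u1" for g u1 u2
  proof -
    have "norm (g ** vel u1 u2) \<le> norm g * norm (vel u1 u2) * K" by (rule K(2))
    also have "\<dots> \<le> norm g * ((norm X1 + norm X2) * u1) * K"
      using norm_vel_le[OF that] K(1) by (intro mult_right_mono mult_left_mono) auto
    finally show ?thesis by (simp add: k_def algebra_simps)
  qed
  ultimately show thesis by (rule that)
qed

end

section \<open>Estimates along a single controlled arc\<close>

locale controlled_arc = elliptic_frame +
  fixes x :: "real \<Rightarrow> (real^2^2) \<times> real" and T :: real and u1 u2 :: "real \<Rightarrow> real"
  assumes ctrl: "controlled x T u1 u2" and lip: "\<exists>C. C-lipschitz_on {0..T} x"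
    and USL2: "\<And>t. t \<in> {0..T} \<Longrightarrow> x t \<in> USL2"
begin

lemma ae_deriv: "AE t in lborel. t \<in> {0..T} \<longrightarrow>
        ((\<lambda>t. fst (x t)) has_vector_derivative (fst (x t) ** vel (u1 t) (u2 t))) (at t) \<and>
        ((\<lambda>t. snd (x t)) has_real_derivative
          vel (u1 t) (u2 t) $ 2 $ 1 / ((fst (x t) $ 1 $ 1)\<^sup>2 + (fst (x t) $ 2 $ 1)\<^sup>2)) (at t)"
  using ctrl by (simp add: controlled_def)

lemma lip_fst: "\<exists>C. C-lipschitz_on {0..T} (\<lambda>t. fst (x t))"
  and lip_snd: "\<exists>C. C-lipschitz_on {0..T} (\<lambda>t. snd (x t))"
  using lip lipschitz_on_leI_dist[OF _ dist_fst_le] lipschitz_on_leI_dist[OF _ dist_snd_le] by blast+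

lemma det_fst: "t \<in> {0..T} \<Longrightarrow> det (fst (x t)) = 1"
  using USL2[of t] by (auto simp: USL2_def SL2_def)

lemma lip_winding: "\<exists>C. C-lipschitz_on {0..T} (\<lambda>t. winding (x t))"
  unfolding winding_def divide_inverse power2_eq_square
  by (intro ex_lipschitz_diff lip_snd ex_lipschitz_compose_1[OF _ _ arctan_lipschitz]
        ex_lipschitz_mult[OF compact_Icc] ex_lipschitz_compose_1[OF _ _ inverse_lipschitz]
        ex_lipschitz_add ex_lipschitz_nth[OF lip_fst])
    (auto intro: lipschitz_on_constant)

text \<open>Integrates the mean rotation rate. Taken over the whole arc, it bounds
  \<open>integral {0..T} u1\<close> by the endpoints alone.\<close>

lemma winding_increase:
  assumes ab: "0 \<le> a" "a \<le> b" "b \<le> T"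
  shows "c * integral {a..b} u1 \<le> s * (winding (x b) - winding (x a))"
proof -
  define M where "M t = vel (u1 t) (u2 t)" for t
  define D where "D t = (angular_form (M t) 0 1 + angular_form (M t) 1 0
      + angular_form (M t) (fst (x t) $ 1 $ 1) (fst (x t) $ 1 $ 2)
      + angular_form (M t) (fst (x t) $ 2 $ 1) (fst (x t) $ 2 $ 2)) /
    ((fst (x t) $ 1 $ 1)\<^sup>2 + (fst (x t) $ 2 $ 1)\<^sup>2 + ((fst (x t) $ 1 $ 2)\<^sup>2 + (fst (x t) $ 2 $ 2)\<^sup>2) + 2)" for t
  obtain C where C: "C-lipschitz_on {0..T} (\<lambda>t. winding (x t))" using lip_winding by blast
  have "AE t in lborel. t \<in> {0..T} \<longrightarrow> ((\<lambda>t. winding (x t)) has_vector_derivative D t) (at t)"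
    using ae_deriv
  proof eventually_elim
    case (elim t)
    show ?case
    proof
      assume t: "t \<in> {0..T}"
      have "((\<lambda>t. winding (fst (x t), snd (x t))) has_real_derivative D t) (at t)"
        unfolding D_def M_def
        by (rule winding_has_derivative) (use elim t det_fst mtrace_vel in auto)
      then show "((\<lambda>t. winding (x t)) has_vector_derivative D t) (at t)"
        by (simp add: has_real_derivative_iff_has_vector_derivative)
    qed
  qed
  from lipschitz_FTC[OF C this ab] have "(D has_integral (winding (x b) - winding (x a))) {a..b}" .
  then have D: "((\<lambda>t. s * D t) has_integral s * (winding (x b) - winding (x a))) {a..b}"
    by (rule has_integral_mult_right)
  have U: "((\<lambda>t. c * u1 t) has_integral c * integral {a..b} u1) {a..b}"
    by (intro has_integral_mult_right integrable_integral controlledD[OF ctrl])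
  have "c * u1 t \<le> s * D t" for t
  proof -
    define g where "g = fst (x t)"
    define Q where "Q = (g $ 1 $ 1)\<^sup>2 + (g $ 2 $ 1)\<^sup>2 + ((g $ 1 $ 2)\<^sup>2 + (g $ 2 $ 2)\<^sup>2) + 2"
    have Q: "Q > 0" unfolding Q_def by (intro add_nonneg_pos add_nonneg_nonneg) auto
    have *: "c * u1 t * (z\<^sup>2 + w\<^sup>2) \<le> s * angular_form (M t) z w" for z w
      unfolding M_def vel_def by (rule definite[OF controlledD(1)[OF ctrl]])
    \<comment> \<open>The four rows in the rate of \<open>winding\<close> each contribute at least
      \<open>c * u1 t\<close> times their squared length, and these lengths add up to
      \<open>Q\<close>.\<close>
    have "c * u1 t * Q \<le> s * (angular_form (M t) 0 1 + angular_form (M t) 1 0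
      + angular_form (M t) (g $ 1 $ 1) (g $ 1 $ 2) + angular_form (M t) (g $ 2 $ 1) (g $ 2 $ 2))"
      using *[of 0 1] *[of 1 0] *[of "g $ 1 $ 1" "g $ 1 $ 2"] *[of "g $ 2 $ 1" "g $ 2 $ 2"]
      by (simp add: Q_def distrib_left)
    then show ?thesis
      using Q by (simp add: D_def g_def[symmetric] Q_def[symmetric] pos_le_divide_eq)
  qed
  then show ?thesis by (rule has_integral_le[OF U D])
qed

text \<open>Gronwall in logarithmic form: the squared norm \<open>E\<close> satisfies
  \<open>E' \<le> 2 k u1 E\<close> a.e. The logarithm is Lipschitz along the arc because
  \<open>E\<close>, a sum of two squares plus twice the determinant, stays above 1.\<close>

lemma norm_growth:
  assumes k: "\<And>g u1 u2. \<bar>u2\<bar> \<le> u1 \<Longrightarrow> norm ((g::real^2^2) ** vel u1 u2) \<le> k * norm g * u1"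
    and ab: "0 \<le> a" "a \<le> b" "b \<le> T"
  shows "norm (fst (x b)) \<le> norm (fst (x a)) * exp (k * integral {a..b} u1)"
proof -
  define g where "g t = fst (x t)" for t
  define E where "E t = g t \<bullet> g t" for t
  have E_alt: "E t = g t $ 1 $ 1 * g t $ 1 $ 1 + g t $ 1 $ 2 * g t $ 1 $ 2
      + (g t $ 2 $ 1 * g t $ 2 $ 1 + g t $ 2 $ 2 * g t $ 2 $ 2)" for t
    by (simp add: E_def inner_vec_def sum_2)
  have E1: "E t \<ge> 1" if "t \<in> {0..T}" for t
  proof -
    have "g t $ 1 $ 1 * g t $ 2 $ 2 - g t $ 1 $ 2 * g t $ 2 $ 1 = 1"
      using det_fst[OF that] by (simp add: g_def det_2)
    moreover have "E t = (g t $ 1 $ 1 - g t $ 2 $ 2)\<^sup>2 + (g t $ 1 $ 2 + g t $ 2 $ 1)\<^sup>2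
        + 2 * (g t $ 1 $ 1 * g t $ 2 $ 2 - g t $ 1 $ 2 * g t $ 2 $ 1)"
      by (simp add: E_alt power2_eq_square algebra_simps)
    ultimately show ?thesis by simp
  qed
  have "\<exists>C. C-lipschitz_on {0..T} (\<lambda>t. ln (E t))"
  proof (rule ex_lipschitz_compose_1[OF _ _ ln_lipschitz])
    show "\<exists>C. C-lipschitz_on {0..T} E"
      unfolding E_alt g_def
      by (intro ex_lipschitz_add ex_lipschitz_mult[OF compact_Icc] ex_lipschitz_nth[OF lip_fst])
  qed (use E1 in auto)
  then obtain C where C: "C-lipschitz_on {0..T} (\<lambda>t. ln (E t))" by blast
  define D where "D t = 2 * (g t \<bullet> (g t ** vel (u1 t) (u2 t))) / E t" for t
  have "AE t in lborel. t \<in> {0..T} \<longrightarrow> ((\<lambda>t. ln (E t)) has_vector_derivative D t) (at t)"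
    using ae_deriv
  proof eventually_elim
    case (elim t)
    show ?case
    proof
      assume t: "t \<in> {0..T}"
      have "(g has_vector_derivative (g t ** vel (u1 t) (u2 t))) (at t)"
        using elim t by (simp add: g_def[abs_def])
      then have "(E has_real_derivative 2 * (g t \<bullet> (g t ** vel (u1 t) (u2 t)))) (at t)"
        unfolding E_def has_vector_derivative_def has_field_derivative_def
        by (auto intro!: derivative_eq_intros simp: inner_commute algebra_simps)
      then have "((\<lambda>t. ln (E t)) has_real_derivative (1 / E t) * (2 * (g t \<bullet> (g t ** vel (u1 t) (u2 t))))) (at t)"
        using E1[OF t] by (intro DERIV_chain2[OF DERIV_ln_divide]) auto
      then show "((\<lambda>t. ln (E t)) has_vector_derivative D t) (at t)"
        by (simp add: D_def has_real_derivative_iff_has_vector_derivative)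
    qed
  qed
  from lipschitz_FTC[OF C this ab] have "(D has_integral (ln (E b) - ln (E a))) {a..b}" .
  moreover have "((\<lambda>t. 2 * k * u1 t) has_integral 2 * k * integral {a..b} u1) {a..b}"
    by (intro has_integral_mult_right integrable_integral controlledD[OF ctrl])
  moreover have "D t \<le> 2 * k * u1 t" if "t \<in> {a..b}" for t
  proof -
    have Et: "E t > 0" using E1[of t] that ab by auto
    have "g t \<bullet> (g t ** vel (u1 t) (u2 t)) \<le> norm (g t) * norm (g t ** vel (u1 t) (u2 t))"
      by (rule norm_cauchy_schwarz)
    also have "\<dots> \<le> norm (g t) * (k * norm (g t) * u1 t)"
      by (intro mult_left_mono k controlledD[OF ctrl]) auto
    also have "\<dots> = k * u1 t * E t"
      by (simp add: E_def dot_square_norm power2_eq_square)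
    finally show ?thesis using Et by (simp add: D_def pos_divide_le_eq)
  qed
  ultimately have "ln (E b) - ln (E a) \<le> 2 * k * integral {a..b} u1" by (rule has_integral_le)
  moreover have "E a > 0" "E b > 0" using E1[of a] E1[of b] ab by auto
  ultimately have "E b \<le> E a * exp (2 * k * integral {a..b} u1)"
    by (metis add.commute diff_le_eq exp_add exp_le_cancel_iff exp_ln)
  then have "(norm (g b))\<^sup>2 \<le> (norm (g a) * exp (k * integral {a..b} u1))\<^sup>2"
    by (simp add: E_def dot_square_norm power_mult_distrib exp_double mult.assoc)
  then show ?thesis unfolding g_def by (rule power2_le_imp_le) simp
qed

text \<open>The first two bounds integrate the speeds of matrix and angle. The third is the error of
  one Euler step, the integral of \<open>(g t - g a) ** vel (u1 t) (u2 t)\<close>; the first bound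
  makes its left factor of the order of \<open>integral {a..b} u1\<close>, hence the square.\<close>

lemma increment_bounds:
  assumes k: "\<And>g u1 u2. \<bar>u2\<bar> \<le> u1 \<Longrightarrow> norm ((g::real^2^2) ** vel u1 u2) \<le> k * norm g * u1" "k > 0"
    and R: "\<And>t. t \<in> {0..T} \<Longrightarrow> norm (fst (x t)) \<le> R"
    and ab: "0 \<le> a" "a \<le> b" "b \<le> T"
  shows "norm (fst (x b) - fst (x a)) \<le> k * R * integral {a..b} u1"
    and "\<bar>snd (x b) - snd (x a)\<bar> \<le> (norm X1 + norm X2) * R\<^sup>2 * integral {a..b} u1"
    and "norm (fst (x b) - fst (x a) - fst (x a) ** vel (integral {a..b} u1) (integral {a..b} u2))
      \<le> k * (k * R) * (integral {a..b} u1)\<^sup>2"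
proof -
  define g where "g t = fst (x t)" for t
  obtain C where C: "C-lipschitz_on {0..T} (\<lambda>t. fst (x t))" using lip_fst by blast
  obtain C' where C': "C'-lipschitz_on {0..T} (\<lambda>t. snd (x t))" using lip_snd by blast
  have R0: "R \<ge> 0" using order_trans[OF norm_ge_zero R[of a]] ab by simp
  have ae1: "AE t in lborel. t \<in> {0..T} \<longrightarrow> ((\<lambda>t. fst (x t)) has_vector_derivative (g t ** vel (u1 t) (u2 t))) (at t)"
    using ae_deriv by eventually_elim (auto simp: g_def)
  have gint: "((\<lambda>t. g t ** vel (u1 t) (u2 t)) has_integral (g b - g a)) {a..b}"
    if "0 \<le> a" "a \<le> b" "b \<le> T" for a b
    using lipschitz_FTC[OF C ae1 that] by (simp add: g_def)
  have u1int: "u1 integrable_on {a..b}" for a b by (rule controlledD[OF ctrl])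
  have b1: "norm (g b - g a) \<le> k * R * integral {a..b} u1" if ab: "0 \<le> a" "a \<le> b" "b \<le> T" for a b
  proof -
    have "norm (integral {a..b} (\<lambda>t. g t ** vel (u1 t) (u2 t))) \<le> integral {a..b} (\<lambda>t. k * R * u1 t)"
    proof (rule integral_norm_bound_integral)
      show "(\<lambda>t. g t ** vel (u1 t) (u2 t)) integrable_on {a..b}" using gint[OF ab] by blast
      show "(\<lambda>t. k * R * u1 t) integrable_on {a..b}" using u1int by (rule integrable_on_mult_right)
      fix t assume t: "t \<in> {a..b}"
      have "norm (g t ** vel (u1 t) (u2 t)) \<le> k * norm (g t) * u1 t"
        by (rule k) (rule controlledD[OF ctrl])
      also have "\<dots> \<le> k * R * u1 t"
        using R[of t] t ab k(2) controlledD(2)[OF ctrl] by (intro mult_right_mono mult_left_mono) (auto simp: g_def)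
      finally show "norm (g t ** vel (u1 t) (u2 t)) \<le> k * R * u1 t" .
    qed
    then show ?thesis using integral_unique[OF gint[OF ab]] by simp
  qed
  show "norm (fst (x b) - fst (x a)) \<le> k * R * integral {a..b} u1"
    using b1[OF ab] by (simp add: g_def)
  define N where "N t = (g t $ 1 $ 1)\<^sup>2 + (g t $ 2 $ 1)\<^sup>2" for t
  have "AE t in lborel. t \<in> {0..T} \<longrightarrow> ((\<lambda>t. snd (x t)) has_vector_derivative (vel (u1 t) (u2 t) $ 2 $ 1 / N t)) (at t)"
    using ae_deriv
    by eventually_elim (auto simp: N_def g_def has_real_derivative_iff_has_vector_derivative)
  from lipschitz_FTC[OF C' this ab]
  have sint: "((\<lambda>t. vel (u1 t) (u2 t) $ 2 $ 1 / N t) has_integral (snd (x b) - snd (x a))) {a..b}" .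
  have "norm (integral {a..b} (\<lambda>t. vel (u1 t) (u2 t) $ 2 $ 1 / N t))
      \<le> integral {a..b} (\<lambda>t. (norm X1 + norm X2) * R\<^sup>2 * u1 t)"
  proof (rule integral_norm_bound_integral)
    show "(\<lambda>t. vel (u1 t) (u2 t) $ 2 $ 1 / N t) integrable_on {a..b}" using sint by blast
    show "(\<lambda>t. (norm X1 + norm X2) * R\<^sup>2 * u1 t) integrable_on {a..b}" using u1int by (rule integrable_on_mult_right)
    fix t assume "t \<in> {a..b}"
    then have t: "t \<in> {0..T}" using ab by auto
    \<comment> \<open>The angular speed is divided by \<open>N t\<close>, the squared length of the
      first column. Unit determinant gives \<open>N t * W \<ge> 1\<close> for the second column, so
      \<open>1 / N t\<close> is at most \<open>W\<close>, which the norm bound controls.\<close>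
    define W where "W = (g t $ 1 $ 2)\<^sup>2 + (g t $ 2 $ 2)\<^sup>2"
    have d: "g t $ 1 $ 1 * g t $ 2 $ 2 - g t $ 1 $ 2 * g t $ 2 $ 1 = 1"
      using det_fst[OF t] by (simp add: g_def det_2)
    have "N t * W = (g t $ 1 $ 1 * g t $ 2 $ 2 - g t $ 1 $ 2 * g t $ 2 $ 1)\<^sup>2
        + (g t $ 1 $ 1 * g t $ 1 $ 2 + g t $ 2 $ 1 * g t $ 2 $ 2)\<^sup>2"
      by (simp add: N_def W_def power2_eq_square algebra_simps)
    then have NW: "N t * W \<ge> 1" unfolding d by simp
    have "N t \<ge> 0" by (simp add: N_def)
    moreover have "N t \<noteq> 0" using NW by auto
    ultimately have N: "N t > 0" by simp
    have "W \<le> g t \<bullet> g t" by (simp add: W_def inner_vec_def sum_2 power2_eq_square)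
    also have "\<dots> \<le> R\<^sup>2" unfolding dot_square_norm using R[OF t] by (auto simp: g_def intro: power_mono)
    finally have "W \<le> R\<^sup>2" .
    moreover have "1 / N t \<le> W" using N NW by (simp add: pos_divide_le_eq mult.commute)
    ultimately have iN: "1 / N t \<le> R\<^sup>2" by linarith
    have "\<bar>vel (u1 t) (u2 t) $ 2 $ 1\<bar> \<le> norm (vel (u1 t) (u2 t))"
      by (meson Finite_Cartesian_Product.norm_nth_le component_le_norm_cart order_trans)
    also have "\<dots> \<le> (norm X1 + norm X2) * u1 t"
      by (rule norm_vel_le[OF controlledD(1)[OF ctrl]])
    finally have v: "\<bar>vel (u1 t) (u2 t) $ 2 $ 1\<bar> \<le> (norm X1 + norm X2) * u1 t" .
    have "\<bar>vel (u1 t) (u2 t) $ 2 $ 1\<bar> * (1 / N t) \<le> (norm X1 + norm X2) * u1 t * R\<^sup>2"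
      using v iN N controlledD(2)[OF ctrl, of t] by (intro mult_mono) auto
    then show "norm (vel (u1 t) (u2 t) $ 2 $ 1 / N t) \<le> (norm X1 + norm X2) * R\<^sup>2 * u1 t"
      using N by (simp add: abs_divide algebra_simps)
  qed
  then show "\<bar>snd (x b) - snd (x a)\<bar> \<le> (norm X1 + norm X2) * R\<^sup>2 * integral {a..b} u1"
    using integral_unique[OF sint] by simp
  define S where "S = integral {a..b} u1"
  have "((\<lambda>t. vel (u1 t) (u2 t)) has_integral vel S (integral {a..b} u2)) {a..b}"
    unfolding vel_def S_def
    by (intro has_integral_add has_integral_scaleR_left integrable_integral controlledD[OF ctrl])
  then have "((\<lambda>t. g a ** vel (u1 t) (u2 t)) has_integral g a ** vel S (integral {a..b} u2)) {a..b}"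
    using has_integral_linear[OF _ bounded_bilinear.bounded_linear_right[OF bounded_bilinear_matrix_mult], of _ _ _ "g a"]
    by (simp add: comp_def)
  from has_integral_diff[OF gint[OF ab] this]
  have dint: "((\<lambda>t. (g t - g a) ** vel (u1 t) (u2 t)) has_integral (g b - g a - g a ** vel S (integral {a..b} u2))) {a..b}"
    by (simp add: matrix_diff_left)
  have "norm (integral {a..b} (\<lambda>t. (g t - g a) ** vel (u1 t) (u2 t))) \<le> integral {a..b} (\<lambda>t. k * (k * R * S) * u1 t)"
  proof (rule integral_norm_bound_integral)
    show "(\<lambda>t. (g t - g a) ** vel (u1 t) (u2 t)) integrable_on {a..b}" using dint by blast
    show "(\<lambda>t. k * (k * R * S) * u1 t) integrable_on {a..b}" using u1int by (rule integrable_on_mult_right)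
    fix t assume t: "t \<in> {a..b}"
    have "integral {a..t} u1 \<le> S"
      unfolding S_def using t u1int controlledD(2)[OF ctrl] by (intro integral_subset_le) auto
    then have "k * R * integral {a..t} u1 \<le> k * R * S" using k(2) R0 by (intro mult_left_mono) auto
    moreover have "norm (g t - g a) \<le> k * R * integral {a..t} u1" using b1[of a t] t ab by auto
    ultimately have 1: "norm (g t - g a) \<le> k * R * S" by linarith
    have "norm ((g t - g a) ** vel (u1 t) (u2 t)) \<le> k * norm (g t - g a) * u1 t"
      by (rule k) (rule controlledD[OF ctrl])
    also have "\<dots> \<le> k * (k * R * S) * u1 t"
      using 1 k(2) controlledD(2)[OF ctrl] by (intro mult_right_mono mult_left_mono) auto
    finally show "norm ((g t - g a) ** vel (u1 t) (u2 t)) \<le> k * (k * R * S) * u1 t" .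
  qed
  then show "norm (fst (x b) - fst (x a) - fst (x a) ** vel (integral {a..b} u1) (integral {a..b} u2))
      \<le> k * (k * R) * (integral {a..b} u1)\<^sup>2"
    unfolding integral_unique[OF dint] by (simp add: g_def S_def power2_eq_square mult_ac)
qed

lemma length_eq:
  "usl2_length X1 X2 x T = ennreal (integral {0..T} (\<lambda>t. sqrt ((u1 t)\<^sup>2 - (u2 t)\<^sup>2)))"
proof -
  have le: "(u2 t)\<^sup>2 \<le> (u1 t)\<^sup>2" for t
    using controlledD(1)[OF ctrl, of t] by (simp add: abs_le_square_iff[symmetric])
  have "usl2_length X1 X2 x T = (\<integral>\<^sup>+ t. ennreal (sqrt ((u1 t)\<^sup>2 - (u2 t)\<^sup>2)) * indicator {0..T} t \<partial>lborel)"
    unfolding usl2_length_def li_length_def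
  proof (rule nn_integral_cong_AE)
    show "AE t in lborel. ennreal (sqrt \<bar>li_q X1 X2 ((fst \<circ> x) t) (vector_derivative (fst \<circ> x) (at t))\<bar>) * indicator {0..T} t =
      ennreal (sqrt ((u1 t)\<^sup>2 - (u2 t)\<^sup>2)) * indicator {0..T} t"
      using ae_deriv
    proof eventually_elim
      case (elim t)
      show ?case
      proof (cases "t \<in> {0..T}")
        case True
        then have "vector_derivative (fst \<circ> x) (at t) = fst (x t) ** vel (u1 t) (u2 t)"
          using elim by (auto simp: comp_def intro: vector_derivative_at)
        then have "li_q X1 X2 ((fst \<circ> x) t) (vector_derivative (fst \<circ> x) (at t)) = (u2 t)\<^sup>2 - (u1 t)\<^sup>2"
          using li_coords_vel[OF det_fst[OF True]] by (simp add: li_q_def)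
        then show ?thesis using le[of t] by (simp add: abs_if)
      qed simp
    qed
  qed
  also have "\<dots> = ennreal (integral {0..T} (\<lambda>t. sqrt ((u1 t)\<^sup>2 - (u2 t)\<^sup>2)))"
    by (rule nn_integral_has_integral_lebesgue') (use le controlledD(5)[OF ctrl] in auto)
  finally show ?thesis .
qed

end

section \<open>Compactness of the space of admissible curves\<close>

context elliptic_frame
begin

text \<open>A derivative-free form of the differential inclusion that, unlike the inclusion itself, is visibly
  stable under pointwise limits; \<open>z\<close> is a lower bound for the accumulated length.\<close>
definition relaxed :: "real \<Rightarrow> real \<Rightarrow> real \<Rightarrow> (real \<Rightarrow> (real^2^2) \<times> real) \<Rightarrow> (real \<Rightarrow> real) \<Rightarrow> bool" where
  "relaxed L M T y z \<longleftrightarrow> (\<forall>t\<in>{0..T}. y t \<in> USL2) \<and>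
     (\<forall>a b. 0 \<le> a \<and> a \<le> b \<and> b \<le> T \<longrightarrow> norm (y b - y a) \<le> L * (b - a) \<and>
        0 \<le> z b - z a \<and> z b - z a \<le> b - a \<and>
        (\<exists>v1 v2. \<bar>v2\<bar> \<le> v1 \<and> v1 \<le> b - a \<and>
           norm (fst (y b) - fst (y a) - fst (y a) ** vel v1 v2) \<le> M * (b - a)\<^sup>2 \<and>
           z b - z a \<le> sqrt (v1\<^sup>2 - v2\<^sup>2)))"

text \<open>All constants come from the endpoints: \<open>winding_increase\<close> fixes
  \<open>T\<close>, then \<open>norm_growth\<close> fixes \<open>R\<close>, and
  \<open>increment_bounds\<close> turns \<open>R\<close> into \<open>L\<close> and \<open>M\<close>.
  The new time is the integral of \<open>u1\<close>.\<close>

lemma admissible_relaxed: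
  fixes x0 x1 :: "(real^2^2) \<times> real"
  obtains L M T where "T > 0" "L \<ge> 0"
    "\<And>x t1. usl2_admissible X1 X2 x t1 \<Longrightarrow> x 0 = x0 \<Longrightarrow> x t1 = x1 \<Longrightarrow>
      \<exists>y z. relaxed L M T y z \<and> y 0 = x0 \<and> y T = x1 \<and> z 0 = 0 \<and> ennreal (z T) = usl2_length X1 X2 x t1"
proof -
  obtain k where k: "k > 0" "\<And>g u1 u2. \<bar>u2\<bar> \<le> u1 \<Longrightarrow> norm ((g::real^2^2) ** vel u1 u2) \<le> k * norm g * u1"
    by (rule speed_bound) blast
  \<comment> \<open>An upper bound for \<open>integral {0..t1} u1\<close>; the summand 1 only keeps
    \<open>T\<close> positive.\<close>
  define T where "T = \<bar>s * (winding x1 - winding x0) / c\<bar> + 1"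
  define R where "R = norm (fst x0) * exp (k * T)"
  define L where "L = k * R + (norm X1 + norm X2) * R\<^sup>2"
  define M where "M = k * (k * R)"
  have T: "T > 0" unfolding T_def by (rule add_nonneg_pos) auto
  have R0: "R \<ge> 0" by (simp add: R_def)
  have L0: "L \<ge> 0" and M0: "M \<ge> 0" using R0 k(1) by (simp_all add: L_def M_def)
  show thesis
  proof (rule that[OF T L0])
    fix x t1 assume adm: "usl2_admissible X1 X2 x t1" and x0: "x 0 = x0" and x1: "x t1 = x1"
    have t1: "0 < t1" using adm by (simp add: usl2_admissible_def li_admissible_def)
    obtain u1 u2 where ctrl: "controlled x t1 u1 u2" using admissible_controlled[OF adm] .
    interpret controlled_arc kap chi X1 X2 X3 s c x t1 u1 u2
      by unfold_locales (use ctrl adm in \<open>auto simp: usl2_admissible_def\<close>)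
    define l where "l t = sqrt ((u1 t)\<^sup>2 - (u2 t)\<^sup>2)" for t
    define \<sigma> \<zeta> where "\<sigma> t = integral {0..t} u1" and "\<zeta> t = integral {0..t} l" for t
    have int: "u1 integrable_on {a..b}" "u2 integrable_on {a..b}" "l integrable_on {a..b}" for a b
      unfolding l_def by (rule controlledD[OF ctrl])+
    have l_bounds: "0 \<le> l t" "l t \<le> u1 t" for t
    proof -
      have "(u2 t)\<^sup>2 \<le> (u1 t)\<^sup>2" using controlledD(1)[OF ctrl, of t] by (simp add: abs_le_square_iff[symmetric])
      then show "0 \<le> l t" by (simp add: l_def)
      have "l t \<le> sqrt ((u1 t)\<^sup>2)" unfolding l_def by (intro real_sqrt_le_mono) simp
      then show "l t \<le> u1 t" using controlledD(2)[OF ctrl] by simp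
    qed
    have diff: "\<sigma> b - \<sigma> a = integral {a..b} u1" "\<zeta> b - \<zeta> a = integral {a..b} l" if "0 \<le> a" "a \<le> b" for a b
      using Henstock_Kurzweil_Integration.integral_combine[OF that int(1)]
        Henstock_Kurzweil_Integration.integral_combine[OF that int(3)]
      by (simp_all add: \<sigma>_def \<zeta>_def algebra_simps)
    have \<sigma>0: "\<sigma> 0 = 0" "\<zeta> 0 = 0" by (simp_all add: \<sigma>_def \<zeta>_def)
    have \<sigma>_mono: "\<sigma> a \<le> \<sigma> b" if "0 \<le> a" "a \<le> b" for a b
    proof -
      have "0 \<le> integral {a..b} u1" using int controlledD(2)[OF ctrl] by (intro integral_nonneg) auto
      then show ?thesis using diff(1)[OF that] by simp
    qed
    define S where "S = \<sigma> t1"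
    have S: "0 \<le> S" "S \<le> T"
    proof -
      show "0 \<le> S" using \<sigma>_mono[of 0 t1] \<sigma>0 t1 by (simp add: S_def)
      have "c * S \<le> s * (winding x1 - winding x0)"
        using winding_increase[of 0 t1] t1 x0 x1 by (simp add: S_def \<sigma>_def)
      then have "S \<le> s * (winding x1 - winding x0) / c"
        using c by (simp add: pos_le_divide_eq mult.commute)
      then show "S \<le> T" unfolding T_def by linarith
    qed
    have R: "norm (fst (x t)) \<le> R" if "t \<in> {0..t1}" for t
    proof -
      have "norm (fst (x t)) \<le> norm (fst (x 0)) * exp (k * \<sigma> t)"
        unfolding \<sigma>_def by (rule norm_growth[OF k(2)]) (use that in auto)
      also have "\<dots> \<le> R"
        unfolding R_def x0 using \<sigma>_mono[of t t1] that S k(1)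
        by (intro mult_left_mono) (auto simp: S_def)
      finally show ?thesis .
    qed
    have est: "norm (x b - x a) \<le> L * (\<sigma> b - \<sigma> a)" "0 \<le> \<zeta> b - \<zeta> a" "\<zeta> b - \<zeta> a \<le> \<sigma> b - \<sigma> a"
      "\<exists>v2. \<bar>v2\<bar> \<le> \<sigma> b - \<sigma> a \<and>
         norm (fst (x b) - fst (x a) - fst (x a) ** vel (\<sigma> b - \<sigma> a) v2) \<le> M * (\<sigma> b - \<sigma> a)\<^sup>2 \<and>
         \<zeta> b - \<zeta> a \<le> sqrt ((\<sigma> b - \<sigma> a)\<^sup>2 - v2\<^sup>2)"
      if ab: "0 \<le> a" "a \<le> b" "b \<le> t1" for a b
    proof -
      note d = diff[OF ab(1,2)] and ib = increment_bounds[OF k(2,1) R ab]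
      have "norm (x b - x a) \<le> norm (fst (x b - x a)) + norm (snd (x b - x a))"
        by (metis norm_Pair_le prod.collapse)
      then show "norm (x b - x a) \<le> L * (\<sigma> b - \<sigma> a)"
        using ib(1,2) by (simp add: d L_def algebra_simps)
      show "0 \<le> \<zeta> b - \<zeta> a" unfolding d using int l_bounds by (intro integral_nonneg) auto
      show "\<zeta> b - \<zeta> a \<le> \<sigma> b - \<sigma> a" unfolding d using int l_bounds by (intro integral_le) auto
      have "\<bar>integral {a..b} u2\<bar> \<le> integral {a..b} u1"
        using integral_norm_bound_integral[OF int(2) int(1)] controlledD(1)[OF ctrl] by simp
      then show "\<exists>v2. \<bar>v2\<bar> \<le> \<sigma> b - \<sigma> a \<and>
         norm (fst (x b) - fst (x a) - fst (x a) ** vel (\<sigma> b - \<sigma> a) v2) \<le> M * (\<sigma> b - \<sigma> a)\<^sup>2 \<and>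
         \<zeta> b - \<zeta> a \<le> sqrt ((\<sigma> b - \<sigma> a)\<^sup>2 - v2\<^sup>2)"
        using ib(3) integral_lorentz_le[OF int(1,2) int(3)[unfolded l_def] controlledD(1)[OF ctrl]]
        unfolding d l_def M_def by (intro exI[of _ "integral {a..b} u2"]) auto
    qed
    have "\<exists>t. 0 \<le> t \<and> t \<le> t1 \<and> \<sigma> t = r" if "0 \<le> r" "r \<le> S" for r
      using IVT'[of \<sigma> 0 r t1] that t1 \<sigma>0 indefinite_integral_continuous_1[OF int(1)]
      by (auto simp: S_def \<sigma>_def)
    then obtain \<tau> where \<tau>: "\<And>r. 0 \<le> r \<Longrightarrow> r \<le> S \<Longrightarrow> 0 \<le> \<tau> r \<and> \<tau> r \<le> t1 \<and> \<sigma> (\<tau> r) = r"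
      by metis
    \<comment> \<open>The new time \<open>\<sigma>\<close> may stand still where \<open>u1\<close>
      vanishes. Curve and length stand still there too, so the choice of the right inverse
      \<open>\<tau>\<close> does not matter.\<close>
    have same: "x a = x b \<and> \<zeta> a = \<zeta> b" if "a \<in> {0..t1}" "b \<in> {0..t1}" "\<sigma> a = \<sigma> b" for a b
    proof (cases "a \<le> b")
      case True
      then show ?thesis using est(1-3)[of a b] that by auto
    next
      case False
      then show ?thesis using est(1-3)[of b a] that by auto
    qed
    \<comment> \<open>The arc occupies only \<open>{0..S}\<close>; \<open>min r S\<close> lets it
      rest at its endpoint until the common time \<open>T\<close>. Resting is a zero velocity, which
      is why \<open>relaxed\<close> allows \<open>v1\<close> to be smaller than
      \<open>b - a\<close>.\<close>
    define y z where "y r = x (\<tau> (min r S))" and "z r = \<zeta> (\<tau> (min r S))" for r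
    have "relaxed L M T y z"
      unfolding relaxed_def
    proof (intro conjI ballI allI impI)
      show "y r \<in> USL2" if "r \<in> {0..T}" for r
        unfolding y_def by (rule USL2) (use \<tau>[of "min r S"] that S in auto)
      fix a b assume ab: "0 \<le> a \<and> a \<le> b \<and> b \<le> T"
      define a' b' where "a' = \<tau> (min a S)" and "b' = \<tau> (min b S)"
      define h where "h = min b S - min a S"
      have \<tau>a: "0 \<le> a'" "a' \<le> t1" "\<sigma> a' = min a S" and \<tau>b: "0 \<le> b'" "b' \<le> t1" "\<sigma> b' = min b S"
        using \<tau>[of "min a S"] \<tau>[of "min b S"] ab S by (auto simp: a'_def b'_def)
      have h: "\<sigma> b' - \<sigma> a' = h" "0 \<le> h" "h \<le> b - a"
        using \<tau>a \<tau>b ab by (auto simp: h_def min_def)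
      have "a' \<le> b'"
      proof (rule ccontr)
        assume "\<not> a' \<le> b'"
        then have "\<sigma> b' \<le> \<sigma> a'" using \<sigma>_mono[of b' a'] \<tau>b(1) by simp
        then have "min a S = min b S" using h \<tau>a \<tau>b by simp
        then show False using \<open>\<not> a' \<le> b'\<close> by (simp add: a'_def b'_def)
      qed
      note e = est[OF \<tau>a(1) this \<tau>b(2), unfolded h(1)]
      have "L * h \<le> L * (b - a)" using h L0 by (intro mult_left_mono) auto
      then show "norm (y b - y a) \<le> L * (b - a)"
        using e(1) by (simp add: y_def a'_def b'_def)
      show "0 \<le> z b - z a" "z b - z a \<le> b - a"
        using e(2,3) h by (simp_all add: z_def a'_def b'_def)
      have "M * h\<^sup>2 \<le> M * (b - a)\<^sup>2" using h M0 by (intro mult_left_mono power_mono) auto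
      then show "\<exists>v1 v2. \<bar>v2\<bar> \<le> v1 \<and> v1 \<le> b - a \<and>
           norm (fst (y b) - fst (y a) - fst (y a) ** vel v1 v2) \<le> M * (b - a)\<^sup>2 \<and>
           z b - z a \<le> sqrt (v1\<^sup>2 - v2\<^sup>2)"
        using e(4) h unfolding y_def z_def a'_def[symmetric] b'_def[symmetric]
        by (meson order_trans)
    qed
    moreover have "y 0 = x0" "z 0 = 0"
      using same[of "\<tau> 0" 0] \<tau>[of 0] S t1 \<sigma>0 x0 by (auto simp: y_def z_def min_absorb1)
    moreover have "y T = x1" "z T = \<zeta> t1"
      using same[of "\<tau> S" t1] \<tau>[of S] S t1 x1 by (auto simp: y_def z_def min_absorb2 S_def)
    moreover have "ennreal (\<zeta> t1) = usl2_length X1 X2 x t1"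
      unfolding length_eq by (simp add: \<zeta>_def l_def[abs_def])
    ultimately show "\<exists>y z. relaxed L M T y z \<and> y 0 = x0 \<and> y T = x1 \<and> z 0 = 0 \<and> ennreal (z T) = usl2_length X1 X2 x t1"
      by metis
  qed
qed

section \<open>Passing to the limit\<close>

lemma tendsto_vel:
  assumes "(f \<longlongrightarrow> a) F" "(g \<longlongrightarrow> b) F"
  shows "((\<lambda>n. vel (f n) (g n)) \<longlongrightarrow> vel a b) F"
  unfolding vel_def using assms by (intro tendsto_intros)

text \<open>The cone cut off at height \<open>h\<close> is compact; it supplies the velocities of
  limit curves.\<close>

lemma cone_seq_subseq:
  fixes v1 v2 :: "nat \<Rightarrow> real"
  assumes "\<And>n. \<bar>v2 n\<bar> \<le> v1 n" "\<And>n. v1 n \<le> h"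
  obtains r w1 w2 where "strict_mono r" "(\<lambda>n. v1 (r n)) \<longlonglongrightarrow> w1" "(\<lambda>n. v2 (r n)) \<longlonglongrightarrow> w2"
    "\<bar>w2\<bar> \<le> w1" "w1 \<le> h"
proof -
  have mem: "\<forall>n. (v1 n, v2 n) \<in> {0..h} \<times> {-h..h}"
  proof
    show "(v1 n, v2 n) \<in> {0..h} \<times> {-h..h}" for n using assms(1)[of n] assms(2)[of n] by auto
  qed
  have "seq_compact ({0..h} \<times> {-h..h})" by (intro compact_imp_seq_compact compact_Times compact_Icc)
  from seq_compactE[OF this mem] obtain w r
    where r: "strict_mono r" "((\<lambda>n. (v1 n, v2 n)) \<circ> r) \<longlonglongrightarrow> w" .
  have w: "(\<lambda>n. v1 (r n)) \<longlonglongrightarrow> fst w" "(\<lambda>n. v2 (r n)) \<longlonglongrightarrow> snd w"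
    using tendsto_fst[OF r(2)] tendsto_snd[OF r(2)] by (simp_all add: comp_def)
  moreover have "\<bar>snd w\<bar> \<le> fst w"
    by (rule LIMSEQ_le[OF tendsto_rabs[OF w(2)] w(1)]) (use assms in auto)
  moreover have "fst w \<le> h"
    by (rule LIMSEQ_le_const2[OF w(1)]) (use assms in auto)
  ultimately show thesis using that r(1) by blast
qed

lemma USL2_limit:
  assumes "\<And>n. y n \<in> USL2" "y \<longlonglongrightarrow> l"
  shows "l \<in> USL2"
proof -
  define g \<theta> where "g n = fst (y n)" and "\<theta> n = snd (y n)" for n
  have gl: "(\<lambda>n. g n $ i $ j) \<longlonglongrightarrow> fst l $ i $ j" for i j
    unfolding g_def by (intro tendsto_vec_nth tendsto_fst assms)
  have tl: "\<theta> \<longlonglongrightarrow> snd l" unfolding \<theta>_def by (intro tendsto_snd assms)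
  have U: "det (g n) = 1 \<and> g n $ 1 $ 1 * sin (\<theta> n) = g n $ 2 $ 1 * cos (\<theta> n) \<and>
     0 \<le> g n $ 1 $ 1 * cos (\<theta> n) + g n $ 2 $ 1 * sin (\<theta> n)" for n
    using assms(1)[of n] USL2_iff[of "g n" "\<theta> n"] by (simp add: g_def \<theta>_def)
  have "(\<lambda>n. det (g n)) \<longlonglongrightarrow> det (fst l)"
    unfolding det_2 by (intro tendsto_intros gl)
  then have "det (fst l) = 1" using U by (simp add: LIMSEQ_const_iff)
  moreover have "(\<lambda>n. g n $ 1 $ 1 * sin (\<theta> n)) \<longlonglongrightarrow> fst l $ 1 $ 1 * sin (snd l)"
    "(\<lambda>n. g n $ 2 $ 1 * cos (\<theta> n)) \<longlonglongrightarrow> fst l $ 2 $ 1 * cos (snd l)"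
    by (intro tendsto_intros gl tl)+
  then have "fst l $ 1 $ 1 * sin (snd l) = fst l $ 2 $ 1 * cos (snd l)"
    using U LIMSEQ_unique by simp
  moreover have "(\<lambda>n. g n $ 1 $ 1 * cos (\<theta> n) + g n $ 2 $ 1 * sin (\<theta> n)) \<longlonglongrightarrow>
      fst l $ 1 $ 1 * cos (snd l) + fst l $ 2 $ 1 * sin (snd l)"
    by (intro tendsto_intros gl tl)
  then have "0 \<le> fst l $ 1 $ 1 * cos (snd l) + fst l $ 2 $ 1 * sin (snd l)"
    by (rule LIMSEQ_le_const) (use U in auto)
  ultimately show ?thesis using USL2_iff[of "fst l" "snd l"] by simp
qed

lemma relaxed_limit:
  assumes rel: "\<And>n. relaxed L M T (y n) (z n)"
    and ylim: "\<And>t. t \<in> {0..T} \<Longrightarrow> (\<lambda>n. y n t) \<longlonglongrightarrow> Y t"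
    and zlim: "\<And>t. t \<in> {0..T} \<Longrightarrow> (\<lambda>n. z n t) \<longlonglongrightarrow> Z t"
  shows "relaxed L M T Y Z"
  unfolding relaxed_def
proof (intro conjI ballI allI impI)
  show "Y t \<in> USL2" if "t \<in> {0..T}" for t
    by (rule USL2_limit[OF _ ylim[OF that]]) (use rel that in \<open>auto simp: relaxed_def\<close>)
  fix a b assume ab: "0 \<le> a \<and> a \<le> b \<and> b \<le> T"
  have ya: "(\<lambda>n. y n a) \<longlonglongrightarrow> Y a" and yb: "(\<lambda>n. y n b) \<longlonglongrightarrow> Y b"
    and za: "(\<lambda>n. z n a) \<longlonglongrightarrow> Z a" and zb: "(\<lambda>n. z n b) \<longlonglongrightarrow> Z b"
    using ab by (auto intro!: ylim zlim)
  have R: "norm (y n b - y n a) \<le> L * (b - a)" "0 \<le> z n b - z n a" "z n b - z n a \<le> b - a"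
    "\<exists>v1 v2. \<bar>v2\<bar> \<le> v1 \<and> v1 \<le> b - a \<and>
       norm (fst (y n b) - fst (y n a) - fst (y n a) ** vel v1 v2) \<le> M * (b - a)\<^sup>2 \<and>
       z n b - z n a \<le> sqrt (v1\<^sup>2 - v2\<^sup>2)" for n
    using rel[of n] ab by (auto simp: relaxed_def)
  show "norm (Y b - Y a) \<le> L * (b - a)"
    by (rule LIMSEQ_le_const2[OF tendsto_norm[OF tendsto_diff[OF yb ya]]]) (use R in auto)
  show "0 \<le> Z b - Z a" by (rule LIMSEQ_le_const[OF tendsto_diff[OF zb za]]) (use R in auto)
  show "Z b - Z a \<le> b - a" by (rule LIMSEQ_le_const2[OF tendsto_diff[OF zb za]]) (use R in auto)
  from choice[OF allI[OF R(4)]] obtain v1 where "\<forall>n. \<exists>v2. \<bar>v2\<bar> \<le> v1 n \<and> v1 n \<le> b - a \<and>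
       norm (fst (y n b) - fst (y n a) - fst (y n a) ** vel (v1 n) v2) \<le> M * (b - a)\<^sup>2 \<and>
       z n b - z n a \<le> sqrt ((v1 n)\<^sup>2 - v2\<^sup>2)" ..
  from choice[OF this] obtain v2 where v: "\<And>n. \<bar>v2 n\<bar> \<le> v1 n" "\<And>n. v1 n \<le> b - a"
    "\<And>n. norm (fst (y n b) - fst (y n a) - fst (y n a) ** vel (v1 n) (v2 n)) \<le> M * (b - a)\<^sup>2"
    "\<And>n. z n b - z n a \<le> sqrt ((v1 n)\<^sup>2 - (v2 n)\<^sup>2)"
    by blast
  \<comment> \<open>The subsequence may depend on \<open>a\<close> and \<open>b\<close>: curve and
    length converge along the full sequence, so only the witness for this one pair is
    affected.\<close>
  obtain r w1 w2 where r: "strict_mono r" and w: "(\<lambda>n. v1 (r n)) \<longlonglongrightarrow> w1" "(\<lambda>n. v2 (r n)) \<longlonglongrightarrow> w2"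
    "\<bar>w2\<bar> \<le> w1" "w1 \<le> b - a"
    by (rule cone_seq_subseq[OF v(1,2)])
  have sub: "(\<lambda>n. f (r n)) \<longlonglongrightarrow> l" if "f \<longlonglongrightarrow> l" for f and l :: "'z::topological_space"
    using LIMSEQ_subseq_LIMSEQ[OF that r] by (simp add: comp_def)
  have "(\<lambda>n. norm (fst (y (r n) b) - fst (y (r n) a) - fst (y (r n) a) ** vel (v1 (r n)) (v2 (r n))))
      \<longlonglongrightarrow> norm (fst (Y b) - fst (Y a) - fst (Y a) ** vel w1 w2)"
    by (intro tendsto_norm tendsto_diff tendsto_fst bounded_bilinear.tendsto[OF bounded_bilinear_matrix_mult]
        tendsto_vel w sub[OF ya] sub[OF yb])
  then have "norm (fst (Y b) - fst (Y a) - fst (Y a) ** vel w1 w2) \<le> M * (b - a)\<^sup>2"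
    by (rule LIMSEQ_le_const2) (use v in auto)
  moreover have "Z b - Z a \<le> sqrt (w1\<^sup>2 - w2\<^sup>2)"
  proof (rule LIMSEQ_le)
    show "(\<lambda>n. z (r n) b - z (r n) a) \<longlonglongrightarrow> Z b - Z a" by (intro tendsto_diff sub[OF za] sub[OF zb])
    show "(\<lambda>n. sqrt ((v1 (r n))\<^sup>2 - (v2 (r n))\<^sup>2)) \<longlonglongrightarrow> sqrt (w1\<^sup>2 - w2\<^sup>2)" by (intro tendsto_intros w)
  qed (use v in auto)
  ultimately show "\<exists>v1 v2. \<bar>v2\<bar> \<le> v1 \<and> v1 \<le> b - a \<and>
       norm (fst (Y b) - fst (Y a) - fst (Y a) ** vel v1 v2) \<le> M * (b - a)\<^sup>2 \<and>
       Z b - Z a \<le> sqrt (v1\<^sup>2 - v2\<^sup>2)"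
    using w(3,4) by blast
qed

text \<open>Dividing the increment over \<open>h\<close> by \<open>h\<close> puts
  \<open>(v1 / h, v2 / h)\<close> into the cone cut off at height 1 and leaves an error
  \<open>M * h\<close>. A limit point of these pairs represents the derivative, and homogeneity of
  the square root transfers the bound on \<open>z\<close>.\<close>

lemma relaxed_derivative:
  assumes rel: "relaxed L M T y z" and t: "t \<in> {0<..<T}"
    and dy: "((\<lambda>t. fst (y t)) has_vector_derivative d) (at t)"
    and dz: "(z has_vector_derivative e) (at t)"
  obtains w1 w2 where "\<bar>w2\<bar> \<le> w1" "d = fst (y t) ** vel w1 w2" "0 \<le> e" "e \<le> sqrt (w1\<^sup>2 - w2\<^sup>2)"
proof -
  \<comment> \<open>Positive steps that stay inside \<open>{0..T}\<close>. One-sided quotients along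
    a sequence suffice, since both derivatives are assumed to exist.\<close>
  define h where "h n = (T - t) / real (Suc n)" for n
  have h: "0 < h n" "t + h n \<le> T" for n
  proof -
    show "0 < h n" using t by (simp add: h_def)
    have "h n \<le> (T - t) / 1" unfolding h_def using t by (intro divide_left_mono) auto
    then show "t + h n \<le> T" by simp
  qed
  have h0: "h \<longlonglongrightarrow> 0"
    using tendsto_mult[OF tendsto_const[of "T - t"] LIMSEQ_inverse_real_of_nat]
    by (simp add: h_def[abs_def] divide_inverse)
  have hat: "filterlim h (at 0) sequentially"
    by (rule filterlim_atI[OF h0]) (use h(1) in \<open>auto simp: less_imp_neq[symmetric]\<close>)
  define dq where "dq n = (fst (y (t + h n)) - fst (y t)) /\<^sub>R h n" for n
  define ez where "ez n = (z (t + h n) - z t) /\<^sub>R h n" for n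
  have dlim: "dq \<longlonglongrightarrow> d"
    unfolding dq_def by (rule filterlim_compose[OF has_vector_derivative_quotient[OF dy] hat])
  have elim: "ez \<longlonglongrightarrow> e"
    unfolding ez_def by (rule filterlim_compose[OF has_vector_derivative_quotient[OF dz] hat])
  have R: "0 \<le> z (t + h n) - z t"
    "\<exists>v1 v2. \<bar>v2\<bar> \<le> v1 \<and> v1 \<le> h n \<and>
       norm (fst (y (t + h n)) - fst (y t) - fst (y t) ** vel v1 v2) \<le> M * (h n)\<^sup>2 \<and>
       z (t + h n) - z t \<le> sqrt (v1\<^sup>2 - v2\<^sup>2)" for n
  proof -
    have "0 \<le> t \<and> t \<le> t + h n \<and> t + h n \<le> T" using t h[of n] by simp
    then have "0 \<le> z (t + h n) - z t \<and>
      (\<exists>v1 v2. \<bar>v2\<bar> \<le> v1 \<and> v1 \<le> t + h n - t \<and>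
       norm (fst (y (t + h n)) - fst (y t) - fst (y t) ** vel v1 v2) \<le> M * (t + h n - t)\<^sup>2 \<and>
       z (t + h n) - z t \<le> sqrt (v1\<^sup>2 - v2\<^sup>2))"
      using rel unfolding relaxed_def by blast
    then show "0 \<le> z (t + h n) - z t"
      "\<exists>v1 v2. \<bar>v2\<bar> \<le> v1 \<and> v1 \<le> h n \<and>
       norm (fst (y (t + h n)) - fst (y t) - fst (y t) ** vel v1 v2) \<le> M * (h n)\<^sup>2 \<and>
       z (t + h n) - z t \<le> sqrt (v1\<^sup>2 - v2\<^sup>2)"
      by simp_all
  qed
  have "\<exists>v1 v2. \<bar>v2\<bar> \<le> v1 \<and> v1 \<le> 1 \<and> norm (dq n - fst (y t) ** vel v1 v2) \<le> M * h n \<and>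
       ez n \<le> sqrt (v1\<^sup>2 - v2\<^sup>2)" for n
  proof -
    obtain v1 v2 where v: "\<bar>v2\<bar> \<le> v1" "v1 \<le> h n"
       "norm (fst (y (t + h n)) - fst (y t) - fst (y t) ** vel v1 v2) \<le> M * (h n)\<^sup>2"
       "z (t + h n) - z t \<le> sqrt (v1\<^sup>2 - v2\<^sup>2)"
      using R(2)[of n] by blast
    have "vel (v1 / h n) (v2 / h n) = vel v1 v2 /\<^sub>R h n"
      by (simp add: vel_def scaleR_add_right divide_inverse mult.commute)
    then have "dq n - fst (y t) ** vel (v1 / h n) (v2 / h n)
        = (fst (y (t + h n)) - fst (y t) - fst (y t) ** vel v1 v2) /\<^sub>R h n"
      by (simp add: dq_def matrix_scaleR_right scaleR_diff_right)
    then have "norm (dq n - fst (y t) ** vel (v1 / h n) (v2 / h n)) \<le> M * (h n)\<^sup>2 / h n"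
      using v(3) h(1)[of n] by (simp add: divide_inverse mult.commute)
    then have 1: "norm (dq n - fst (y t) ** vel (v1 / h n) (v2 / h n)) \<le> M * h n"
      using h(1)[of n] by (simp add: power2_eq_square)
    have "sqrt ((v1 / h n)\<^sup>2 - (v2 / h n)\<^sup>2) = sqrt ((v1\<^sup>2 - v2\<^sup>2) / (h n)\<^sup>2)"
      by (simp add: power_divide diff_divide_distrib)
    also have "\<dots> = sqrt (v1\<^sup>2 - v2\<^sup>2) / h n" using h(1)[of n] by (simp add: real_sqrt_divide)
    finally have 2: "ez n \<le> sqrt ((v1 / h n)\<^sup>2 - (v2 / h n)\<^sup>2)"
      using v(4) h(1)[of n] by (simp add: ez_def divide_inverse mult.commute)
    have "\<bar>v2 / h n\<bar> \<le> v1 / h n" "v1 / h n \<le> 1"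
      using v(1,2) h(1)[of n] by (simp_all add: abs_divide divide_right_mono)
    then show ?thesis using 1 2 by blast
  qed
  from choice[OF allI[OF this]] obtain v1 where "\<forall>n. \<exists>v2. \<bar>v2\<bar> \<le> v1 n \<and> v1 n \<le> 1 \<and>
       norm (dq n - fst (y t) ** vel (v1 n) v2) \<le> M * h n \<and> ez n \<le> sqrt ((v1 n)\<^sup>2 - v2\<^sup>2)" ..
  from choice[OF this] obtain v2 where v: "\<And>n. \<bar>v2 n\<bar> \<le> v1 n" "\<And>n. v1 n \<le> 1"
    "\<And>n. norm (dq n - fst (y t) ** vel (v1 n) (v2 n)) \<le> M * h n"
    "\<And>n. ez n \<le> sqrt ((v1 n)\<^sup>2 - (v2 n)\<^sup>2)"
    by blast
  obtain r w1 w2 where r: "strict_mono r" and w: "(\<lambda>n. v1 (r n)) \<longlonglongrightarrow> w1" "(\<lambda>n. v2 (r n)) \<longlonglongrightarrow> w2"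
    "\<bar>w2\<bar> \<le> w1" "w1 \<le> 1"
    by (rule cone_seq_subseq[OF v(1,2)])
  have sub: "(\<lambda>n. f (r n)) \<longlonglongrightarrow> l" if "f \<longlonglongrightarrow> l" for f and l :: "'z::topological_space"
    using LIMSEQ_subseq_LIMSEQ[OF that r] by (simp add: comp_def)
  have "(\<lambda>n. norm (dq (r n) - fst (y t) ** vel (v1 (r n)) (v2 (r n)))) \<longlonglongrightarrow> norm (d - fst (y t) ** vel w1 w2)"
    by (intro tendsto_norm tendsto_diff bounded_bilinear.tendsto[OF bounded_bilinear_matrix_mult]
        tendsto_vel tendsto_const w sub[OF dlim])
  moreover have "(\<lambda>n. M * h (r n)) \<longlonglongrightarrow> M * 0" by (intro tendsto_intros sub[OF h0])
  ultimately have "norm (d - fst (y t) ** vel w1 w2) \<le> M * 0"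
    by (rule LIMSEQ_le) (use v in auto)
  then have "d = fst (y t) ** vel w1 w2" by simp
  moreover have "0 \<le> e"
    by (rule LIMSEQ_le_const[OF elim]) (use R(1) h(1) in \<open>auto simp: ez_def less_imp_le\<close>)
  moreover have "e \<le> sqrt (w1\<^sup>2 - w2\<^sup>2)"
  proof (rule LIMSEQ_le[OF sub[OF elim]])
    show "(\<lambda>n. sqrt ((v1 (r n))\<^sup>2 - (v2 (r n))\<^sup>2)) \<longlonglongrightarrow> sqrt (w1\<^sup>2 - w2\<^sup>2)" by (intro tendsto_intros w)
  qed (use v in auto)
  ultimately show thesis using that w(3) by blast
qed

text \<open>The curve and \<open>z\<close> are Lipschitz, so a.e. both derivatives exist and
  \<open>relaxed_derivative\<close> applies. The angle is carried by membership in
  \<open>USL2\<close> and the Lipschitz bound. Integrating \<open>z'\<close>, which is at most the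
  Lorentzian speed, compares lengths.\<close>

lemma relaxed_admissible:
  assumes rel: "relaxed L M T y z" and T: "T > 0" and L: "L \<ge> 0"
  shows "usl2_admissible X1 X2 y T" "ennreal (z T - z 0) \<le> usl2_length X1 X2 y T"
proof -
  have U: "y t \<in> USL2" if "t \<in> {0..T}" for t using rel that by (simp add: relaxed_def)
  have det: "det (fst (y t)) = 1" if "t \<in> {0..T}" for t
    using U[OF that] by (auto simp: USL2_def SL2_def)
  have inc: "norm (y b - y a) \<le> L * (b - a)" "0 \<le> z b - z a" "z b - z a \<le> b - a"
    if "0 \<le> a" "a \<le> b" "b \<le> T" for a b
    using rel that by (auto simp: relaxed_def)
  have ylip: "L-lipschitz_on {0..T} y"
    by (rule lipschitz_on_leI) (use inc(1) L in \<open>auto simp: dist_norm norm_minus_commute\<close>)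
  have glip: "L-lipschitz_on {0..T} (\<lambda>t. fst (y t))"
    by (rule lipschitz_on_leI_dist[OF ylip dist_fst_le])
  have zlip: "1-lipschitz_on {0..T} z"
  proof (rule lipschitz_on_leI)
    fix a b assume "a \<in> {0..T}" "b \<in> {0..T}" "a \<le> b"
    then show "dist (z a) (z b) \<le> 1 * dist a b"
      using inc(2,3)[of a b] by (simp add: dist_real_def)
  qed simp
  obtain d where d: "AE t in lborel. t \<in> {0..T} \<longrightarrow> ((\<lambda>t. fst (y t)) has_vector_derivative d t) (at t)"
    by (rule lipschitz_interval_AE_derivative[OF glip]) blast
  obtain e where e: "AE t in lborel. t \<in> {0..T} \<longrightarrow> (z has_vector_derivative e t) (at t)"
    by (rule lipschitz_interval_AE_derivative[OF zlip]) blast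
  have "AE t in lborel. t \<noteq> 0" "AE t in lborel. t \<noteq> T" by (rule AE_lborel_singleton)+
  with d e have key: "AE t in lborel. t \<in> {0..T} \<longrightarrow> (\<exists>w1 w2. \<bar>w2\<bar> \<le> w1 \<and>
      ((\<lambda>t. fst (y t)) has_vector_derivative fst (y t) ** vel w1 w2) (at t) \<and>
      (z has_vector_derivative e t) (at t) \<and> 0 \<le> e t \<and> e t \<le> sqrt (w1\<^sup>2 - w2\<^sup>2))"
  proof eventually_elim
    case (elim t)
    show ?case
    proof
      assume t: "t \<in> {0..T}"
      then have t': "t \<in> {0<..<T}" using elim(3,4) by simp
      have dy: "((\<lambda>t. fst (y t)) has_vector_derivative d t) (at t)"
        and dz: "(z has_vector_derivative e t) (at t)" using elim(1,2) t by blast+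
      obtain w1 w2 where "\<bar>w2\<bar> \<le> w1" "d t = fst (y t) ** vel w1 w2" "0 \<le> e t" "e t \<le> sqrt (w1\<^sup>2 - w2\<^sup>2)"
        by (rule relaxed_derivative[OF rel t' dy dz])
      then show "\<exists>w1 w2. \<bar>w2\<bar> \<le> w1 \<and>
        ((\<lambda>t. fst (y t)) has_vector_derivative fst (y t) ** vel w1 w2) (at t) \<and>
        (z has_vector_derivative e t) (at t) \<and> 0 \<le> e t \<and> e t \<le> sqrt (w1\<^sup>2 - w2\<^sup>2)"
        using dy dz by (intro exI[of _ w1] exI[of _ w2]) simp
    qed
  qed
  have "AE t in lborel. t \<in> {0..T} \<longrightarrow>
        (fst \<circ> y) differentiable (at t) \<and> li_cone X1 X2 ((fst \<circ> y) t) (vector_derivative (fst \<circ> y) (at t))"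
    using key
  proof eventually_elim
    case (elim t)
    show ?case
    proof
      assume "t \<in> {0..T}"
      then obtain w1 w2 where w: "\<bar>w2\<bar> \<le> w1"
        "((fst \<circ> y) has_vector_derivative fst (y t) ** vel w1 w2) (at t)"
        using elim by (auto simp: comp_def)
      have "w2\<^sup>2 \<le> w1\<^sup>2" "0 \<le> w1" using w(1) by (auto simp: abs_le_square_iff[symmetric])
      then have "li_cone X1 X2 ((fst \<circ> y) t) (fst (y t) ** vel w1 w2)"
        unfolding li_cone_def vel_def by (intro exI[of _ w1] exI[of _ w2]) simp
      then show "(fst \<circ> y) differentiable (at t) \<and> li_cone X1 X2 ((fst \<circ> y) t) (vector_derivative (fst \<circ> y) (at t))"
        using w(2) vector_derivative_at[OF w(2)] by (auto intro: differentiableI_vector)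
    qed
  qed
  moreover have "L-lipschitz_on {0..T} (fst \<circ> y)" using glip by (simp add: comp_def)
  ultimately show "usl2_admissible X1 X2 y T"
    using T ylip U det unfolding usl2_admissible_def li_admissible_def SL2_def by auto
  \<comment> \<open>\<open>e\<close> is known to be nonnegative only a.e.; the maximum makes it so
    everywhere, as needed to convert the integral into a nonnegative one.\<close>
  have "AE t in lborel. t \<in> {0..T} \<longrightarrow> (z has_vector_derivative max 0 (e t)) (at t)"
    using key by eventually_elim (auto simp: max_absorb2)
  from lipschitz_FTC[OF zlip this, of 0 T]
  have "((\<lambda>t. max 0 (e t)) has_integral (z T - z 0)) {0..T}" using T by simp
  then have "ennreal (z T - z 0) = (\<integral>\<^sup>+ t. ennreal (max 0 (e t)) * indicator {0..T} t \<partial>lborel)"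
    by (intro nn_integral_has_integral_lebesgue'[symmetric]) auto
  also have "\<dots> \<le> usl2_length X1 X2 y T"
    unfolding usl2_length_def li_length_def
  proof (rule nn_integral_mono_AE)
    show "AE t in lborel. ennreal (max 0 (e t)) * indicator {0..T} t \<le>
        ennreal (sqrt \<bar>li_q X1 X2 ((fst \<circ> y) t) (vector_derivative (fst \<circ> y) (at t))\<bar>) * indicator {0..T} t"
      using key
    proof eventually_elim
      case (elim t)
      show ?case
      proof (cases "t \<in> {0..T}")
        case True
        then obtain w1 w2 where w: "\<bar>w2\<bar> \<le> w1"
          "((fst \<circ> y) has_vector_derivative fst (y t) ** vel w1 w2) (at t)" "0 \<le> e t" "e t \<le> sqrt (w1\<^sup>2 - w2\<^sup>2)"
          using elim by (auto simp: comp_def)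
        have "w2\<^sup>2 \<le> w1\<^sup>2" using w(1) by (simp add: abs_le_square_iff[symmetric])
        moreover have "li_q X1 X2 ((fst \<circ> y) t) (vector_derivative (fst \<circ> y) (at t)) = w2\<^sup>2 - w1\<^sup>2"
          unfolding vector_derivative_at[OF w(2)] using li_coords_vel[OF det[OF True]] by (simp add: li_q_def)
        ultimately have "sqrt \<bar>li_q X1 X2 ((fst \<circ> y) t) (vector_derivative (fst \<circ> y) (at t))\<bar> = sqrt (w1\<^sup>2 - w2\<^sup>2)"
          by (simp add: abs_if)
        then show ?thesis using w(3,4) by (auto simp: max_absorb2 intro!: mult_right_mono ennreal_leI)
      qed simp
    qed
  qed
  finally show "ennreal (z T - z 0) \<le> usl2_length X1 X2 y T" .
qed

section \<open>Existence of a longest arc\<close>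

lemma attainable_imp_longest_arc:
  assumes att: "attainable (usl2_admissible X1 X2) x0 x1"
  shows "\<exists>x t1. longest_arc (usl2_admissible X1 X2) (usl2_length X1 X2) x0 x1 x t1"
proof -
  define arcs where "arcs = {(x, t1). usl2_admissible X1 X2 x t1 \<and> x 0 = x0 \<and> x t1 = x1}"
  define len where "len p = usl2_length X1 X2 (fst p) (snd p)" for p
  define D where "D = sL_dist (usl2_admissible X1 X2) (usl2_length X1 X2) x0 x1"
  have D: "D = Sup (len ` arcs)" by (simp add: D_def sL_dist_def arcs_def len_def[abs_def])
  obtain L M T where T: "T > 0" and L: "L \<ge> 0" and rel:
    "\<And>x t1. usl2_admissible X1 X2 x t1 \<Longrightarrow> x 0 = x0 \<Longrightarrow> x t1 = x1 \<Longrightarrow>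
      \<exists>y z. relaxed L M T y z \<and> y 0 = x0 \<and> y T = x1 \<and> z 0 = 0 \<and> ennreal (z T) = usl2_length X1 X2 x t1"
    by (rule admissible_relaxed[of x0 x1]) (rule that; assumption)
  have "len ` arcs \<noteq> {}" using att by (auto simp: attainable_def arcs_def)
  from ennreal_Sup_countable_SUP[OF this] obtain f :: "nat \<Rightarrow> ennreal"
    where f: "incseq f" "range f \<subseteq> len ` arcs" "D = (SUP n. f n)" unfolding D by blast
  have "\<exists>y z. relaxed L M T y z \<and> y 0 = x0 \<and> y T = x1 \<and> z 0 = 0 \<and> ennreal (z T) = f n" for n
  proof -
    obtain p where "p \<in> arcs" "f n = len p" using f(2) by blast
    then show ?thesis using rel[of "fst p" "snd p"] by (auto simp: arcs_def len_def)
  qed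
  from choice[OF allI[OF this]] obtain y where "\<forall>n. \<exists>z. relaxed L M T (y n) z \<and> y n 0 = x0 \<and> y n T = x1 \<and>
      z 0 = 0 \<and> ennreal (z T) = f n" ..
  from choice[OF this] obtain z where yz: "\<And>n. relaxed L M T (y n) (z n)" "\<And>n. y n 0 = x0" "\<And>n. y n T = x1"
    "\<And>n. z n 0 = 0" "\<And>n. ennreal (z n T) = f n" by blast
  have inc: "norm (y n b - y n a) \<le> L * (b - a)" "0 \<le> z n b - z n a" "z n b - z n a \<le> b - a"
    if "0 \<le> a" "a \<le> b" "b \<le> T" for a b n
    using yz(1)[of n] that by (auto simp: relaxed_def)
  \<comment> \<open>Pairing each curve with its accumulated length lets one application of
    Arzela-Ascoli extract a common subsequence for both.\<close>
  define F where "F n t = (y n t, z n t)" for n t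
  have Finc: "norm (F n b - F n a) \<le> (L + 1) * (b - a)" if "0 \<le> a" "a \<le> b" "b \<le> T" for a b n
  proof -
    have "norm (F n b - F n a) \<le> norm (y n b - y n a) + norm (z n b - z n a)"
      unfolding F_def diff_Pair by (rule norm_Pair_le)
    then show ?thesis using inc[OF that, of n] by (simp add: algebra_simps)
  qed
  have Fdist: "norm (F n a - F n b) \<le> (L + 1) * \<bar>a - b\<bar>" if "a \<in> {0..T}" "b \<in> {0..T}" for a b n
  proof (cases "a \<le> b")
    case True
    then show ?thesis using Finc[of a b n] that by (simp add: norm_minus_commute)
  next
    case False
    then show ?thesis using Finc[of b a n] that by simp
  qed
  obtain G r where r: "strict_mono (r :: nat \<Rightarrow> nat)"
    and G: "\<And>\<epsilon>. 0 < \<epsilon> \<Longrightarrow> \<exists>N. \<forall>n t. n \<ge> N \<and> t \<in> {0..T} \<longrightarrow> norm (F (r n) t - G t) < \<epsilon>"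
  proof (rule Arzela_Ascoli[of "{0..T}" F "norm (x0, 0::real) + (L + 1) * T"])
    show "norm (F n t) \<le> norm (x0, 0::real) + (L + 1) * T" if "t \<in> {0..T}" for n t
    proof -
      have "F n 0 = (x0, 0)" using yz by (simp add: F_def)
      moreover have "norm (F n t) \<le> norm (F n 0) + norm (F n t - F n 0)"
        by (metis add_diff_cancel_left' diff_add_cancel norm_triangle_ineq)
      moreover have "norm (F n t - F n 0) \<le> (L + 1) * (t - 0)" using that by (intro Finc) auto
      moreover have "(L + 1) * (t - 0) \<le> (L + 1) * T" using that L by (intro mult_left_mono) auto
      ultimately show ?thesis by simp
    qed
    show "\<exists>\<delta>>0. \<forall>n b. b \<in> {0..T} \<and> norm (a - b) < \<delta> \<longrightarrow> norm (F n a - F n b) < \<epsilon>"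
      if a: "a \<in> {0..T}" and "0 < \<epsilon>" for a \<epsilon>
    proof (intro exI[of _ "\<epsilon> / (L + 1)"] conjI allI impI)
      show "0 < \<epsilon> / (L + 1)" using L \<open>0 < \<epsilon>\<close> by simp
      fix n b assume b: "b \<in> {0..T} \<and> norm (a - b) < \<epsilon> / (L + 1)"
      have "norm (F n a - F n b) \<le> (L + 1) * \<bar>a - b\<bar>" using Fdist a b by blast
      also have "\<dots> < \<epsilon>" using b L by (simp add: pos_less_divide_eq mult.commute)
      finally show "norm (F n a - F n b) < \<epsilon>" .
    qed
  qed (auto intro: that)
  have lim: "(\<lambda>n. F (r n) t) \<longlonglongrightarrow> G t" if "t \<in> {0..T}" for t
    unfolding LIMSEQ_iff using G that by meson
  define Y Z where "Y t = fst (G t)" and "Z t = snd (G t)" for t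
  have Ylim: "(\<lambda>n. y (r n) t) \<longlonglongrightarrow> Y t" and Zlim: "(\<lambda>n. z (r n) t) \<longlonglongrightarrow> Z t" if "t \<in> {0..T}" for t
    using tendsto_fst[OF lim[OF that]] tendsto_snd[OF lim[OF that]] by (simp_all add: F_def Y_def Z_def)
  have relY: "relaxed L M T Y Z" by (rule relaxed_limit[OF yz(1) Ylim Zlim])
  have "Y 0 = x0" "Y T = x1" "Z 0 = 0"
    using Ylim[of 0] Ylim[of T] Zlim[of 0] T yz by (simp_all add: LIMSEQ_const_iff)
  note adm = relaxed_admissible[OF relY T L]
  have "(\<lambda>n. ennreal (z (r n) T)) \<longlonglongrightarrow> ennreal (Z T)"
    using Zlim[of T] T by (intro tendsto_ennrealI) auto
  moreover have "(\<lambda>n. f (r n)) \<longlonglongrightarrow> D"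
    using LIMSEQ_subseq_LIMSEQ[OF LIMSEQ_SUP[OF f(1)] r] by (simp add: f(3) comp_def)
  \<comment> \<open>The supremum was taken in \<open>ennreal\<close>, so its finiteness is a result
    of this step: it is the limit of real numbers \<open>z (r n) T\<close> that converge to
    \<open>Z T\<close>.\<close>
  ultimately have DZ: "D = ennreal (Z T)" using yz(5) LIMSEQ_unique by simp
  have "(Y, T) \<in> arcs" using adm(1) \<open>Y 0 = x0\<close> \<open>Y T = x1\<close> by (simp add: arcs_def)
  then have "len (Y, T) \<le> D" unfolding D by (intro Sup_upper imageI)
  moreover have "D \<le> len (Y, T)" using adm(2) by (simp add: DZ len_def \<open>Z 0 = 0\<close>)
  ultimately have "usl2_length X1 X2 Y T = D" by (simp add: len_def)
  then have "longest_arc (usl2_admissible X1 X2) (usl2_length X1 X2) x0 x1 Y T"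
    unfolding longest_arc_def D_def[symmetric]
    using adm(1) \<open>Y 0 = x0\<close> \<open>Y T = x1\<close> by (simp add: DZ)
  then show ?thesis by blast
qed

end

theorem theorem1:
  fixes kap chi :: real
  shows
  "(kap < chi \<and> chi < 0 \<longrightarrow>
      (\<exists>X1 X2 X3. g_frame sl2_alg kap chi X1 X2 X3) \<and>
      (\<forall>X1 X2 X3. g_frame sl2_alg kap chi X1 X2 X3 \<longrightarrow>
        (\<forall>x0\<in>USL2. \<forall>x1\<in>USL2.
           (\<exists>x t1. longest_arc (usl2_admissible X1 X2) (usl2_length X1 X2) x0 x1 x t1)
           \<longleftrightarrow> attainable (usl2_admissible X1 X2) x0 x1)))
   \<and>
   (chi < 0 \<and> \<bar>kap\<bar> < - chi \<longrightarrow>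
      (\<exists>X1 X2 X3. g_frame su2_alg kap chi X1 X2 X3) \<and>
      (\<forall>X1 X2 X3. g_frame su2_alg kap chi X1 X2 X3 \<longrightarrow>
        (\<forall>x0\<in>SU2. \<forall>x1\<in>SU2. attainable (li_admissible SU2 X1 X2) x0 x1 \<longrightarrow>
           sL_dist (li_admissible SU2 X1 X2) (li_length X1 X2) x0 x1 = \<infinity> \<and>
           \<not> (\<exists>x t1. longest_arc (li_admissible SU2 X1 X2) (li_length X1 X2) x0 x1 x t1))))"
proof (intro conjI impI allI ballI)
  assume *: "kap < chi \<and> chi < 0"
  then show "\<exists>X1 X2 X3. g_frame sl2_alg kap chi X1 X2 X3" by (intro sl2_alg_frame) auto
  fix X1 X2 X3 x0 x1 assume frame: "g_frame sl2_alg kap chi X1 X2 X3"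
  obtain s c :: real where "\<bar>s\<bar> = 1" "c > 0"
    "\<And>u1 u2 z w. \<bar>u2\<bar> \<le> u1 \<Longrightarrow> c * u1 * (z\<^sup>2 + w\<^sup>2) \<le> s * angular_form (u1 *\<^sub>R X1 + u2 *\<^sub>R X2) z w"
    by (rule sl2_cone_definite[OF frame]) (use * in blast)+
  then interpret elliptic_frame kap chi X1 X2 X3 s c
    using frame by unfold_locales
  show "(\<exists>x t1. longest_arc (usl2_admissible X1 X2) (usl2_length X1 X2) x0 x1 x t1)
           \<longleftrightarrow> attainable (usl2_admissible X1 X2) x0 x1"
  proof
    assume "\<exists>x t1. longest_arc (usl2_admissible X1 X2) (usl2_length X1 X2) x0 x1 x t1"
    then show "attainable (usl2_admissible X1 X2) x0 x1"
      unfolding longest_arc_def attainable_def by blast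
  qed (rule attainable_imp_longest_arc)
next
  assume "chi < 0 \<and> \<bar>kap\<bar> < - chi"
  then show "\<exists>X1 X2 X3. g_frame su2_alg kap chi X1 X2 X3" by (intro su2_alg_frame) auto
next
  fix X1 X2 X3 x0 x1
  assume "g_frame su2_alg kap chi X1 X2 X3" "x0 \<in> SU2" "attainable (li_admissible SU2 X1 X2) x0 x1"
  then show inf: "sL_dist (li_admissible SU2 X1 X2) (li_length X1 X2) x0 x1 = \<infinity>"
    by (rule SU2_sL_dist_infinite)
  then show "\<not> (\<exists>x t1. longest_arc (li_admissible SU2 X1 X2) (li_length X1 X2) x0 x1 x t1)"
    by (simp add: longest_arc_def)
qed

end
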